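(* Let $\mathbb{A}$ be a structure with at least two elements. Then $HF(\mathbb{A})$ and $S(\mathbb{A},\mathbb{N})$ are absolutely bi-interpretable in each other.
   Context: $HF(\mathbb{A})=\langle HF(A);L,P_A,\in\rangle$, where $HF_0(A)=A$, $HF_{k+1}(A)=HF_k(A)\cup\{\text{finite subsets of }HF_k(A)\}$, $HF(A)=\bigcup_k HF_k(A)$, the (relational, operations replaced by graphs) language $L$ of $\mathbb{A}$ is interpreted on $A$, $P_A$ is a unary predicate for $A$ and $\in$ is membership. $S(A)$ is the set of finite sequences of elements of $A$. $S(\mathbb{A},\mathbb{N})=\langle\mathbb{A},S(A),\mathbb{N};t,l,\frown,\in\rangle$ is the three-sorted structure with $\mathbb{N}=\langle\mathbb{N};+,\cdot,0,1\rangle$, $l:S(A)\to\mathbb{N}$ the length function, $\frown$ concatenation of sequences, $a\in s$ meaning $a$ is a component of $s$, and $t(s,i,a)$ holding iff $s=(s_1,\dots,s_m)$, $1\leq i\leq m$ and $a=s_i$ (multi-sorted structures are viewed as one-sorted with unary sort predicates). Absolute bi-interpretability: there are parameter-free interpretations of each structure in the other (codes of formulas defining a set of tuples, an equivalence relation on it and preimages of graphs of the symbols, yielding a structure isomorphic to the target via a coordinate map) such that the isomorphism from the composite self-interpretation of each structure onto the structure itself is definable without parameters in that structure. *)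

theory Defs
  imports Main "HOL-Library.FSet"
begin

section \<open>Structures\<close>

text \<open>Operation and relation symbols are elements of arbitrary types; which of them belong to
  the language, and their arities, is part of the structure.  A constant is an operation of
  arity 0.\<close>

record ('f, 'r, 'a) fo_structure =
  fo_univ :: "'a set"
  fo_ops :: "'f set"
  fo_op_arity :: "'f \<Rightarrow> nat"
  fo_op :: "'f \<Rightarrow> 'a list \<Rightarrow> 'a"
  fo_rels :: "'r set"
  fo_rel_arity :: "'r \<Rightarrow> nat"
  fo_rel :: "'r \<Rightarrow> 'a list \<Rightarrow> bool"

record ('r, 'a) rel_structure =
  univ :: "'a set"
  syms :: "'r set"
  arity :: "'r \<Rightarrow> nat"
  rel :: "'r \<Rightarrow> 'a list \<Rightarrow> bool"

definition tuples :: "'a set \<Rightarrow> nat \<Rightarrow> 'a list set" where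
  "tuples U n = {xs. length xs = n \<and> set xs \<subseteq> U}"

definition is_structure :: "('f, 'r, 'a) fo_structure \<Rightarrow> bool" where
  "is_structure A \<longleftrightarrow> fo_univ A \<noteq> {} \<and>
     (\<forall>f\<in>fo_ops A. \<forall>xs\<in>tuples (fo_univ A) (fo_op_arity A f). fo_op A f xs \<in> fo_univ A)"

text \<open>Replacing every n-ary operation by its (n+1)-ary graph.\<close>

definition graph_structure ::
  "('f, 'r, 'a) fo_structure \<Rightarrow> ('f + 'r, 'a) rel_structure" where
  "graph_structure A =
     \<lparr> univ = fo_univ A,
       syms = fo_ops A <+> fo_rels A,
       arity = case_sum (\<lambda>f. Suc (fo_op_arity A f)) (fo_rel_arity A),
       rel = case_sum (\<lambda>f xs. fo_op A f (butlast xs) = last xs) (fo_rel A) \<rparr>"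

definition structure_iso ::
  "('a \<Rightarrow> 'b) \<Rightarrow> ('r, 'a) rel_structure \<Rightarrow> ('r, 'b) rel_structure \<Rightarrow> bool" where
  "structure_iso h M N \<longleftrightarrow>
     syms M = syms N \<and> (\<forall>r\<in>syms M. arity M r = arity N r) \<and>
     bij_betw h (univ M) (univ N) \<and>
     (\<forall>r\<in>syms M. \<forall>xs\<in>tuples (univ M) (arity M r). rel M r xs \<longleftrightarrow> rel N r (map h xs))"

section \<open>First-order formulas without parameters\<close>

text \<open>Variables are de Bruijn indices: \<open>FEx\<close> binds index 0 and shifts the others.\<close>

datatype 'r fm =
    FRel 'r "nat list"
  | FEq nat nat
  | FNeg "'r fm"
  | FAnd "'r fm" "'r fm"
  | FEx "'r fm"

text \<open>\<open>formula_in M n \<phi>\<close>: \<open>\<phi>\<close> is a formula in the language of \<open>M\<close> whose free variables are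
  among the indices below \<open>n\<close>.\<close>

primrec formula_in :: "('r, 'a) rel_structure \<Rightarrow> nat \<Rightarrow> 'r fm \<Rightarrow> bool" where
  "formula_in M n (FRel r is) \<longleftrightarrow> r \<in> syms M \<and> length is = arity M r \<and> (\<forall>i\<in>set is. i < n)"
| "formula_in M n (FEq i j) \<longleftrightarrow> i < n \<and> j < n"
| "formula_in M n (FNeg p) \<longleftrightarrow> formula_in M n p"
| "formula_in M n (FAnd p q) \<longleftrightarrow> formula_in M n p \<and> formula_in M n q"
| "formula_in M n (FEx p) \<longleftrightarrow> formula_in M (Suc n) p"

text \<open>The i-th entry of the list is the value of variable i; only used for lists that are long
  enough to cover all free variables.\<close>

primrec sat :: "('r, 'a) rel_structure \<Rightarrow> 'a list \<Rightarrow> 'r fm \<Rightarrow> bool" where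
  "sat M xs (FRel r is) \<longleftrightarrow> rel M r (map ((!) xs) is)"
| "sat M xs (FEq i j) \<longleftrightarrow> xs ! i = xs ! j"
| "sat M xs (FNeg p) \<longleftrightarrow> \<not> sat M xs p"
| "sat M xs (FAnd p q) \<longleftrightarrow> sat M xs p \<and> sat M xs q"
| "sat M xs (FEx p) \<longleftrightarrow> (\<exists>a\<in>univ M. sat M (a # xs) p)"

definition definable :: "('r, 'a) rel_structure \<Rightarrow> nat \<Rightarrow> 'a list set \<Rightarrow> bool" where
  "definable M n R \<longleftrightarrow> (\<exists>p. formula_in M n p \<and> R = {xs \<in> tuples (univ M) n. sat M xs p})"

section \<open>Interpretations\<close>

text \<open>A code for interpreting structures in the symbols \<open>'r\<close> by formulas in the symbols \<open>'s\<close>.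
  A k-tuple of \<open>code_dim\<close>-tuples is passed to a formula as their concatenation.\<close>

record ('r, 's) code =
  code_dim :: nat
  code_dom :: "'s fm"
  code_eq :: "'s fm"
  code_rel :: "'r \<Rightarrow> 's fm"

definition code_for ::
  "('r, 's) code \<Rightarrow> ('r, 'a) rel_structure \<Rightarrow> ('s, 'b) rel_structure \<Rightarrow> bool" where
  "code_for \<Gamma> M N \<longleftrightarrow>
     0 < code_dim \<Gamma> \<and>
     formula_in N (code_dim \<Gamma>) (code_dom \<Gamma>) \<and>
     formula_in N (2 * code_dim \<Gamma>) (code_eq \<Gamma>) \<and>
     (\<forall>r\<in>syms M. formula_in N (arity M r * code_dim \<Gamma>) (code_rel \<Gamma> r))"

definition dom_set :: "('r, 's) code \<Rightarrow> ('s, 'b) rel_structure \<Rightarrow> 'b list set" where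
  "dom_set \<Gamma> N = {xs \<in> tuples (univ N) (code_dim \<Gamma>). sat N xs (code_dom \<Gamma>)}"

definition eq_rel :: "('r, 's) code \<Rightarrow> ('s, 'b) rel_structure \<Rightarrow> ('b list \<times> 'b list) set" where
  "eq_rel \<Gamma> N =
     {(xs, ys). xs \<in> dom_set \<Gamma> N \<and> ys \<in> dom_set \<Gamma> N \<and> sat N (xs @ ys) (code_eq \<Gamma>)}"

text \<open>The code defines a structure in the language of \<open>M\<close> inside \<open>N\<close>.\<close>

definition code_well_defined ::
  "('r, 's) code \<Rightarrow> ('r, 'a) rel_structure \<Rightarrow> ('s, 'b) rel_structure \<Rightarrow> bool" where
  "code_well_defined \<Gamma> M N \<longleftrightarrow>
     code_for \<Gamma> M N \<and> dom_set \<Gamma> N \<noteq> {} \<and> equiv (dom_set \<Gamma> N) (eq_rel \<Gamma> N) \<and>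
     (\<forall>r\<in>syms M. \<forall>xss yss. length xss = arity M r \<longrightarrow>
        list_all2 (\<lambda>xs ys. (xs, ys) \<in> eq_rel \<Gamma> N) xss yss \<longrightarrow>
        sat N (concat xss) (code_rel \<Gamma> r) = sat N (concat yss) (code_rel \<Gamma> r))"

text \<open>The structure \<open>\<Gamma>(N)\<close>; \<open>M\<close> only supplies the language.\<close>

definition coded_structure ::
  "('r, 's) code \<Rightarrow> ('r, 'a) rel_structure \<Rightarrow> ('s, 'b) rel_structure
     \<Rightarrow> ('r, 'b list set) rel_structure" where
  "coded_structure \<Gamma> M N =
     \<lparr> univ = dom_set \<Gamma> N // eq_rel \<Gamma> N,
       syms = syms M,
       arity = arity M,
       rel = (\<lambda>r cs. \<exists>xss. set xss \<subseteq> dom_set \<Gamma> N \<and> cs = map (\<lambda>xs. eq_rel \<Gamma> N `` {xs}) xss \<and>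
                sat N (concat xss) (code_rel \<Gamma> r)) \<rparr>"

text \<open>\<open>\<Gamma>\<close> interprets \<open>M\<close> in \<open>N\<close> without parameters, with coordinate map \<open>\<mu>\<close>.\<close>

definition interpretation_via ::
  "('r, 'a) rel_structure \<Rightarrow> ('s, 'b) rel_structure \<Rightarrow> ('r, 's) code \<Rightarrow> ('b list \<Rightarrow> 'a) \<Rightarrow> bool" where
  "interpretation_via M N \<Gamma> \<mu> \<longleftrightarrow>
     code_well_defined \<Gamma> M N \<and>
     (\<exists>h. structure_iso h (coded_structure \<Gamma> M N) M \<and>
          (\<forall>xs\<in>dom_set \<Gamma> N. \<mu> xs = h (eq_rel \<Gamma> N `` {xs})))"

text \<open>Let \<open>\<Gamma>\<close> interpret \<open>M\<close> in \<open>N\<close> via \<open>\<mu>\<close> and \<open>\<Delta>\<close> interpret \<open>N\<close> in \<open>M\<close> via \<open>\<nu>\<close>.  The composite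
  self-interpretation \<open>\<Gamma>(\<Delta>(M))\<close> of \<open>M\<close> lives on the \<open>code_dim \<Gamma>\<close>-tuples of \<open>\<Delta>\<close>-codes that
  \<open>\<nu>\<close> sends to \<open>\<Gamma>\<close>-codes, and its isomorphism onto \<open>M\<close> is induced by the coordinate map
  \<open>\<mu> \<circ> map \<nu>\<close>.  This is the graph of that map, as a set of flat tuples over \<open>M\<close>.\<close>

definition composite_graph ::
  "('r, 'a) rel_structure \<Rightarrow> ('s, 'b) rel_structure \<Rightarrow> ('r, 's) code \<Rightarrow> ('b list \<Rightarrow> 'a)
     \<Rightarrow> ('s, 'r) code \<Rightarrow> ('a list \<Rightarrow> 'b) \<Rightarrow> 'a list set" where
  "composite_graph M N \<Gamma> \<mu> \<Delta> \<nu> =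
     {concat xss @ [\<mu> (map \<nu> xss)] | xss.
        xss \<in> tuples (dom_set \<Delta> M) (code_dim \<Gamma>) \<and> map \<nu> xss \<in> dom_set \<Gamma> N}"

definition absolutely_bi_interpretable ::
  "('r, 'a) rel_structure \<Rightarrow> ('s, 'b) rel_structure \<Rightarrow> bool" where
  "absolutely_bi_interpretable M N \<longleftrightarrow>
     (\<exists>(\<Gamma> :: ('r, 's) code) \<mu> (\<Delta> :: ('s, 'r) code) \<nu>.
        interpretation_via M N \<Gamma> \<mu> \<and> interpretation_via N M \<Delta> \<nu> \<and>
        definable M (code_dim \<Gamma> * code_dim \<Delta> + 1) (composite_graph M N \<Gamma> \<mu> \<Delta> \<nu>) \<and>
        definable N (code_dim \<Delta> * code_dim \<Gamma> + 1) (composite_graph N M \<Delta> \<nu> \<Gamma> \<mu>))"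

section \<open>Hereditarily finite sets over a structure\<close>

text \<open>The elements of the base set are urelements: they are distinct from all sets and have no
  members.\<close>

datatype 'a hf = Ur 'a | HSet "'a hf fset"

primrec HF_level :: "'a set \<Rightarrow> nat \<Rightarrow> 'a hf set" where
  "HF_level A 0 = Ur ` A"
| "HF_level A (Suc k) = HF_level A k \<union> {HSet X | X. fset X \<subseteq> HF_level A k}"

definition HF :: "'a set \<Rightarrow> 'a hf set" where
  "HF A = (\<Union>k. HF_level A k)"

datatype 'r hf_sym = HF_base 'r | HF_P | HF_mem

primrec hf_arity :: "('r \<Rightarrow> nat) \<Rightarrow> 'r hf_sym \<Rightarrow> nat" where
  "hf_arity ar (HF_base r) = ar r"
| "hf_arity ar HF_P = 1"
| "hf_arity ar HF_mem = 2"

primrec hf_rel :: "('r, 'a) rel_structure \<Rightarrow> 'r hf_sym \<Rightarrow> 'a hf list \<Rightarrow> bool" where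
  "hf_rel A (HF_base r) xs \<longleftrightarrow> (\<exists>as \<in> tuples (univ A) (arity A r). xs = map Ur as \<and> rel A r as)"
| "hf_rel A HF_P xs \<longleftrightarrow> (\<exists>a \<in> univ A. xs = [Ur a])"
| "hf_rel A HF_mem xs \<longleftrightarrow> (\<exists>x X. xs = [x, HSet X] \<and> x |\<in>| X)"

definition HF_structure :: "('r, 'a) rel_structure \<Rightarrow> ('r hf_sym, 'a hf) rel_structure" where
  "HF_structure A =
     \<lparr> univ = HF (univ A),
       syms = HF_base ` syms A \<union> {HF_P, HF_mem},
       arity = hf_arity (arity A),
       rel = hf_rel A \<rparr>"

section \<open>Finite sequences and arithmetic over a structure\<close>

text \<open>The three sorts are merged into one universe with unary sort predicates; the empty
  sequence is a sequence, and the operations are given by their graphs.\<close>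

datatype 'a sn = Elem 'a | Seq "'a list" | Num nat

datatype 'r sn_sym =
    SN_base 'r
  | SN_sortA | SN_sortS | SN_sortN
  | SN_t | SN_length | SN_append | SN_mem
  | SN_plus | SN_times | SN_zero | SN_one

primrec sn_arity :: "('r \<Rightarrow> nat) \<Rightarrow> 'r sn_sym \<Rightarrow> nat" where
  "sn_arity ar (SN_base r) = ar r"
| "sn_arity ar SN_sortA = 1"
| "sn_arity ar SN_sortS = 1"
| "sn_arity ar SN_sortN = 1"
| "sn_arity ar SN_t = 3"
| "sn_arity ar SN_length = 2"
| "sn_arity ar SN_append = 3"
| "sn_arity ar SN_mem = 2"
| "sn_arity ar SN_plus = 3"
| "sn_arity ar SN_times = 3"
| "sn_arity ar SN_zero = 1"
| "sn_arity ar SN_one = 1"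

text \<open>In \<open>t(s, i, a)\<close> positions are counted from 1, whereas list indices start at 0.\<close>

primrec sn_rel :: "('r, 'a) rel_structure \<Rightarrow> 'r sn_sym \<Rightarrow> 'a sn list \<Rightarrow> bool" where
  "sn_rel A (SN_base r) xs \<longleftrightarrow> (\<exists>as \<in> tuples (univ A) (arity A r). xs = map Elem as \<and> rel A r as)"
| "sn_rel A SN_sortA xs \<longleftrightarrow> (\<exists>a. xs = [Elem a])"
| "sn_rel A SN_sortS xs \<longleftrightarrow> (\<exists>s. xs = [Seq s])"
| "sn_rel A SN_sortN xs \<longleftrightarrow> (\<exists>n. xs = [Num n])"
| "sn_rel A SN_t xs \<longleftrightarrow>
     (\<exists>s i a. xs = [Seq s, Num i, Elem a] \<and> 1 \<le> i \<and> i \<le> length s \<and> a = s ! (i - 1))"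
| "sn_rel A SN_length xs \<longleftrightarrow> (\<exists>s. xs = [Seq s, Num (length s)])"
| "sn_rel A SN_append xs \<longleftrightarrow> (\<exists>s u. xs = [Seq s, Seq u, Seq (s @ u)])"
| "sn_rel A SN_mem xs \<longleftrightarrow> (\<exists>a s. xs = [Elem a, Seq s] \<and> a \<in> set s)"
| "sn_rel A SN_plus xs \<longleftrightarrow> (\<exists>m n. xs = [Num m, Num n, Num (m + n)])"
| "sn_rel A SN_times xs \<longleftrightarrow> (\<exists>m n. xs = [Num m, Num n, Num (m * n)])"
| "sn_rel A SN_zero xs \<longleftrightarrow> xs = [Num 0]"
| "sn_rel A SN_one xs \<longleftrightarrow> xs = [Num 1]"

definition SN_structure :: "('r, 'a) rel_structure \<Rightarrow> ('r sn_sym, 'a sn) rel_structure" where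
  "SN_structure A =
     \<lparr> univ = Elem ` univ A \<union> Seq ` lists (univ A) \<union> range Num,
       syms = SN_base ` syms A \<union>
         {SN_sortA, SN_sortS, SN_sortN, SN_t, SN_length, SN_append, SN_mem,
          SN_plus, SN_times, SN_zero, SN_one},
       arity = sn_arity (arity A),
       rel = sn_rel A \<rparr>"

end

theory Submission
  imports Defs
begin

text \<open>Both interpretations use coordinate maps that are defined on all tuples, so only the
  kernel, the preimages of the relations and the composite maps have to be shown definable.

  A hereditarily finite set is coded by sequences \<open>s\<close>, \<open>e\<close> and a number \<open>v\<close>: the numbers
  from 1 to the length of \<open>s\<close> stand for the entries of \<open>s\<close> as urelements, any other number
  for the set coded by its smaller neighbours in a finite relation on numbers.  As there are
  two elements, a sequence can code such a relation by comparing its entries with the first one.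
  Hence one can quantify over finite relations on numbers, and two codes have the same value iff
  some finite relation is a bisimulation between them.

  Conversely, numbers are cardinalities of sets, so that addition and multiplication become
  disjoint unions and products compared by finite bijections, and a sequence is a finite set of
  pairs of a set of cardinality \<open>i\<close> and the \<open>i\<close>-th entry.  A pair of sets codes an element, a
  number or a sequence according to whether its first component is an urelement, empty, or
  neither.\<close>

section \<open>A calculus of definable predicates\<close>

text \<open>Formulas are hardly ever written out: closure rules for \<open>dfn\<close> turn a
  predicate stated in HOL into a formula. Default values make all decoding maps total:
  \<open>numof\<close> of a non-number is 0, \<open>dec\<close> of a set that codes no sequence is
  the empty list, and every object has a cardinality, which is one advantage of cardinalities over
  ordinals. Hence every tuple is a code, and a composite map is simply a composition of functions.
  The main obstacle is recursion, since a formula cannot follow \<open>val\<close> down its edges.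
  One finite witness replaces it: over sets a finite partial graph of \<open>val\<close>, over
  sequences a finite relation on numbers. A witness only has to satisfy a local condition at each of
  its pairs. As \<open>val\<close> follows edges from smaller to larger numbers only, induction on
  numbers makes the local condition determine the values, and no well-foundedness has to be
  expressed. Codes are not unique in most sorts. Equality of decoded values must therefore be shown
  definable before variables of a sort can be used as terms, which dictates the order of the
  development.\<close>

definition env :: "('r, 'a) rel_structure \<Rightarrow> nat \<Rightarrow> (nat \<Rightarrow> 'a list) \<Rightarrow> bool" where
  "env M d e \<longleftrightarrow> (\<forall>k. e k \<in> tuples (univ M) d)"

text \<open>Each variable of \<open>P\<close> is a block: component \<open>j\<close> of variable
  \<open>k\<close> is the formula variable \<open>k * d + j\<close>. As the equivalence is demanded
  for all environments, on these \<open>P\<close> can depend only on the first \<open>n\<close>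
  blocks.\<close>

definition dfn :: "('r, 'a) rel_structure \<Rightarrow> nat \<Rightarrow> nat \<Rightarrow> ((nat \<Rightarrow> 'a list) \<Rightarrow> bool) \<Rightarrow> bool" where
  "dfn M d n P \<longleftrightarrow>
     (\<exists>p. formula_in M (n * d) p \<and>
       (\<forall>e. env M d e \<longrightarrow> sat M (concat (map e [0..<n])) p = P e))"

lemma env_tuple: "env M d e \<Longrightarrow> e k \<in> tuples (univ M) d"
  by (simp add: env_def)

lemma env_shift: "env M d e \<Longrightarrow> env M d (\<lambda>k. e (f k))"
  by (simp add: env_def)

lemma env_case: "env M d e \<Longrightarrow> x \<in> tuples (univ M) d \<Longrightarrow> env M d (case_nat x e)"
  by (auto simp: env_def split: nat.split)

lemma map_upt_Suc_shift: "map e [0..<Suc n] = e 0 # map (\<lambda>k. e (Suc k)) [0..<n]"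
  by (simp add: map_Suc_upt[symmetric] upt_conv_Cons del: upt_Suc map_Suc_upt)

lemma length_concat_env:
  assumes "env M d e" shows "length (concat (map e [0..<n])) = n * d"
  using assms by (induction n) (auto simp: env_def tuples_def)

lemma nth_concat_env:
  assumes "env M d e" "i < n" "j < d"
  shows "concat (map e [0..<n]) ! (i * d + j) = e i ! j"
  using assms(2)
proof (induction n)
  case (Suc n)
  have *: "length (concat (map e [0..<n])) = n * d"
    using assms(1) by (rule length_concat_env)
  show ?case
  proof (cases "i = n")
    case True
    then show ?thesis using * by (simp add: nth_append)
  next
    case False
    with Suc.prems have "i < n" by simp
    then have "Suc i * d \<le> n * d" by (intro mult_le_mono1) simp
    then have "i * d + j < n * d" using assms(3) by simp
    then show ?thesis using Suc.IH[OF \<open>i < n\<close>] * by (simp add: nth_append)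
  qed
qed simp

lemma dfn_cong:
  assumes "dfn M d n P" "\<And>e. env M d e \<Longrightarrow> P e = Q e"
  shows "dfn M d n Q"
  using assms unfolding dfn_def by auto

named_theorems dfn_intros

lemma dfn_not [dfn_intros]: "dfn M d n P \<Longrightarrow> dfn M d n (\<lambda>e. \<not> P e)"
  unfolding dfn_def by (metis formula_in.simps(3) sat.simps(3))

lemma dfn_conj [dfn_intros]:
  assumes "dfn M d n P" "dfn M d n Q" shows "dfn M d n (\<lambda>e. P e \<and> Q e)"
proof -
  obtain p q where "formula_in M (n * d) p" "formula_in M (n * d) q"
    "\<And>e. env M d e \<Longrightarrow> sat M (concat (map e [0..<n])) p = P e"
    "\<And>e. env M d e \<Longrightarrow> sat M (concat (map e [0..<n])) q = Q e"
    using assms unfolding dfn_def by auto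
  then show ?thesis unfolding dfn_def by (intro exI[of _ "FAnd p q"]) auto
qed

lemma dfn_disj [dfn_intros]:
  assumes "dfn M d n P" "dfn M d n Q" shows "dfn M d n (\<lambda>e. P e \<or> Q e)"
  using dfn_not[OF dfn_conj[OF dfn_not[OF assms(1)] dfn_not[OF assms(2)]]]
  by simp

lemma dfn_imp [dfn_intros]:
  assumes "dfn M d n P" "dfn M d n Q" shows "dfn M d n (\<lambda>e. P e \<longrightarrow> Q e)"
  using dfn_not[OF dfn_conj[OF assms(1) dfn_not[OF assms(2)]]]
  by simp

lemma dfn_iff [dfn_intros]:
  assumes "dfn M d n P" "dfn M d n Q" shows "dfn M d n (\<lambda>e. P e \<longleftrightarrow> Q e)"
  using dfn_conj[OF dfn_imp[OF assms] dfn_imp[OF assms(2,1)]]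
  by (rule dfn_cong) auto

lemma dfn_True [dfn_intros]: "dfn M d n (\<lambda>e. True)"
  \<comment> \<open>The formula has to be closed, because no free variable is admissible when
    \<open>n * d\<close> is 0.\<close>
  unfolding dfn_def by (intro exI[of _ "FNeg (FEx (FNeg (FEq 0 0)))"]) simp

lemma sat_FEx_power:
  "sat M xs ((FEx ^^ d) p) \<longleftrightarrow> (\<exists>ys\<in>tuples (univ M) d. sat M (ys @ xs) p)"
proof (induction d arbitrary: xs)
  case 0
  then show ?case by (simp add: tuples_def)
next
  case (Suc d)
  \<comment> \<open>The outermost quantifier binds the last component, since inner ones prepend
    their values; hence the tuple is split at its end.\<close>
  have "(\<exists>a\<in>univ M. \<exists>ys\<in>tuples (univ M) d. sat M (ys @ a # xs) p) \<longleftrightarrow>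
        (\<exists>ys\<in>tuples (univ M) (Suc d). sat M (ys @ xs) p)" (is "?L \<longleftrightarrow> ?R")
  proof
    assume ?L
    then obtain a ys where "a \<in> univ M" "ys \<in> tuples (univ M) d" "sat M (ys @ a # xs) p" by auto
    then show ?R by (intro bexI[of _ "ys @ [a]"]) (auto simp: tuples_def)
  next
    assume ?R
    then obtain ys where ys: "length ys = Suc d" "set ys \<subseteq> univ M" "sat M (ys @ xs) p"
      by (auto simp: tuples_def)
    then obtain zs a where "ys = zs @ [a]" by (cases ys rule: rev_cases) auto
    then show ?L using ys by (auto simp: tuples_def intro!: bexI[of _ a] bexI[of _ zs])
  qed
  then show ?case using Suc.IH by simp
qed

lemma formula_in_FEx_power: "formula_in M n ((FEx ^^ d) p) \<longleftrightarrow> formula_in M (d + n) p"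
  by (induction d arbitrary: n) auto

lemma dfn_ex_tuple:
  assumes "dfn M d (Suc n) (\<lambda>e. P (e 0) (\<lambda>k. e (Suc k)))"
  shows "dfn M d n (\<lambda>e. \<exists>x\<in>tuples (univ M) d. P x e)"
proof -
  obtain p where p: "formula_in M (Suc n * d) p"
    "\<And>e. env M d e \<Longrightarrow> sat M (concat (map e [0..<Suc n])) p = P (e 0) (\<lambda>k. e (Suc k))"
    using assms unfolding dfn_def by auto
  show ?thesis unfolding dfn_def
  proof (intro exI[of _ "(FEx ^^ d) p"] conjI allI impI)
    show "formula_in M (n * d) ((FEx ^^ d) p)"
      using p(1) by (simp add: formula_in_FEx_power)
    fix e assume e: "env M d e"
    have "sat M (x @ concat (map e [0..<n])) p = P x e" if "x \<in> tuples (univ M) d" for x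
      using p(2)[OF env_case[OF e that]] by (simp add: map_upt_Suc_shift del: upt_Suc)
    then show "sat M (concat (map e [0..<n])) ((FEx ^^ d) p) \<longleftrightarrow>
        (\<exists>x\<in>tuples (univ M) d. P x e)"
      by (auto simp: sat_FEx_power)
  qed
qed

section \<open>Renaming of variables and atomic predicates\<close>

primrec rename :: "(nat \<Rightarrow> nat) \<Rightarrow> 'r fm \<Rightarrow> 'r fm" where
  "rename f (FRel r is) = FRel r (map f is)"
| "rename f (FEq i j) = FEq (f i) (f j)"
| "rename f (FNeg p) = FNeg (rename f p)"
| "rename f (FAnd p q) = FAnd (rename f p) (rename f q)"
| "rename f (FEx p) = FEx (rename (case_nat 0 (\<lambda>i. Suc (f i))) p)"

lemma rename_formula_in:
  "formula_in M n p \<Longrightarrow> (\<And>i. i < n \<Longrightarrow> f i < m) \<Longrightarrow> formula_in M m (rename f p)"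
proof (induction p arbitrary: n m f)
  case (FEx p)
  show ?case unfolding rename.simps formula_in.simps
    by (rule FEx.IH[of "Suc n"]) (use FEx.prems in \<open>auto split: nat.split\<close>)
qed auto

lemma sat_rename:
  "formula_in M n p \<Longrightarrow> (\<And>i. i < n \<Longrightarrow> xs ! (f i) = ys ! i) \<Longrightarrow>
   sat M xs (rename f p) = sat M ys p"
proof (induction p arbitrary: n xs ys f)
  case (FRel r "is")
  then have "map ((!) xs) (map f is) = map ((!) ys) is" by auto
  then show ?case by (simp del: map_map)
next
  case (FEx p)
  have "sat M (a # xs) (rename (case_nat 0 (\<lambda>i. Suc (f i))) p) = sat M (a # ys) p" for a
    by (rule FEx.IH[of "Suc n"]) (use FEx.prems in \<open>auto split: nat.split\<close>)
  then show ?case by simp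
qed auto

lemma dfn_rename:
  assumes "dfn M d m P" "\<And>i. i < m \<Longrightarrow> f i < n"
  shows "dfn M d n (\<lambda>e. P (\<lambda>i. e (f i)))"
proof -
  obtain p where p: "formula_in M (m * d) p"
    "\<And>e. env M d e \<Longrightarrow> sat M (concat (map e [0..<m])) p = P e"
    using assms unfolding dfn_def by auto
  \<comment> \<open>\<open>f\<close> moves whole blocks; \<open>?g\<close> moves single variables,
    the quotient being the block and the remainder the component.\<close>
  let ?g = "\<lambda>i. f (i div d) * d + i mod d"
  have split: "i div d < m \<and> i mod d < d" if "i < m * d" for i
    using that by (metis less_mult_imp_div_less mod_less_divisor mult_0_right not_gr_zero not_less_zero)
  show ?thesis unfolding dfn_def
  proof (intro exI[of _ "rename ?g p"] conjI allI impI)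
    show "formula_in M (n * d) (rename ?g p)"
    proof (rule rename_formula_in[OF p(1)])
      fix i assume "i < m * d"
      with split assms(2) have "f (i div d) < n" "i mod d < d" by auto
      then have "Suc (f (i div d)) * d \<le> n * d" by (intro mult_le_mono1) simp
      then show "?g i < n * d" using \<open>i mod d < d\<close> by simp
    qed
    fix e assume e: "env M d e"
    have "sat M (concat (map e [0..<n])) (rename ?g p) =
          sat M (concat (map (\<lambda>i. e (f i)) [0..<m])) p"
    proof (rule sat_rename[OF p(1)])
      fix i assume "i < m * d"
      with split assms(2) have *: "f (i div d) < n" "i mod d < d" "i div d < m" by auto
      have "concat (map (\<lambda>i. e (f i)) [0..<m]) ! (i div d * d + i mod d) = e (f (i div d)) ! (i mod d)"
        using nth_concat_env[OF env_shift[OF e, of f] *(3,2)] .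
      then show "concat (map e [0..<n]) ! ?g i = concat (map (\<lambda>i. e (f i)) [0..<m]) ! i"
        using nth_concat_env[OF e *(1,2)] by simp
    qed
    then show "sat M (concat (map e [0..<n])) (rename ?g p) = P (\<lambda>i. e (f i))"
      using p(2)[OF env_shift[OF e]] by simp
  qed
qed

lemma dfn_rel:
  assumes "r \<in> syms M" "length ijs = arity M r" "\<And>i j. (i, j) \<in> set ijs \<Longrightarrow> i < n \<and> j < d"
  shows "dfn M d n (\<lambda>e. rel M r (map (\<lambda>(i, j). e i ! j) ijs))"
  unfolding dfn_def
proof (intro exI[of _ "FRel r (map (\<lambda>(i, j). i * d + j) ijs)"] conjI allI impI)
  have "i * d + j < n * d" if "(i, j) \<in> set ijs" for i j
  proof -
    have "Suc i * d \<le> n * d" using assms(3)[OF that] by (intro mult_le_mono1) simp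
    then show ?thesis using assms(3)[OF that] by simp
  qed
  then show "formula_in M (n * d) (FRel r (map (\<lambda>(i, j). i * d + j) ijs))"
    using assms by auto
  fix e assume e: "env M d e"
  have "map ((!) (concat (map e [0..<n]))) (map (\<lambda>(i, j). i * d + j) ijs) =
        map (\<lambda>(i, j). e i ! j) ijs"
    using assms(3) nth_concat_env[OF e] by auto
  then show "sat M (concat (map e [0..<n])) (FRel r (map (\<lambda>(i, j). i * d + j) ijs)) =
      rel M r (map (\<lambda>(i, j). e i ! j) ijs)"
    by (simp del: map_map)
qed

lemma dfn_eq_nth:
  assumes "i < n" "j < d" "i' < n" "j' < d"
  shows "dfn M d n (\<lambda>e. e i ! j = e i' ! j')"
  unfolding dfn_def
proof (intro exI[of _ "FEq (i * d + j) (i' * d + j')"] conjI allI impI)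
  have "i * d + j < n * d" if "i < n" "j < d" for i j
  proof -
    have "Suc i * d \<le> n * d" using that by (intro mult_le_mono1) simp
    then show ?thesis using that by simp
  qed
  then show "formula_in M (n * d) (FEq (i * d + j) (i' * d + j'))" using assms by simp
  fix e assume "env M d e"
  then show "sat M (concat (map e [0..<n])) (FEq (i * d + j) (i' * d + j')) = (e i ! j = e i' ! j')"
    using nth_concat_env assms by (metis sat.simps(2))
qed

section \<open>Quantification over several blocks and composition\<close>

lemma dfn_ex_many:
  assumes "dfn M d (k + n) P"
  shows "dfn M d n (\<lambda>e. \<exists>h. env M d h \<and> P (\<lambda>i. if i < k then h i else e (i - k)))"
  using assms
proof (induction k arbitrary: P)
  case 0
  then have "dfn M d n P" by simp
  then show ?case by (rule dfn_cong) auto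
next
  case (Suc k)
  have "dfn M d (k + n) (\<lambda>e. \<exists>x\<in>tuples (univ M) d. P (case_nat x e))"
  proof (rule dfn_ex_tuple)
    have "case_nat (e 0) (\<lambda>k. e (Suc k)) = e" for e :: "nat \<Rightarrow> 'b list"
      by (auto split: nat.split)
    then show "dfn M d (Suc (k + n)) (\<lambda>e. P (case_nat (e 0) (\<lambda>k. e (Suc k))))"
      using Suc.prems by simp
  qed
  from Suc.IH[OF this] show ?case
  proof (rule dfn_cong)
    fix e assume e: "env M d e"
    let ?f = "\<lambda>k h i. if i < k then h i else e (i - k)"
    have *: "?f (Suc k) h = case_nat (h 0) (?f k (\<lambda>i. h (Suc i)))" for h
      by (auto split: nat.split)
    show "(\<exists>h. env M d h \<and> (\<exists>x\<in>tuples (univ M) d. P (case_nat x (?f k h)))) =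
          (\<exists>h. env M d h \<and> P (?f (Suc k) h))" (is "?L = ?R")
    proof
      assume ?L
      then obtain h x where h: "env M d h" "x \<in> tuples (univ M) d" "P (case_nat x (?f k h))" by auto
      moreover have "case_nat x (?f k h) = ?f (Suc k) (case_nat x h)" by (auto split: nat.split)
      ultimately show ?R using env_case[of M d h x] by (intro exI[of _ "case_nat x h"]) auto
    next
      assume ?R
      then obtain h where "env M d h" "P (?f (Suc k) h)" by auto
      then show ?L unfolding *
        using env_shift[of M d h Suc] env_tuple[of M d h 0] by blast
    qed
  qed
qed

text \<open>The bound lives outside the formula, so this is a conjunction of \<open>k\<close>
  formulas. It is needed because \<open>dfn_comp\<close> is also used with the arity of an arbitrary
  symbol for \<open>k\<close>.\<close>

lemma dfn_all_less:
  fixes k :: nat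
  assumes "\<And>i. i < k \<Longrightarrow> dfn M d n (P i)"
  shows "dfn M d n (\<lambda>e. \<forall>i<k. P i e)"
  using assms
proof (induction k)
  case 0
  then show ?case by (simp add: dfn_True)
next
  case (Suc k)
  then have "dfn M d n (\<lambda>e. (\<forall>i<k. P i e) \<and> P k e)" by (intro dfn_conj) auto
  then show ?case by (rule dfn_cong) (auto simp: less_Suc_eq)
qed

text \<open>Composition: \<open>C i\<close> relates a tuple to the values it may stand for, and \<open>P\<close> arises
  from \<open>Q\<close> by substituting such values for its variables.\<close>

lemma dfn_comp:
  assumes Q: "dfn M d k Q"
    and C: "\<And>i. i < k \<Longrightarrow> dfn M d (Suc n) (\<lambda>e. C i (e 0) (\<lambda>j. e (Suc j)))"
    and ex: "\<And>i e. i < k \<Longrightarrow> env M d e \<Longrightarrow> \<exists>x\<in>tuples (univ M) d. C i x e"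
    and PQ: "\<And>e h. env M d e \<Longrightarrow> env M d h \<Longrightarrow> (\<And>i. i < k \<Longrightarrow> C i (h i) e) \<Longrightarrow> Q h = P e"
  shows "dfn M d n P"
proof -
  have 1: "dfn M d (k + n) (\<lambda>e. C i (e i) (\<lambda>j. e (k + j)))" if "i < k" for i
    using dfn_rename[OF C[OF that], of "case_nat i ((+) k)" "k + n"] that
    by (auto split: nat.split)
  have 2: "dfn M d (k + n) Q"
    using dfn_rename[OF Q, of id "k + n"] by simp
  have "dfn M d (k + n) (\<lambda>e. (\<forall>i<k. C i (e i) (\<lambda>j. e (k + j))) \<and> Q e)"
    by (intro dfn_conj dfn_all_less 1 2)
  from dfn_ex_many[OF this] show ?thesis
  proof (rule dfn_cong)
    fix e assume e: "env M d e"
    let ?f = "\<lambda>h i. if i < k then h i else e (i - k)"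
    have f: "env M d (?f h)" if "env M d h" for h
      using e that by (simp add: env_def)
    show "(\<exists>h. env M d h \<and> (\<forall>i<k. C i (?f h i) (\<lambda>j. ?f h (k + j))) \<and> Q (?f h)) = P e"
      (is "?L = _")
    proof
      assume ?L
      then obtain h where h: "env M d h" "\<forall>i<k. C i (?f h i) e" "Q (?f h)" by auto
      then show "P e" using PQ[OF e f[OF h(1)]] by blast
    next
      assume "P e"
      \<comment> \<open>The choice of values is immaterial: by \<open>PQ\<close>, \<open>Q\<close>
        has the truth value \<open>P e\<close> for all of them.\<close>
      obtain h where h: "\<And>i. i < k \<Longrightarrow> h i \<in> tuples (univ M) d \<and> C i (h i) e"
        using ex[OF _ e] by metis
      have h': "env M d (?f h)" using h e by (simp add: env_def)
      have "Q (?f h)" using PQ[OF e h'] h \<open>P e\<close> by auto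
      moreover have "?f (?f h) = ?f h" by auto
      ultimately show ?L using h h' by (intro exI[of _ "?f h"]) simp
    qed
  qed
qed

text \<open>A sort is given by a map \<open>c\<close> decoding tuples, and \<open>t\<close> is a definable term of that sort.\<close>

definition tm :: "('r, 'a) rel_structure \<Rightarrow> nat \<Rightarrow> nat \<Rightarrow> ('a list \<Rightarrow> 'c) \<Rightarrow>
    ((nat \<Rightarrow> 'a list) \<Rightarrow> 'c) \<Rightarrow> bool" where
  "tm M d n c t \<longleftrightarrow>
     (\<forall>e. env M d e \<longrightarrow> t e \<in> c ` tuples (univ M) d) \<and>
     dfn M d (Suc n) (\<lambda>e. c (e 0) = t (\<lambda>k. e (Suc k)))"

lemma tm_ex:
  assumes "tm M d n c t" "env M d e" shows "\<exists>x\<in>tuples (univ M) d. c x = t e"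
proof -
  have "t e \<in> c ` tuples (univ M) d" using assms unfolding tm_def by blast
  then show ?thesis by (auto simp: eq_commute)
qed

lemma tm_dfn: "tm M d n c t \<Longrightarrow> dfn M d (Suc n) (\<lambda>e. c (e 0) = t (\<lambda>k. e (Suc k)))"
  unfolding tm_def by blast

lemma tm_var:
  assumes "dfn M d 2 (\<lambda>e. c (e 0) = c (e 1))" "i < n"
  shows "tm M d n c (\<lambda>e. c (e i))"
proof -
  have "dfn M d (Suc n) (\<lambda>e. c (e 0) = c (e (Suc i)))"
    using dfn_rename[OF assms(1), of "case_nat 0 (\<lambda>_. Suc i)" "Suc n"] assms(2)
    by (auto split: nat.split)
  then show ?thesis unfolding tm_def by (auto simp: env_def)
qed

section \<open>Quantifiers over sorts and substitution of terms\<close>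

lemma dfn_ex_sort:
  assumes "c ` tuples (univ M) d = V"
    and "dfn M d (Suc n) (\<lambda>e. P (c (e 0)) (\<lambda>k. e (Suc k)))"
  shows "dfn M d n (\<lambda>e. \<exists>z\<in>V. P z e)"
proof -
  have "dfn M d n (\<lambda>e. \<exists>x\<in>tuples (univ M) d. P (c x) e)"
    by (rule dfn_ex_tuple) (rule assms(2))
  then show ?thesis by (rule dfn_cong) (use assms(1) in blast)
qed

lemma dfn_all_sort:
  assumes "c ` tuples (univ M) d = V"
    and "dfn M d (Suc n) (\<lambda>e. P (c (e 0)) (\<lambda>k. e (Suc k)))"
  shows "dfn M d n (\<lambda>e. \<forall>z\<in>V. P z e)"
proof -
  have "dfn M d n (\<lambda>e. \<not> (\<exists>z\<in>V. \<not> P z e))"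
    by (intro dfn_not dfn_ex_sort[OF assms(1)] assms(2))
  then show ?thesis by simp
qed

lemma dfn_subst1:
  assumes "dfn M d 1 (\<lambda>e. R (c (e 0)))" "tm M d n c t"
  shows "dfn M d n (\<lambda>e. R (t e))"
proof (rule dfn_comp[OF assms(1), of n "\<lambda>_ x e. c x = t e"])
  show "\<exists>x\<in>tuples (univ M) d. c x = t e" if "env M d e" for e
    using tm_ex[OF assms(2) that] .
qed (use tm_dfn[OF assms(2)] in simp_all)

text \<open>The arguments may belong to sorts with different HOL types. A disjunction over the index
  therefore takes the place of an indexed family of decoding maps.\<close>

lemma dfn_subst2:
  assumes "dfn M d 2 (\<lambda>e. R (c1 (e 0)) (c2 (e 1)))" "tm M d n c1 t1" "tm M d n c2 t2"
  shows "dfn M d n (\<lambda>e. R (t1 e) (t2 e))"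
proof (rule dfn_comp[OF assms(1), of n
    "\<lambda>i x e. (i = 0 \<and> c1 x = t1 e) \<or> (i = 1 \<and> c2 x = t2 e)"])
  show "\<exists>x\<in>tuples (univ M) d. (i = 0 \<and> c1 x = t1 e) \<or> (i = 1 \<and> c2 x = t2 e)"
    if "i < 2" "env M d e" for i :: nat and e
  proof -
    have "i = 0 \<or> i = 1" using that by auto
    then show ?thesis using tm_ex[OF assms(2) that(2)] tm_ex[OF assms(3) that(2)] by auto
  qed
  show "dfn M d (Suc n) (\<lambda>e. (i = 0 \<and> c1 (e 0) = t1 (\<lambda>j. e (Suc j))) \<or>
           (i = 1 \<and> c2 (e 0) = t2 (\<lambda>j. e (Suc j))))" if "i < 2" for i :: nat
  proof -
    have "i = 0 \<or> i = 1" using that by auto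
    then show ?thesis using tm_dfn[OF assms(2)] tm_dfn[OF assms(3)] by auto
  qed
next
  fix e h assume "env M d e" "env M d h"
    and *: "\<And>i. i < 2 \<Longrightarrow> (i = 0 \<and> c1 (h i) = t1 e) \<or> (i = 1 \<and> c2 (h i) = t2 e)"
  show "R (c1 (h 0)) (c2 (h 1)) = R (t1 e) (t2 e)" using *[of 0] *[of 1] by simp
qed

lemma less_3_cases: "i < (3::nat) \<Longrightarrow> i = 0 \<or> i = 1 \<or> i = 2"
  by auto

lemma less_4_cases: "i < (4::nat) \<Longrightarrow> i = 0 \<or> i = 1 \<or> i = 2 \<or> i = 3"
  by auto

lemma dfn_subst3:
  assumes "dfn M d 3 (\<lambda>e. R (c1 (e 0)) (c2 (e 1)) (c3 (e 2)))"
    "tm M d n c1 t1" "tm M d n c2 t2" "tm M d n c3 t3"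
  shows "dfn M d n (\<lambda>e. R (t1 e) (t2 e) (t3 e))"
proof (rule dfn_comp[OF assms(1), of n
    "\<lambda>i x e. (i = 0 \<and> c1 x = t1 e) \<or> (i = 1 \<and> c2 x = t2 e) \<or> (i = 2 \<and> c3 x = t3 e)"])
  show "\<exists>x\<in>tuples (univ M) d. (i = 0 \<and> c1 x = t1 e) \<or> (i = 1 \<and> c2 x = t2 e) \<or> (i = 2 \<and> c3 x = t3 e)"
    if "i < 3" "env M d e" for i :: nat and e
    using less_3_cases[OF that(1)] tm_ex[OF assms(2) that(2)] tm_ex[OF assms(3) that(2)]
      tm_ex[OF assms(4) that(2)] by auto
  show "dfn M d (Suc n) (\<lambda>e. (i = 0 \<and> c1 (e 0) = t1 (\<lambda>j. e (Suc j))) \<or>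
           (i = 1 \<and> c2 (e 0) = t2 (\<lambda>j. e (Suc j))) \<or> (i = 2 \<and> c3 (e 0) = t3 (\<lambda>j. e (Suc j))))"
    if "i < 3" for i :: nat
    using less_3_cases[OF that] tm_dfn[OF assms(2)] tm_dfn[OF assms(3)] tm_dfn[OF assms(4)] by auto
next
  fix e h assume "env M d e" "env M d h"
    and *: "\<And>i. i < 3 \<Longrightarrow> (i = 0 \<and> c1 (h i) = t1 e) \<or> (i = 1 \<and> c2 (h i) = t2 e) \<or>
      (i = 2 \<and> c3 (h i) = t3 e)"
  show "R (c1 (h 0)) (c2 (h 1)) (c3 (h 2)) = R (t1 e) (t2 e) (t3 e)"
    using *[of 0] *[of 1] *[of 2] by simp
qed

lemma dfn_subst4:
  assumes "dfn M d 4 (\<lambda>e. R (c1 (e 0)) (c2 (e 1)) (c3 (e 2)) (c4 (e 3)))"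
    "tm M d n c1 t1" "tm M d n c2 t2" "tm M d n c3 t3" "tm M d n c4 t4"
  shows "dfn M d n (\<lambda>e. R (t1 e) (t2 e) (t3 e) (t4 e))"
proof (rule dfn_comp[OF assms(1), of n
    "\<lambda>i x e. (i = 0 \<and> c1 x = t1 e) \<or> (i = 1 \<and> c2 x = t2 e) \<or> (i = 2 \<and> c3 x = t3 e) \<or>
      (i = 3 \<and> c4 x = t4 e)"])
  show "\<exists>x\<in>tuples (univ M) d. (i = 0 \<and> c1 x = t1 e) \<or> (i = 1 \<and> c2 x = t2 e) \<or>
      (i = 2 \<and> c3 x = t3 e) \<or> (i = 3 \<and> c4 x = t4 e)"
    if "i < 4" "env M d e" for i :: nat and e
    using less_4_cases[OF that(1)] tm_ex[OF assms(2) that(2)] tm_ex[OF assms(3) that(2)]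
      tm_ex[OF assms(4) that(2)] tm_ex[OF assms(5) that(2)] by auto
  show "dfn M d (Suc n) (\<lambda>e. (i = 0 \<and> c1 (e 0) = t1 (\<lambda>j. e (Suc j))) \<or>
           (i = 1 \<and> c2 (e 0) = t2 (\<lambda>j. e (Suc j))) \<or> (i = 2 \<and> c3 (e 0) = t3 (\<lambda>j. e (Suc j))) \<or>
           (i = 3 \<and> c4 (e 0) = t4 (\<lambda>j. e (Suc j))))"
    if "i < 4" for i :: nat
    using less_4_cases[OF that] tm_dfn[OF assms(2)] tm_dfn[OF assms(3)] tm_dfn[OF assms(4)]
      tm_dfn[OF assms(5)] by auto
next
  fix e h assume "env M d e" "env M d h"
    and *: "\<And>i. i < 4 \<Longrightarrow> (i = 0 \<and> c1 (h i) = t1 e) \<or> (i = 1 \<and> c2 (h i) = t2 e) \<or>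
      (i = 2 \<and> c3 (h i) = t3 e) \<or> (i = 3 \<and> c4 (h i) = t4 e)"
  show "R (c1 (h 0)) (c2 (h 1)) (c3 (h 2)) (c4 (h 3)) = R (t1 e) (t2 e) (t3 e) (t4 e)"
    using *[of 0] *[of 1] *[of 2] *[of 3] by simp
qed

lemma tm_weaken:
  assumes "tm M d n c t" shows "tm M d (Suc n) c (\<lambda>e. t (\<lambda>k. e (Suc k)))"
proof -
  have "dfn M d (Suc (Suc n)) (\<lambda>e. c (e 0) = t (\<lambda>k. e (Suc (Suc k))))"
    using dfn_rename[of M d "Suc n" "\<lambda>e. c (e 0) = t (\<lambda>k. e (Suc k))"
        "case_nat 0 (\<lambda>i. Suc (Suc i))" "Suc (Suc n)"] assms
    unfolding tm_def by (auto split: nat.split)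
  then show ?thesis using assms env_shift unfolding tm_def by blast
qed

lemma tm_subst0:
  assumes "dfn M d 1 (\<lambda>e. c (e 0) = a)" "a \<in> c ` tuples (univ M) d"
  shows "tm M d n c (\<lambda>e. a)"
  unfolding tm_def using assms dfn_rename[OF assms(1), of id "Suc n"] by simp

lemma tm_subst1:
  assumes "dfn M d 2 (\<lambda>e. c (e 0) = f (c1 (e 1)))"
    "\<And>x. x \<in> c1 ` tuples (univ M) d \<Longrightarrow> f x \<in> c ` tuples (univ M) d"
    "dfn M d 2 (\<lambda>e. c (e 0) = c (e 1))"
    "tm M d n c1 t1"
  shows "tm M d n c (\<lambda>e. f (t1 e))"
  unfolding tm_def
proof (intro conjI allI impI)
  show "f (t1 e) \<in> c ` tuples (univ M) d" if "env M d e" for e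
    using assms that unfolding tm_def by blast
  show "dfn M d (Suc n) (\<lambda>e. c (e 0) = f (t1 (\<lambda>k. e (Suc k))))"
    using dfn_subst2[OF assms(1) tm_var[OF assms(3), of 0 "Suc n"] tm_weaken[OF assms(4)]]
    by simp
qed

lemma tm_subst2:
  assumes "dfn M d 3 (\<lambda>e. c (e 0) = f (c1 (e 1)) (c2 (e 2)))"
    "\<And>x y. x \<in> c1 ` tuples (univ M) d \<Longrightarrow> y \<in> c2 ` tuples (univ M) d \<Longrightarrow> f x y \<in> c ` tuples (univ M) d"
    "dfn M d 2 (\<lambda>e. c (e 0) = c (e 1))"
    "tm M d n c1 t1" "tm M d n c2 t2"
  shows "tm M d n c (\<lambda>e. f (t1 e) (t2 e))"
  unfolding tm_def
proof (intro conjI allI impI)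
  show "f (t1 e) (t2 e) \<in> c ` tuples (univ M) d" if "env M d e" for e
    using assms that unfolding tm_def by blast
  show "dfn M d (Suc n) (\<lambda>e. c (e 0) = f (t1 (\<lambda>k. e (Suc k))) (t2 (\<lambda>k. e (Suc k))))"
    using dfn_subst3[where R = "\<lambda>x y z. x = f y z", OF assms(1) tm_var[OF assms(3), of 0 "Suc n"]
        tm_weaken[OF assms(4)] tm_weaken[OF assms(5)]]
    by simp
qed

section \<open>Interpretations by total coordinate maps\<close>

lemma concat_map_tuples:
  assumes "set xss \<subseteq> tuples U d" shows "concat xss \<in> tuples U (length xss * d)"
  using assms by (induction xss) (auto simp: tuples_def)

lemma env_of_list:
  assumes "set xss \<subseteq> tuples (univ M) d" "univ M \<noteq> {}"
  obtains e where "env M d e" "map e [0..<length xss] = xss"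
proof -
  obtain u where u: "u \<in> univ M" using assms by auto
  let ?e = "\<lambda>i. if i < length xss then xss ! i else replicate d u"
  have "xss ! i \<in> tuples (univ M) d" if "i < length xss" for i
    using assms(1) that by (meson nth_mem subsetD)
  then have "env M d ?e" using u by (auto simp: env_def tuples_def)
  moreover have "map ?e [0..<length xss] = xss" by (rule nth_equalityI) auto
  ultimately show ?thesis using that[of ?e] by auto
qed

text \<open>With the kernel of \<mu> as equivalence, relations pulled back along \<mu> are
  automatically invariant, and surjectivity makes the induced map on classes a bijection.\<close>

lemma interpretation_total:
  fixes M :: "('r, 'a) rel_structure" and N :: "('s, 'b) rel_structure"
  assumes d: "0 < d" and ne: "univ N \<noteq> {}"
    and surj: "\<mu> ` tuples (univ N) d = univ M"
    and eq: "dfn N d 2 (\<lambda>e. \<mu> (e 0) = \<mu> (e 1))"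
    and rels: "\<And>r. r \<in> syms M \<Longrightarrow>
      dfn N d (arity M r) (\<lambda>e. rel M r (map (\<lambda>i. \<mu> (e i)) [0..<arity M r]))"
  obtains \<Gamma> where "interpretation_via M N \<Gamma> \<mu>" "code_dim \<Gamma> = d" "dom_set \<Gamma> N = tuples (univ N) d"
proof -
  obtain q where q: "formula_in N (2 * d) q"
    "\<And>e. env N d e \<Longrightarrow> sat N (concat (map e [0..<2])) q = (\<mu> (e 0) = \<mu> (e 1))"
    using eq unfolding dfn_def by auto
  obtain R where R: "\<And>r. r \<in> syms M \<Longrightarrow> formula_in N (arity M r * d) (R r)"
    "\<And>r e. r \<in> syms M \<Longrightarrow> env N d e \<Longrightarrow>
      sat N (concat (map e [0..<arity M r])) (R r) = rel M r (map (\<lambda>i. \<mu> (e i)) [0..<arity M r])"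
    using rels unfolding dfn_def by metis
  define T where "T = tuples (univ N) d"
  \<comment> \<open>\<open>FEq 0 0\<close> accepts every tuple; index 0 is admissible because
    \<open>0 < d\<close>.\<close>
  define G where "G = \<lparr>code_dim = d, code_dom = FEq 0 0, code_eq = q, code_rel = R\<rparr>"
  have dom: "dom_set G N = T" by (simp add: G_def dom_set_def T_def)
  have sat_q: "sat N (xs @ ys) q \<longleftrightarrow> \<mu> xs = \<mu> ys" if "xs \<in> T" "ys \<in> T" for xs ys
  proof -
    have "set [xs, ys] \<subseteq> tuples (univ N) d" using that by (simp add: T_def)
    from env_of_list[OF this ne] obtain e where
      e: "env N d e" "map e [0..<length [xs, ys]] = [xs, ys]" by blast
    then have "concat (map e [0..<2]) = xs @ ys" "e 0 = xs" "e 1 = ys"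
      by (auto simp: numeral_2_eq_2)
    then show ?thesis using q(2)[OF e(1)] by simp
  qed
  have eqr: "eq_rel G N = {(xs, ys). xs \<in> T \<and> ys \<in> T \<and> \<mu> xs = \<mu> ys}"
    unfolding eq_rel_def dom using sat_q by (auto simp: G_def)
  have sat_R: "sat N (concat xss) (R r) \<longleftrightarrow> rel M r (map \<mu> xss)"
    if r: "r \<in> syms M" and "set xss \<subseteq> T" and len: "length xss = arity M r" for r xss
  proof -
    have "set xss \<subseteq> tuples (univ N) d" using that by (simp add: T_def)
    from env_of_list[OF this ne] obtain e where e: "env N d e" "map e [0..<arity M r] = xss"
      unfolding len by blast
    have "map (\<lambda>i. \<mu> (e i)) [0..<arity M r] = map \<mu> xss" unfolding e(2)[symmetric] by simp
    then show ?thesis using R(2)[OF r e(1)] e(2) by simp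
  qed
  have code: "code_for G M N"
    using d q(1) R(1) by (simp add: code_for_def G_def)
  have T_ne: "T \<noteq> {}"
  proof -
    obtain u where "u \<in> univ N" using ne by auto
    then have "replicate d u \<in> T" by (auto simp: T_def tuples_def)
    then show ?thesis by blast
  qed
  have wd: "code_well_defined G M N"
    unfolding code_well_defined_def
  proof (intro conjI code ballI allI impI)
    show "dom_set G N \<noteq> {}" using T_ne dom by simp
    show "equiv (dom_set G N) (eq_rel G N)"
      unfolding dom eqr by (auto intro!: equivI refl_onI symI transI)
    fix r xss yss
    assume r: "r \<in> syms M" and len: "length xss = arity M r"
      and *: "list_all2 (\<lambda>xs ys. (xs, ys) \<in> eq_rel G N) xss yss"
    have "list_all2 (\<lambda>xs ys. xs \<in> T \<and> ys \<in> T \<and> \<mu> xs = \<mu> ys) xss yss"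
      using * unfolding eqr by (simp add: case_prod_unfold)
    then have "set xss \<subseteq> T \<and> set yss \<subseteq> T \<and> map \<mu> xss = map \<mu> yss \<and> length yss = length xss"
      by (induction rule: list_all2_induct) auto
    then show "sat N (concat xss) (code_rel G r) = sat N (concat yss) (code_rel G r)"
      using sat_R[OF r] len by (simp add: G_def)
  qed
  \<comment> \<open>\<mu> is constant on each class, so it does not matter which representative is
    taken.\<close>
  define h where "h C = \<mu> (SOME x. x \<in> C)" for C
  have h: "h (eq_rel G N `` {xs}) = \<mu> xs" if "xs \<in> T" for xs
  proof -
    have "(SOME x. x \<in> eq_rel G N `` {xs}) \<in> eq_rel G N `` {xs}"
      by (rule someI[of _ xs]) (use that in \<open>simp add: eqr\<close>)
    then have "(xs, SOME x. x \<in> eq_rel G N `` {xs}) \<in> eq_rel G N" by simp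
    then have "\<mu> xs = \<mu> (SOME x. x \<in> eq_rel G N `` {xs})" unfolding eqr by fast
    then show ?thesis unfolding h_def by (rule sym)
  qed
  have quot: "T // eq_rel G N = (\<lambda>xs. eq_rel G N `` {xs}) ` T"
    by (auto simp: quotient_def)
  have bij: "bij_betw h (T // eq_rel G N) (univ M)"
    unfolding bij_betw_def
  proof
    show "inj_on h (T // eq_rel G N)"
      unfolding quot
    proof (rule inj_onI, elim imageE)
      fix C D xs ys
      assume *: "C = eq_rel G N `` {xs}" "D = eq_rel G N `` {ys}" "xs \<in> T" "ys \<in> T" "h C = h D"
      then have "\<mu> xs = \<mu> ys" by (simp add: h)
      then show "C = D" using * by (auto simp: eqr)
    qed
    show "h ` (T // eq_rel G N) = univ M"
      unfolding quot image_image using h surj by (simp add: T_def)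
  qed
  have "structure_iso h (coded_structure G M N) M"
    unfolding structure_iso_def coded_structure_def rel_structure.simps dom
  proof (intro conjI ballI bij refl)
    fix r cs assume r: "r \<in> syms M" and cs: "cs \<in> tuples (T // eq_rel G N) (arity M r)"
    have "cs \<in> lists ((\<lambda>xs. eq_rel G N `` {xs}) ` T)" using cs quot by (auto simp: tuples_def)
    then obtain xss where xss: "set xss \<subseteq> T" "cs = map (\<lambda>xs. eq_rel G N `` {xs}) xss"
      unfolding lists_image by auto
    have map_h: "map h (map (\<lambda>xs. eq_rel G N `` {xs}) xss) = map \<mu> xss" if "set xss \<subseteq> T" for xss
      using that h by auto
    have R': "code_rel G r = R r" by (simp add: G_def)
    have len: "length yss = arity M r" if "cs = map (\<lambda>xs. eq_rel G N `` {xs}) yss" for yss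
      using cs that by (auto simp: tuples_def)
    show "(\<exists>xss. set xss \<subseteq> T \<and> cs = map (\<lambda>xs. eq_rel G N `` {xs}) xss \<and>
            sat N (concat xss) (code_rel G r)) = rel M r (map h cs)"
      (is "?L = ?R")
    proof
      assume ?L
      then obtain yss where yss: "set yss \<subseteq> T" "cs = map (\<lambda>xs. eq_rel G N `` {xs}) yss"
        "sat N (concat yss) (R r)" unfolding R' by blast
      then show ?R using sat_R[OF r yss(1) len[OF yss(2)]] map_h[OF yss(1)] yss(2,3) by metis
    next
      assume ?R
      then have "rel M r (map \<mu> xss)" using map_h[OF xss(1)] xss(2) by metis
      then show ?L unfolding R' using sat_R[OF r xss(1) len[OF xss(2)]] xss by blast
    qed
  qed
  then have "interpretation_via M N G \<mu>"
    unfolding interpretation_via_def dom using wd h by (intro conjI exI[of _ h]) auto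
  then show ?thesis using that[of G] dom by (simp add: G_def T_def)
qed

text \<open>The calculus knows only blocks of length \<open>d\<close>, while the graph of a
  composite ends in a single element. The value is therefore read as component 0 of one more block,
  and this block is then shrunk to one variable.\<close>

lemma definable_graph:
  assumes d: "0 < d" and ne: "univ M \<noteq> {}"
    and f: "\<And>xss. xss \<in> tuples (tuples (univ M) d) k \<Longrightarrow> f xss \<in> univ M"
    and D: "dfn M d (Suc k) (\<lambda>e. e k ! 0 = f (map e [0..<k]))"
  shows "definable M (k * d + 1) {concat xss @ [f xss] | xss. xss \<in> tuples (tuples (univ M) d) k}"
proof -
  obtain p where p: "formula_in M (Suc k * d) p"
    "\<And>e. env M d e \<Longrightarrow> sat M (concat (map e [0..<Suc k])) p = (e k ! 0 = f (map e [0..<k]))"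
    using D unfolding dfn_def by auto
  \<comment> \<open>All variables of the last block are identified with variable
    \<open>k * d\<close>; accordingly, that block is filled with copies of the value
    (\<open>replicate d z\<close>) below.\<close>
  define g where "g i = min i (k * d)" for i
  have form: "formula_in M (k * d + 1) (rename g p)"
    by (rule rename_formula_in[OF p(1)]) (simp add: g_def)
  have sat: "sat M (concat xss @ [z]) (rename g p) \<longleftrightarrow> z = f xss"
    if xss: "xss \<in> tuples (tuples (univ M) d) k" and z: "z \<in> univ M" for xss z
  proof -
    have len: "length xss = k" using xss by (simp add: tuples_def)
    have "set (xss @ [replicate d z]) \<subseteq> tuples (univ M) d"
      using xss z by (auto simp: tuples_def)
    from env_of_list[OF this ne] obtain e where e: "env M d e"
      "map e [0..<Suc k] = xss @ [replicate d z]"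
      using len by auto
    then have e': "map e [0..<k] = xss" "e k = replicate d z" by auto
    have lc: "length (concat xss) = k * d"
      using concat_map_tuples[of xss "univ M" d] xss by (auto simp: tuples_def)
    have "sat M (concat xss @ [z]) (rename g p) = sat M (concat (map e [0..<Suc k])) p"
      by (rule sat_rename[OF p(1)]) (use lc in \<open>auto simp: e' g_def nth_append min_def\<close>)
    then show ?thesis using p(2)[OF e(1)] e' d by simp
  qed
  have "\<exists>yss. xs = concat yss @ [z] \<and> yss \<in> tuples (tuples (univ M) d) k"
    if "xs = ys @ [z]" "set ys \<subseteq> univ M" "length ys = k * d" for xs ys z
  proof -
    have "\<exists>yss. ys = concat yss \<and> yss \<in> tuples (tuples (univ M) d) k"
      using that(2,3)
    proof (induction k arbitrary: ys)
      case (Suc k)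
      obtain yss where "drop d ys = concat yss" "yss \<in> tuples (tuples (univ M) d) k"
        using Suc.IH[of "drop d ys"] Suc.prems by (auto dest: in_set_dropD)
      then have "ys = concat (take d ys # yss)"
        by (metis append_take_drop_id concat.simps(2))
      moreover have "take d ys # yss \<in> tuples (tuples (univ M) d) (Suc k)"
        using Suc.prems \<open>yss \<in> _\<close> by (auto simp: tuples_def dest: in_set_takeD)
      ultimately show ?case by blast
    qed (auto simp: tuples_def)
    then show ?thesis using that(1) by auto
  qed note split = this
  show ?thesis unfolding definable_def
  proof (intro exI[of _ "rename g p"] conjI form equalityI subsetI)
    fix xs assume "xs \<in> {concat xss @ [f xss] | xss. xss \<in> tuples (tuples (univ M) d) k}"
    then obtain xss where xss: "xs = concat xss @ [f xss]" "xss \<in> tuples (tuples (univ M) d) k"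
      by auto
    moreover have "concat xss \<in> tuples (univ M) (k * d)"
      using concat_map_tuples[of xss "univ M" d] xss by (auto simp: tuples_def)
    ultimately show "xs \<in> {xs \<in> tuples (univ M) (k * d + 1). sat M xs (rename g p)}"
      using sat[OF xss(2) f[OF xss(2)]] f[OF xss(2)] by (auto simp: tuples_def)
  next
    fix xs assume xs: "xs \<in> {xs \<in> tuples (univ M) (k * d + 1). sat M xs (rename g p)}"
    then obtain ys z where ys: "xs = ys @ [z]" "set ys \<subseteq> univ M" "length ys = k * d" "z \<in> univ M"
      by (cases xs rule: rev_cases) (auto simp: tuples_def)
    then obtain yss where yss: "xs = concat yss @ [z]" "yss \<in> tuples (tuples (univ M) d) k"
      using split by blast
    then show "xs \<in> {concat xss @ [f xss] | xss. xss \<in> tuples (tuples (univ M) d) k}"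
      using xs sat[OF yss(2) ys(4)] by auto
  qed
qed

section \<open>Hereditarily finite sets\<close>

primrec els :: "'a hf \<Rightarrow> 'a hf set" where
  "els (Ur a) = {}"
| "els (HSet X) = fset X"

primrec is_Ur :: "'a hf \<Rightarrow> bool" where
  "is_Ur (Ur a) = True"
| "is_Ur (HSet X) = False"

text \<open>Not the usual rank: a sum replaces the maximum and so covers the empty set without a
  separate case. Only strict growth along membership (\<open>rank_els\<close>) matters.\<close>

primrec rank :: "'a hf \<Rightarrow> nat" where
  "rank (Ur a) = 0"
| "rank (HSet X) = Suc (\<Sum>(fset (fimage rank X)))"

lemma rank_els: "x \<in> els y \<Longrightarrow> rank x < rank y"
proof (cases y)
  case (HSet X)
  assume "x \<in> els y"
  then have "rank x \<le> \<Sum>(rank ` fset X)" using HSet by (intro member_le_sum) auto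
  then show ?thesis using HSet by simp
qed simp

lemma finite_els: "finite (els x)"
  by (cases x) auto

lemma is_Ur_iff: "is_Ur x \<longleftrightarrow> (\<exists>a. x = Ur a)"
  by (cases x) auto

lemma hf_ext: "\<not> is_Ur x \<Longrightarrow> \<not> is_Ur y \<Longrightarrow> els x = els y \<Longrightarrow> x = y"
  by (cases x; cases y) (auto simp: fset_inject)

lemma HF_Ur [simp]: "Ur a \<in> HF U \<longleftrightarrow> a \<in> U"
proof
  assume "Ur a \<in> HF U"
  then obtain k where "Ur a \<in> HF_level U k" by (auto simp: HF_def)
  then show "a \<in> U" by (induction k) auto
next
  assume "a \<in> U"
  then have "Ur a \<in> HF_level U 0" by simp
  then show "Ur a \<in> HF U" unfolding HF_def by blast
qed

lemma HF_level_mono: "k \<le> l \<Longrightarrow> HF_level U k \<subseteq> HF_level U l"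
  by (rule lift_Suc_mono_le[of "HF_level U"]) auto

lemma HF_HSet [simp]: "HSet X \<in> HF U \<longleftrightarrow> fset X \<subseteq> HF U"
proof
  assume "HSet X \<in> HF U"
  then obtain k where "HSet X \<in> HF_level U k" by (auto simp: HF_def)
  then show "fset X \<subseteq> HF U" by (induction k) (auto simp: HF_def)
next
  assume X: "fset X \<subseteq> HF U"
  then obtain l where l: "\<And>x. x \<in> fset X \<Longrightarrow> x \<in> HF_level U (l x)"
    unfolding HF_def by (metis UN_E subsetD)
  \<comment> \<open>The sum of the finitely many levels is at least each of them, hence a common
    level.\<close>
  have "x \<in> HF_level U (\<Sum>x\<in>fset X. l x)" if "x \<in> fset X" for x
  proof -
    have "l x \<le> (\<Sum>x\<in>fset X. l x)" using that by (intro member_le_sum) auto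
    then show ?thesis using l[OF that] HF_level_mono by blast
  qed
  then have "HSet X \<in> HF_level U (Suc (\<Sum>x\<in>fset X. l x))" by auto
  then show "HSet X \<in> HF U" unfolding HF_def by blast
qed

lemma els_HF: "y \<in> HF U \<Longrightarrow> x \<in> els y \<Longrightarrow> x \<in> HF U"
  by (cases y) auto

definition hset :: "'a hf set \<Rightarrow> 'a hf" where
  "hset X = HSet (Abs_fset X)"

lemma els_hset [simp]: "finite X \<Longrightarrow> els (hset X) = X"
  by (simp add: hset_def Abs_fset_inverse)

lemma hset_HF: "finite X \<Longrightarrow> X \<subseteq> HF U \<Longrightarrow> hset X \<in> HF U"
  by (simp add: hset_def Abs_fset_inverse)

lemma is_Ur_hset [simp]: "\<not> is_Ur (hset X)"
  by (simp add: hset_def)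

definition upr :: "'a hf \<Rightarrow> 'a hf \<Rightarrow> 'a hf" where
  "upr x y = HSet {|x, y|}"

text \<open>Kuratowski's pair, built from \<open>upr\<close> alone so that its definability follows
  by substitution.\<close>

definition pair :: "'a hf \<Rightarrow> 'a hf \<Rightarrow> 'a hf" where
  "pair x y = upr (upr x x) (upr x y)"

lemma els_upr [simp]: "els (upr x y) = {x, y}" and is_Ur_upr [simp]: "\<not> is_Ur (upr x y)"
  by (simp_all add: upr_def)

lemma upr_HF [simp]: "upr x y \<in> HF U \<longleftrightarrow> x \<in> HF U \<and> y \<in> HF U"
  by (simp add: upr_def)

lemma pair_HF [simp]: "pair x y \<in> HF U \<longleftrightarrow> x \<in> HF U \<and> y \<in> HF U"
  by (auto simp: pair_def)

lemma upr_eq: "upr x y = upr u v \<longleftrightarrow> {x, y} = {u, v}"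
  by (metis els_upr hf_ext is_Ur_upr)

lemma pair_inject [simp]: "pair x y = pair u v \<longleftrightarrow> x = u \<and> y = v"
  unfolding pair_def by (auto simp: upr_eq doubleton_eq_iff)

lemma eq_upr_iff:
  assumes "x \<in> HF U" "y \<in> HF U" "z \<in> HF U"
  shows "z = upr x y \<longleftrightarrow> \<not> is_Ur z \<and> (\<forall>w\<in>HF U. w \<in> els z \<longleftrightarrow> w = x \<or> w = y)"
    (is "_ \<longleftrightarrow> ?R")
proof
  assume ?R
  then have "els z = {x, y}" using assms els_HF by blast
  then show "z = upr x y" using \<open>?R\<close> by (intro hf_ext) auto
qed simp

section \<open>Arithmetic of cardinalities\<close>

lemma infinite_HF: "infinite (HF U)"
proof
  assume fin: "finite (HF U)"
  \<comment> \<open>A finite universe would be its own member, which \<open>rank\<close> forbids. So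
    every number is a cardinality, even over a finite \<open>U\<close>.\<close>
  then have "hset (HF U) \<in> els (hset (HF U))" by (simp add: hset_HF)
  then show False using rank_els by blast
qed

lemma HF_card_ex: "\<exists>x\<in>HF U. card (els x) = n"
proof -
  obtain X where "finite X" "card X = n" "X \<subseteq> HF U"
    using infinite_HF infinite_arbitrarily_large by metis
  then show ?thesis by (intro bexI[of _ "hset X"] hset_HF) auto
qed

text \<open>All quantifiers on the right are relativised to \<open>HF U\<close>, so that the rules
  for \<open>dfn\<close> apply to it as it stands. The single equivalence
  \<open>u = u' \<longleftrightarrow> v = v'\<close> expresses that \<open>f\<close> is a function
  and that it is injective.\<close>

lemma card_eq_iff:
  assumes x: "x \<in> HF U" and y: "y \<in> HF U"
  shows "card (els x) = card (els y) \<longleftrightarrow>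
    (\<exists>f\<in>HF U.
      (\<forall>u\<in>HF U. u \<in> els x \<longrightarrow> (\<exists>v\<in>HF U. v \<in> els y \<and> pair u v \<in> els f)) \<and>
      (\<forall>v\<in>HF U. v \<in> els y \<longrightarrow> (\<exists>u\<in>HF U. u \<in> els x \<and> pair u v \<in> els f)) \<and>
      (\<forall>u\<in>HF U. \<forall>v\<in>HF U. \<forall>u'\<in>HF U. \<forall>v'\<in>HF U.
        pair u v \<in> els f \<and> pair u' v' \<in> els f \<longrightarrow> (u = u' \<longleftrightarrow> v = v')))"
    (is "?L \<longleftrightarrow> ?R")
proof
  assume ?L
  then obtain g where g: "bij_betw g (els x) (els y)"
    using finite_same_card_bij[OF finite_els finite_els] by blast
  let ?F = "(\<lambda>u. pair u (g u)) ` els x"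
  have g_in: "g u \<in> els y" if "u \<in> els x" for u using g that by (auto simp: bij_betw_def)
  have g_onto: "\<exists>u\<in>els x. v = g u" if "v \<in> els y" for v using g that by (auto simp: bij_betw_def)
  have g_inj: "g u = g u' \<longleftrightarrow> u = u'" if "u \<in> els x" "u' \<in> els x" for u u'
    using g that by (auto simp: bij_betw_def inj_on_def)
  have fin: "finite ?F" by (simp add: finite_els)
  have "?F \<subseteq> HF U" using els_HF[OF x] els_HF[OF y] g_in by auto
  with fin have F: "hset ?F \<in> HF U" by (rule hset_HF)
  show ?R
  proof (rule bexI[OF _ F], intro conjI ballI impI)
    fix u assume "u \<in> els x"
    then show "\<exists>v\<in>HF U. v \<in> els y \<and> pair u v \<in> els (hset ?F)"
      using g_in els_HF[OF y] by (intro bexI[of _ "g u"]) (auto simp: fin)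
  next
    fix v assume "v \<in> els y"
    then obtain u where "u \<in> els x" "v = g u" using g_onto by blast
    then show "\<exists>u\<in>HF U. u \<in> els x \<and> pair u v \<in> els (hset ?F)"
      using els_HF[OF x] by (intro bexI[of _ u]) (auto simp: fin)
  next
    fix u v u' v' assume "pair u v \<in> els (hset ?F) \<and> pair u' v' \<in> els (hset ?F)"
    then show "u = u' \<longleftrightarrow> v = v'" using g_inj by (auto simp: fin)
  qed
next
  assume ?R
  then obtain f where
    *: "\<forall>u\<in>HF U. u \<in> els x \<longrightarrow> (\<exists>v\<in>HF U. v \<in> els y \<and> pair u v \<in> els f)"
      "\<forall>v\<in>HF U. v \<in> els y \<longrightarrow> (\<exists>u\<in>HF U. u \<in> els x \<and> pair u v \<in> els f)"
      "\<forall>u\<in>HF U. \<forall>v\<in>HF U. \<forall>u'\<in>HF U. \<forall>v'\<in>HF U.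
        pair u v \<in> els f \<and> pair u' v' \<in> els f \<longrightarrow> (u = u' \<longleftrightarrow> v = v')"
    by (elim bexE conjE)
  have 1: "\<exists>v. v \<in> els y \<and> pair u v \<in> els f" if "u \<in> els x" for u
    using *(1) els_HF[OF x that] that by blast
  have 2: "\<exists>u. u \<in> els x \<and> pair u v \<in> els f" if "v \<in> els y" for v
    using *(2) els_HF[OF y that] that by blast
  have 3: "u = u' \<longleftrightarrow> v = v'"
    if "u \<in> els x" "u' \<in> els x" "v \<in> els y" "v' \<in> els y" "pair u v \<in> els f" "pair u' v' \<in> els f"
    for u v u' v'
    using *(3) els_HF[OF x] els_HF[OF y] that by blast
  obtain g where g: "\<And>u. u \<in> els x \<Longrightarrow> g u \<in> els y \<and> pair u (g u) \<in> els f"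
    using 1 by metis
  have "bij_betw g (els x) (els y)"
  proof (rule bij_betwI')
    show "g u = g u' \<longleftrightarrow> u = u'" if "u \<in> els x" "u' \<in> els x" for u u'
      using 3[OF that] g that by blast
    show "\<exists>u\<in>els x. v = g u" if v: "v \<in> els y" for v
    proof -
      obtain u where u: "u \<in> els x" "pair u v \<in> els f" using 2[OF v] by blast
      then have "v = g u" using 3[OF u(1) u(1) v] g[OF u(1)] by blast
      then show ?thesis using u(1) by blast
    qed
  qed (use g in blast)
  then show ?L by (rule bij_betw_same_card)
qed

text \<open>As \<open>x\<close> and \<open>y\<close> may overlap, their union is of no use; instead
  \<open>z\<close> is split into two disjoint parts of the required sizes.\<close>

lemma card_plus_iff:
  assumes x: "x \<in> HF U" and y: "y \<in> HF U" and z: "z \<in> HF U"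
  shows "card (els z) = card (els x) + card (els y) \<longleftrightarrow>
    (\<exists>x'\<in>HF U. \<exists>y'\<in>HF U. card (els x') = card (els x) \<and> card (els y') = card (els y) \<and>
      (\<forall>w\<in>HF U. (w \<in> els z \<longleftrightarrow> w \<in> els x' \<or> w \<in> els y') \<and> \<not> (w \<in> els x' \<and> w \<in> els y')))"
    (is "?L \<longleftrightarrow> ?R")
proof
  assume ?L
  then obtain X where X: "X \<subseteq> els z" "card X = card (els x)" "finite X"
    by (metis obtain_subset_with_card_n le_add1)
  have "card (els z - X) = card (els y)"
    using X \<open>?L\<close> by (simp add: card_Diff_subset)
  moreover have "els z \<subseteq> HF U" using els_HF[OF z] by blast
  ultimately show ?R using X
    by (intro bexI[of _ "hset X"] bexI[of _ "hset (els z - X)"] hset_HF) (auto simp: finite_els)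
next
  assume ?R
  then obtain x' y' where *: "x' \<in> HF U" "y' \<in> HF U" "card (els x') = card (els x)"
    "card (els y') = card (els y)"
    "\<forall>w\<in>HF U. (w \<in> els z \<longleftrightarrow> w \<in> els x' \<or> w \<in> els y') \<and> \<not> (w \<in> els x' \<and> w \<in> els y')"
    by blast
  then have "els z = els x' \<union> els y'" "els x' \<inter> els y' = {}"
    using els_HF[OF z] els_HF[OF *(1)] els_HF[OF *(2)] by blast+
  then show ?L using * by (simp add: card_Un_disjoint finite_els)
qed

lemma card_times_iff:
  assumes x: "x \<in> HF U" and y: "y \<in> HF U"
  shows "card (els z) = card (els x) * card (els y) \<longleftrightarrow>
    (\<exists>w\<in>HF U. card (els w) = card (els z) \<and>
      (\<forall>p\<in>HF U. p \<in> els w \<longleftrightarrow> (\<exists>u\<in>HF U. \<exists>v\<in>HF U. u \<in> els x \<and> v \<in> els y \<and> p = pair u v)))"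
    (is "?L \<longleftrightarrow> ?R")
proof -
  let ?P = "(\<lambda>(u, v). pair u v) ` (els x \<times> els y)"
  have card: "card ?P = card (els x) * card (els y)"
    by (subst card_image) (auto simp: inj_on_def card_cartesian_product)
  have P: "finite ?P" "?P \<subseteq> HF U" using els_HF[OF x] els_HF[OF y] by (auto simp: finite_els)
  show ?thesis
  proof
    assume ?L
    then show ?R using P card els_HF[OF x] els_HF[OF y]
      by (intro bexI[of _ "hset ?P"] hset_HF) auto
  next
    assume ?R
    then obtain w where w: "w \<in> HF U" "card (els w) = card (els z)"
      "\<forall>p\<in>HF U. p \<in> els w \<longleftrightarrow> (\<exists>u\<in>HF U. \<exists>v\<in>HF U. u \<in> els x \<and> v \<in> els y \<and> p = pair u v)"
      by blast
    have "els w = ?P"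
    proof (intro equalityI subsetI)
      fix p assume "p \<in> els w"
      then obtain u v where "u \<in> els x" "v \<in> els y" "p = pair u v" using w(3) els_HF[OF w(1)] by blast
      then show "p \<in> ?P" by auto
    next
      fix p assume "p \<in> ?P"
      then show "p \<in> els w" using w(3) els_HF[OF x] els_HF[OF y] by auto
    qed
    then show ?L using w(2) card by simp
  qed
qed

section \<open>Copies of the hereditarily finite sets and of the numbers in an arbitrary
  structure\<close>

locale hf_sort =
  fixes M :: "('r, 'b) rel_structure" and d :: nat and c :: "'b list \<Rightarrow> 'a hf" and U :: "'a set"
  assumes range: "c ` tuples (univ M) d = HF U"
    and eq: "dfn M d 2 (\<lambda>e. c (e 0) = c (e 1))"
    and mem: "dfn M d 2 (\<lambda>e. c (e 0) \<in> els (c (e 1)))"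
    and ur: "dfn M d 1 (\<lambda>e. is_Ur (c (e 0)))"
begin

lemma env_HF: "env M d e \<Longrightarrow> c (e i) \<in> HF U"
  using range by (auto simp: env_def)

lemmas [dfn_intros] = tm_var[OF eq] dfn_ex_sort[OF range] dfn_all_sort[OF range]
  dfn_subst2[where R = "\<lambda>x y. x = y", OF eq] dfn_subst2[where R = "\<lambda>x y. x \<in> els y", OF mem]
  dfn_subst1[where R = is_Ur, OF ur]

lemma upr_graph: "dfn M d 3 (\<lambda>e. c (e 0) = upr (c (e 1)) (c (e 2)))"
proof (rule dfn_cong)
  show "dfn M d 3 (\<lambda>e. \<not> is_Ur (c (e 0)) \<and>
      (\<forall>w\<in>HF U. w \<in> els (c (e 0)) \<longleftrightarrow> w = c (e 1) \<or> w = c (e 2)))"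
    by (intro dfn_intros) simp_all
qed (use eq_upr_iff env_HF in blast)

lemma tm_upr [dfn_intros]:
  assumes "tm M d n c s" "tm M d n c t" shows "tm M d n c (\<lambda>e. upr (s e) (t e))"
  by (rule tm_subst2[OF upr_graph _ eq assms]) (simp add: range)

lemma tm_pair [dfn_intros]:
  "tm M d n c s \<Longrightarrow> tm M d n c t \<Longrightarrow> tm M d n c (\<lambda>e. pair (s e) (t e))"
  unfolding pair_def by (intro tm_upr)

end

text \<open>Instantiated in both structures, by cardinalities of sets and by the sort of numbers, so
  that order and polynomial terms are derived only once.\<close>

locale nat_sort =
  fixes M :: "('r, 'b) rel_structure" and d :: nat and c :: "'b list \<Rightarrow> nat"
  assumes range: "c ` tuples (univ M) d = UNIV"
    and eq: "dfn M d 2 (\<lambda>e. c (e 0) = c (e 1))"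
    and zero: "dfn M d 1 (\<lambda>e. c (e 0) = 0)"
    and one: "dfn M d 1 (\<lambda>e. c (e 0) = 1)"
    and plus: "dfn M d 3 (\<lambda>e. c (e 0) = c (e 1) + c (e 2))"
    and times: "dfn M d 3 (\<lambda>e. c (e 0) = c (e 1) * c (e 2))"
begin

lemmas [dfn_intros] = tm_var[OF eq] dfn_subst2[where R = "\<lambda>x y. x = y", OF eq]
  tm_subst0[OF zero, unfolded range, OF UNIV_I] tm_subst0[OF one, unfolded range, OF UNIV_I]

lemma tm_plus [dfn_intros]:
  assumes "tm M d n c s" "tm M d n c t" shows "tm M d n c (\<lambda>e. s e + t e)"
  by (rule tm_subst2[OF plus _ eq assms]) (simp add: range)

lemma tm_times [dfn_intros]:
  assumes "tm M d n c s" "tm M d n c t" shows "tm M d n c (\<lambda>e. s e * t e)"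
  by (rule tm_subst2[OF times _ eq assms]) (simp add: range)

lemma dfn_ex_nat [dfn_intros]:
  fixes P :: "nat \<Rightarrow> _"
  assumes "dfn M d (Suc n) (\<lambda>e. P (c (e 0)) (\<lambda>k. e (Suc k)))"
  shows "dfn M d n (\<lambda>e. \<exists>z. P z e)"
  using dfn_ex_sort[OF range assms] by simp

lemma dfn_all_nat [dfn_intros]:
  fixes P :: "nat \<Rightarrow> _"
  assumes "dfn M d (Suc n) (\<lambda>e. P (c (e 0)) (\<lambda>k. e (Suc k)))"
  shows "dfn M d n (\<lambda>e. \<forall>z. P z e)"
  using dfn_all_sort[OF range assms] by simp

lemma dfn_less [dfn_intros]:
  assumes "tm M d n c s" "tm M d n c t" shows "dfn M d n (\<lambda>e. s e < t e)"
proof (rule dfn_subst2[OF _ assms])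
  show "dfn M d 2 (\<lambda>e. c (e 0) < c (e 1))"
  proof (rule dfn_cong)
    show "dfn M d 2 (\<lambda>e. \<exists>k. c (e 1) = c (e 0) + k + 1)"
      by (intro dfn_intros) simp_all
  qed (auto simp: less_iff_Suc_add)
qed

lemma dfn_le [dfn_intros]:
  assumes "tm M d n c s" "tm M d n c t" shows "dfn M d n (\<lambda>e. s e \<le> t e)"
  using dfn_not[OF dfn_less[OF assms(2,1)]] by (simp add: not_less)

end

section \<open>Coding finite relations and hereditarily finite sets by sequences\<close>

text \<open>A pairing polynomial and hence a term of arithmetic, with no division by two as in
  Cantor's. Injective because adding \<open>u\<close> to the square of \<open>u + v\<close> stays
  below the next square. The offset keeps position 1 free for the marker; it is written
  \<open>1 + 1\<close> since only 0 and 1 are available as constants.\<close>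

definition code2 :: "nat \<Rightarrow> nat \<Rightarrow> nat" where
  "code2 u v = (u + v) * (u + v) + u + 1 + 1"

lemma code2_inject: "code2 u v = code2 u' v' \<longleftrightarrow> u = u' \<and> v = v'"
proof -
  have less: "code2 u v < code2 u' v'" if "u + v < u' + v'" for u v u' v'
  proof -
    have "Suc (u + v) * Suc (u + v) \<le> (u' + v') * (u' + v')" using that by (intro mult_le_mono) auto
    then show ?thesis by (simp add: code2_def)
  qed
  show ?thesis
  proof (cases "u + v = u' + v'")
    case True
    then show ?thesis by (auto simp: code2_def)
  next
    case False
    then consider "u + v < u' + v'" | "u' + v' < u + v" by linarith
    then show ?thesis using less[of u v u' v'] less[of u' v' u v] by cases auto
  qed
qed

definition at :: "'a list \<Rightarrow> nat \<Rightarrow> 'a \<Rightarrow> bool" where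
  "at s i a \<longleftrightarrow> 1 \<le> i \<and> i \<le> length s \<and> a = s ! (i - 1)"

lemma at_inject: "at s = at s' \<Longrightarrow> s = s'"
proof -
  assume eq: "at s = at s'"
  have "(\<exists>a. at s i a) \<longleftrightarrow> 1 \<le> i \<and> i \<le> length s" for i and s :: "'a list" by (auto simp: at_def)
  then have "\<forall>i. (1 \<le> i \<and> i \<le> length s) = (1 \<le> i \<and> i \<le> length s')" using eq by metis
  then have len: "length s = length s'"
    by (metis Suc_leI One_nat_def le_antisym le_numeral_extra(4) nat_le_linear not_less_eq_eq zero_le)
  show ?thesis
  proof (rule nth_equalityI[OF len])
    fix i assume "i < length s"
    then have "at s (Suc i) (s ! i)" by (simp add: at_def)
    then show "s ! i = s' ! i" unfolding eq by (simp add: at_def)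
  qed
qed

text \<open>The first entry of a sequence serves as the marker for membership.\<close>

definition edge :: "'a list \<Rightarrow> nat \<Rightarrow> nat \<Rightarrow> bool" where
  "edge e u v \<longleftrightarrow> (\<exists>a. at e 1 a \<and> at e (code2 u v) a)"

text \<open>This is where two distinct elements enter: a word in two letters codes a finite set of
  positions. Comparing with the first entry, rather than with a fixed element, keeps
  \<open>edge\<close> free of parameters.\<close>

lemma edge_ex:
  assumes "a \<in> U" "b \<in> U" "a \<noteq> b" "finite B"
  shows "\<exists>e\<in>lists U. \<forall>u v. edge e u v \<longleftrightarrow> (u, v) \<in> B"
proof -
  define C where "C = insert 1 ((\<lambda>(u, v). code2 u v) ` B)"
  have "finite C" using assms(4) by (simp add: C_def)
  then obtain L where L: "\<And>i. i \<in> C \<Longrightarrow> i \<le> L"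
    unfolding finite_nat_set_iff_bounded_le by blast
  \<comment> \<open>List index \<open>i\<close> is position \<open>Suc i\<close>. Position 1 lies in
    \<open>C\<close>, so the marker is \<open>a\<close>; positions beyond \<open>L\<close> do not
    exist and are not in \<open>C\<close>.\<close>
  let ?e = "map (\<lambda>i. if Suc i \<in> C then a else b) [0..<L]"
  have at_C: "at ?e i a \<longleftrightarrow> i \<in> C" if "1 \<le> i" for i
    using that L[of i] assms(3) by (auto simp: at_def split: if_splits)
  have 1: "1 \<in> C" by (simp add: C_def)
  have "at ?e 1 x \<longleftrightarrow> x = a" for x
    using at_C[of 1] 1 by (auto simp: at_def)
  then have "edge ?e u v \<longleftrightarrow> code2 u v \<in> C" for u v
    unfolding edge_def using at_C[of "code2 u v"] by (auto simp: code2_def)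
  moreover have "code2 u v \<in> C \<longleftrightarrow> (u, v) \<in> B" for u v
  proof -
    have "code2 u v \<noteq> 1" by (simp add: code2_def)
    then show ?thesis unfolding C_def by (auto simp: code2_inject)
  qed
  moreover have "?e \<in> lists U" using assms(1,2) by auto
  ultimately show ?thesis by blast
qed

text \<open>The bound \<open>u < v\<close> makes the recursion terminate for every \<open>e\<close>,
  so any two sequences and a number form a code; edges that do not lead upwards are ignored. Index 0
  always denotes the empty set, as positions in \<open>s\<close> start at 1.\<close>

fun val :: "'a list \<Rightarrow> 'a list \<Rightarrow> nat \<Rightarrow> 'a hf" where
  "val s e v = (if 1 \<le> v \<and> v \<le> length s then Ur (s ! (v - 1))
     else HSet (fset_of_list (map (val s e) (filter (\<lambda>u. edge e u v) [0..<v]))))"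

declare val.simps [simp del]

lemma is_Ur_val [simp]: "is_Ur (val s e v) \<longleftrightarrow> 1 \<le> v \<and> v \<le> length s"
  by (simp add: val.simps[of s e v])

lemma val_eq_Ur: "val s e v = Ur a \<longleftrightarrow> at s v a"
  by (auto simp: val.simps[of s e v] at_def)

lemma els_val: "\<not> (1 \<le> v \<and> v \<le> length s) \<Longrightarrow> els (val s e v) = val s e ` {u. u < v \<and> edge e u v}"
  by (subst val.simps) (auto simp: fset_of_list.rep_eq)

lemma val_HF: "s \<in> lists U \<Longrightarrow> val s e v \<in> HF U"
proof (induction v rule: less_induct)
  case (less v)
  then show ?case
    by (subst val.simps) (auto simp: fset_of_list.rep_eq)
qed

text \<open>The premise \<open>z \<in> HF U\<close> is kept inside the conclusion, so that
  structural induction on \<open>z\<close> applies directly.\<close>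

lemma finite_transitive_closure:
  "\<exists>Z. finite Z \<and> z \<in> Z \<and> (\<forall>y\<in>Z. els y \<subseteq> Z) \<and> (z \<in> HF U \<longrightarrow> Z \<subseteq> HF U)"
proof (induction z)
  case (Ur a)
  show ?case by (intro exI[of _ "{Ur a}"]) auto
next
  case (HSet X)
  then obtain Z where Z: "\<And>z. z \<in> fset X \<Longrightarrow> finite (Z z) \<and> z \<in> Z z \<and>
      (\<forall>y\<in>Z z. els y \<subseteq> Z z) \<and> (z \<in> HF U \<longrightarrow> Z z \<subseteq> HF U)"
    by metis
  show ?case
  proof (intro exI[of _ "insert (HSet X) (\<Union>z\<in>fset X. Z z)"] conjI)
    show "HSet X \<in> HF U \<longrightarrow> insert (HSet X) (\<Union>z\<in>fset X. Z z) \<subseteq> HF U"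
      using Z by auto
    show "\<forall>y\<in>insert (HSet X) (\<Union>z\<in>fset X. Z z). els y \<subseteq> insert (HSet X) (\<Union>z\<in>fset X. Z z)"
      using Z by fastforce
  qed (use Z in auto)
qed

text \<open>A finite transitive set containing \<open>z\<close> is listed with its urelements first
  and its other members sorted by \<open>rank\<close>. Members then precede the sets that contain
  them, and \<open>e\<close> codes membership between the places of this list.\<close>

lemma val_ex:
  assumes "a \<in> U" "b \<in> U" "a \<noteq> b" "z \<in> HF U"
  shows "\<exists>s\<in>lists U. \<exists>e\<in>lists U. \<exists>v. val s e v = z"
proof -
  obtain Z where Z: "finite Z" "z \<in> Z" "\<And>y. y \<in> Z \<Longrightarrow> els y \<subseteq> Z" "Z \<subseteq> HF U"
    using finite_transitive_closure[of z U] assms(4) by metis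
  obtain s where s: "set s = {a. Ur a \<in> Z}"
    using finite_list[of "{a. Ur a \<in> Z}"] finite_vimageI[OF Z(1), of Ur]
    by (auto simp: inj_def vimage_def)
  obtain L where L: "set L = {y \<in> Z. \<not> is_Ur y}"
    using finite_list[of "{y \<in> Z. \<not> is_Ur y}"] Z(1) by auto
  define ys where "ys = sort_key rank L"
  define zs where "zs = map Ur s @ ys"
  have set_ys: "set ys = {y \<in> Z. \<not> is_Ur y}" by (simp add: ys_def L)
  have set_zs: "set zs = Z" using s set_ys by (auto simp: zs_def is_Ur_iff)
  have before: "i < j" if "i < length ys" "j < length ys" "rank (ys ! i) < rank (ys ! j)" for i j
  proof (rule ccontr)
    assume "\<not> i < j"
    moreover have "sorted (map rank ys)" by (simp add: ys_def)
    ultimately have "rank (ys ! j) \<le> rank (ys ! i)"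
      using that by (metis length_map not_less nth_map sorted_nth_mono)
    then show False using that by simp
  qed
  \<comment> \<open>Indices count from 1, so that those up to \<open>length s\<close> are exactly
    the places of the urelements in \<open>zs\<close>.\<close>
  define B where "B = {(u, v). 1 \<le> u \<and> u < v \<and> v \<le> length zs \<and> zs ! (u - 1) \<in> els (zs ! (v - 1))}"
  have "B \<subseteq> {..length zs} \<times> {..length zs}" by (auto simp: B_def)
  then have "finite B" by (rule finite_subset) simp
  then obtain e where e: "e \<in> lists U" "\<And>u v. edge e u v \<longleftrightarrow> (u, v) \<in> B"
    using edge_ex[OF assms(1-3)] by meson
  have val: "val s e v = zs ! (v - 1)" if "1 \<le> v" "v \<le> length zs" for v
    using that
  proof (induction v rule: less_induct)
    case (less v)
    show ?case
    proof (cases "v \<le> length s")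
      case True
      then show ?thesis using less.prems by (subst val.simps) (auto simp: zs_def nth_append)
    next
      case False
      let ?y = "zs ! (v - 1)"
      let ?j = "v - 1 - length s"
      have j: "?j < length ys" "?y = ys ! ?j" "v = length s + ?j + 1"
        using False less.prems by (auto simp: zs_def nth_append)
      then have y: "\<not> is_Ur ?y" "?y \<in> Z" using set_ys nth_mem[OF j(1)] by auto
      have "els (val s e v) = els ?y"
      proof (intro equalityI subsetI)
        fix x assume "x \<in> els (val s e v)"
        then obtain u where "u < v" "(u, v) \<in> B" "x = val s e u"
          using els_val[of v s e] False e(2) by auto
        then show "x \<in> els ?y" using less by (auto simp: B_def)
      next
        fix x assume x: "x \<in> els ?y"
        then have "x \<in> Z" using Z(3)[OF y(2)] by blast
        \<comment> \<open>An urelement stands in the first part of \<open>zs\<close>; a set in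
          \<open>?y\<close> has smaller rank and hence an earlier place in
          \<open>ys\<close>.\<close>
        have "\<exists>u. 1 \<le> u \<and> u < v \<and> zs ! (u - 1) = x"
        proof (cases "is_Ur x")
          case True
          then obtain a where "a \<in> set s" "x = Ur a" using \<open>x \<in> Z\<close> s by (auto simp: is_Ur_iff)
          then obtain i where "i < length s" "x = Ur (s ! i)" by (auto simp: in_set_conv_nth)
          then show ?thesis using j(3) by (intro exI[of _ "Suc i"]) (auto simp: zs_def nth_append)
        next
          case notUr: False
          then have "x \<in> set ys" using \<open>x \<in> Z\<close> set_ys by blast
          then obtain i where i: "i < length ys" "x = ys ! i" by (auto simp: in_set_conv_nth)
          then have "i < ?j" using before[of i ?j] rank_els[OF x] j by simp
          then show ?thesis using i j(3)
            by (intro exI[of _ "length s + i + 1"]) (auto simp: zs_def nth_append)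
        qed
        then obtain u where u: "1 \<le> u" "u < v" "zs ! (u - 1) = x" by blast
        then have "edge e u v" using less.prems x by (simp add: e(2) B_def)
        moreover have "val s e u = x" using less.IH[of u] u less.prems by simp
        ultimately show "x \<in> els (val s e v)" using els_val[of v s e] False u by auto
      qed
      then show ?thesis using y(1) False by (intro hf_ext) auto
    qed
  qed
  obtain i where "i < length zs" "z = zs ! i" using Z(2) set_zs by (metis in_set_conv_nth)
  then have "val s e (Suc i) = z" using val[of "Suc i"] by simp
  moreover have "s \<in> lists U" using s Z(4) by auto
  ultimately show ?thesis using e(1) by blast
qed

section \<open>Sequences and numbers in hereditarily finite sets\<close>

definition atU :: "'a list \<Rightarrow> nat \<Rightarrow> 'a hf \<Rightarrow> bool" where
  "atU s i z \<longleftrightarrow> (\<exists>a. z = Ur a \<and> at s i a)"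

text \<open>The argument \<open>i\<close> appears in \<open>f\<close> as any set with
  \<open>i\<close> members, so several pairs may describe the same argument and
  \<open>graph_at f\<close> is in general only a relation.\<close>

definition graph_at :: "'a hf \<Rightarrow> nat \<Rightarrow> 'a hf \<Rightarrow> bool" where
  "graph_at f i z \<longleftrightarrow> (\<exists>X. pair X z \<in> els f \<and> card (els X) = i)"

definition slot :: "'a hf \<Rightarrow> nat \<Rightarrow> 'a hf \<Rightarrow> bool" where
  "slot y i z \<longleftrightarrow> is_Ur z \<and> graph_at y i z"

text \<open>Members of \<open>y\<close> other than pairs with an urelement as second component are
  ignored, and positions have many representatives; a sequence thus has many codes.\<close>

definition codes_seq :: "'a hf \<Rightarrow> 'a list \<Rightarrow> bool" where
  "codes_seq y s \<longleftrightarrow> (\<forall>i z. slot y i z \<longleftrightarrow> atU s i z)"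

definition dec :: "'a hf \<Rightarrow> 'a list" where
  "dec y = (if \<exists>s. codes_seq y s then THE s. codes_seq y s else [])"

lemma atU_inject: "(\<And>i z. atU s i z \<longleftrightarrow> atU s' i z) \<Longrightarrow> s = s'"
  by (rule at_inject) (auto simp: atU_def fun_eq_iff)

lemma dec_eq: "codes_seq y s \<Longrightarrow> dec y = s"
proof -
  assume s: "codes_seq y s"
  have "s' = s" if "codes_seq y s'" for s'
    by (rule atU_inject) (use s that in \<open>auto simp: codes_seq_def\<close>)
  then have "(THE s. codes_seq y s) = s" using s by blast
  then show ?thesis using s by (auto simp: dec_def)
qed

lemma graph_at_iff:
  assumes "f \<in> HF U"
  shows "graph_at f i z \<longleftrightarrow> (\<exists>X\<in>HF U. pair X z \<in> els f \<and> card (els X) = i)"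
  unfolding graph_at_def using els_HF[OF assms, of "pair _ z"] by auto

lemma graph_at_HF: "f \<in> HF U \<Longrightarrow> graph_at f i z \<Longrightarrow> z \<in> HF U"
  unfolding graph_at_def using els_HF[of f U "pair _ z"] by auto

lemma slot_HF: "y \<in> HF U \<Longrightarrow> slot y i z \<Longrightarrow> z \<in> HF U"
  unfolding slot_def using graph_at_HF by blast

lemma graph_at_ex:
  assumes "\<And>i. i \<in> I \<Longrightarrow> g i \<in> HF U" "finite I"
  shows "\<exists>f\<in>HF U. \<forall>i z. graph_at f i z \<longleftrightarrow> i \<in> I \<and> z = g i"
proof -
  obtain N where N: "\<And>i. N i \<in> HF U \<and> card (els (N i)) = i"
    using HF_card_ex[of U] by metis
  let ?F = "(\<lambda>i. pair (N i) (g i)) ` I"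
  have fin: "finite ?F" using assms(2) by simp
  have "hset ?F \<in> HF U" using assms N by (intro hset_HF) auto
  moreover have "graph_at (hset ?F) i z \<longleftrightarrow> i \<in> I \<and> z = g i" for i z
    unfolding graph_at_def els_hset[OF fin] using N by auto
  ultimately show ?thesis by blast
qed

lemma atU_HF: "s \<in> lists U \<Longrightarrow> atU s i z \<Longrightarrow> z \<in> HF U"
  by (auto simp: atU_def at_def in_lists_conv_set)

lemma ex_atU: "(\<exists>z. atU s i z) \<longleftrightarrow> 1 \<le> i \<and> i \<le> length s"
  by (auto simp: atU_def at_def)

text \<open>Quantifying over sequences is not yet possible inside the structure of sets. The right
  side avoids it: slots are single-valued and occupied exactly on an initial segment.\<close>

lemma codes_seq_ex_iff:
  assumes y: "y \<in> HF U"
  shows "(\<exists>s. codes_seq y s) \<longleftrightarrow>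
    (\<forall>i. \<forall>z\<in>HF U. \<forall>z'\<in>HF U. slot y i z \<and> slot y i z' \<longrightarrow> z = z') \<and>
    (\<exists>n. \<forall>i. (\<exists>z\<in>HF U. slot y i z) \<longleftrightarrow> 1 \<le> i \<and> i \<le> n)" (is "?L \<longleftrightarrow> ?R")
proof
  assume ?L
  then obtain s where s: "\<And>i z. slot y i z \<longleftrightarrow> atU s i z" by (auto simp: codes_seq_def)
  have "\<exists>z\<in>HF U. slot y i z" if "1 \<le> i \<and> i \<le> length s" for i
    using ex_atU[of s i] s slot_HF[OF y] that by metis
  then have "(\<exists>z\<in>HF U. slot y i z) \<longleftrightarrow> 1 \<le> i \<and> i \<le> length s" for i
    using ex_atU[of s i] s by metis
  then show ?R by (auto simp: s atU_def at_def)
next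
  assume ?R
  then obtain n where
    fn': "\<forall>i. \<forall>z\<in>HF U. \<forall>z'\<in>HF U. slot y i z \<and> slot y i z' \<longrightarrow> z = z'" and
    n': "\<forall>i. (\<exists>z\<in>HF U. slot y i z) \<longleftrightarrow> 1 \<le> i \<and> i \<le> n"
    by (elim exE conjE)
  have fn: "z = z'" if "slot y i z" "slot y i z'" for i z z'
    using fn' slot_HF[OF y] that by blast
  have n: "(\<exists>z. slot y i z) \<longleftrightarrow> 1 \<le> i \<and> i \<le> n" for i
    using n' slot_HF[OF y] by blast
  \<comment> \<open>\<open>g\<close> is indexed from 0 like a list, whereas slots count from
    1.\<close>
  define g where "g i = (SOME a. slot y (Suc i) (Ur a))" for i
  have "\<exists>a. slot y (Suc i) (Ur a)" if "i < n" for i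
    using n[of "Suc i"] that by (auto simp: slot_def is_Ur_iff)
  then have g: "slot y (Suc i) (Ur (g i))" if "i < n" for i
    using that unfolding g_def by (metis someI_ex)
  have "slot y i z \<longleftrightarrow> atU (map g [0..<n]) i z" for i z
  proof
    assume *: "slot y i z"
    then have "1 \<le> i" "i \<le> n" using n by blast+
    then show "atU (map g [0..<n]) i z"
      using fn[OF *] g[of "i - 1"] by (auto simp: atU_def at_def)
  next
    assume "atU (map g [0..<n]) i z"
    then have "1 \<le> i" "i \<le> n" "z = Ur (g (i - 1))" by (auto simp: atU_def at_def)
    then show "slot y i z" using g[of "i - 1"] by simp
  qed
  then show ?L unfolding codes_seq_def by blast
qed

text \<open>The default \<open>[]\<close> has no positions, so both sides fail when no sequence is
  coded. The entries of \<open>dec y\<close> thereby become definable before there is a sort of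
  sequences.\<close>

lemma atU_dec: "atU (dec y) i z \<longleftrightarrow> (\<exists>s. codes_seq y s) \<and> slot y i z"
proof (cases "\<exists>s. codes_seq y s")
  case True
  then show ?thesis using dec_eq by (auto simp: codes_seq_def)
next
  case False
  then show ?thesis by (simp add: dec_def atU_def at_def)
qed

lemma dec_lists: "y \<in> HF U \<Longrightarrow> dec y \<in> lists U"
proof -
  assume y: "y \<in> HF U"
  have "x \<in> U" if "x \<in> set (dec y)" for x
  proof -
    obtain i where "i < length (dec y)" "x = dec y ! i" using \<open>x \<in> set (dec y)\<close>
      by (auto simp: in_set_conv_nth)
    then have "atU (dec y) (Suc i) (Ur x)" by (simp add: atU_def at_def)
    then have "Ur x \<in> HF U" using slot_HF[OF y] atU_dec by metis
    then show ?thesis by simp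
  qed
  then show ?thesis by (simp add: in_lists_conv_set)
qed

lemma dec_ex: assumes "s \<in> lists U" shows "\<exists>y\<in>HF U. dec y = s"
proof -
  have "Ur (s ! (i - 1)) \<in> HF U" if "i \<in> {1..length s}" for i
    using that assms by (auto simp: in_lists_conv_set)
  then obtain y where "y \<in> HF U"
    "\<forall>i z. graph_at y i z \<longleftrightarrow> i \<in> {1..length s} \<and> z = Ur (s ! (i - 1))"
    using graph_at_ex[of "{1..length s}" "\<lambda>i. Ur (s ! (i - 1))" U] by auto
  then have "codes_seq y s" by (auto simp: codes_seq_def slot_def atU_def at_def)
  then show ?thesis using dec_eq \<open>y \<in> HF U\<close> by blast
qed

lemma eq_length_iff:
  assumes "s \<in> lists U"
  shows "n = length s \<longleftrightarrow> (\<forall>i. (\<exists>z\<in>HF U. atU s i z) \<longleftrightarrow> 1 \<le> i \<and> i \<le> n)"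
proof -
  have *: "(\<exists>z\<in>HF U. atU s i z) \<longleftrightarrow> 1 \<le> i \<and> i \<le> length s" for i
    using ex_atU[of s i] atU_HF[OF assms] by blast
  have "n = m" if "\<forall>i. (1 \<le> i \<and> i \<le> m) \<longleftrightarrow> (1 \<le> i \<and> i \<le> n)" for m n :: nat
    using that[rule_format, of m] that[rule_format, of n] by (cases m; cases n) auto
  then show ?thesis unfolding * by blast
qed

lemma append_iff:
  "w = s @ u \<longleftrightarrow> (\<forall>i z. atU w i z \<longleftrightarrow> atU s i z \<or> (\<exists>j. i = length s + j \<and> atU u j z))"
proof -
  have "atU (s @ u) i z \<longleftrightarrow> atU s i z \<or> (\<exists>j. i = length s + j \<and> atU u j z)" for i z
  proof (cases "i \<le> length s")
    case True
    then show ?thesis by (auto simp: atU_def at_def nth_append)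
  next
    case False
    then obtain j where "i = length s + Suc j"
      by (metis add_Suc_right less_iff_Suc_add not_le)
    then show ?thesis by (auto simp: atU_def at_def nth_append)
  qed
  then show ?thesis using atU_inject by metis
qed

lemma edge_iff: "e \<in> lists U \<Longrightarrow> edge e u v \<longleftrightarrow> (\<exists>z\<in>HF U. atU e 1 z \<and> atU e (code2 u v) z)"
  unfolding edge_def by (auto simp: atU_def) (auto simp: at_def in_lists_conv_set)

text \<open>\<open>R\<close> is a partial graph of \<open>val s e\<close> closed under the recursive calls.\<close>

definition local_val :: "'a list \<Rightarrow> 'a list \<Rightarrow> (nat \<Rightarrow> 'a hf \<Rightarrow> bool) \<Rightarrow> nat \<Rightarrow> 'a hf \<Rightarrow> bool" where
  "local_val s e R i w \<longleftrightarrow>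
     atU s i w \<or>
     \<not> (1 \<le> i \<and> i \<le> length s) \<and> \<not> is_Ur w \<and>
       (\<forall>w'\<in>els w. \<exists>u. u < i \<and> edge e u i \<and> R u w') \<and>
       (\<forall>u. u < i \<and> edge e u i \<longrightarrow> (\<exists>w'\<in>els w. R u w'))"

lemma local_val_val:
  assumes "\<And>u. u < i \<Longrightarrow> R u (val s e u)"
  shows "local_val s e R i (val s e i)"
proof (cases "1 \<le> i \<and> i \<le> length s")
  case True
  then show ?thesis using is_Ur_val[of s e i] val_eq_Ur[of s e i]
    unfolding local_val_def atU_def is_Ur_iff by blast
next
  case False
  then show ?thesis unfolding local_val_def els_val[OF False] using assms by auto
qed

lemma local_val_unique:
  assumes R: "\<And>i w. R i w \<Longrightarrow> local_val s e R i w" and "R i w"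
  shows "w = val s e i"
  using assms(2)
proof (induction i arbitrary: w rule: less_induct)
  case (less i)
  from R[OF less.prems] consider "atU s i w"
    | "\<not> (1 \<le> i \<and> i \<le> length s)" "\<not> is_Ur w"
      "\<forall>w'\<in>els w. \<exists>u. u < i \<and> edge e u i \<and> R u w'"
      "\<forall>u. u < i \<and> edge e u i \<longrightarrow> (\<exists>w'\<in>els w. R u w')"
    unfolding local_val_def by blast
  then show ?case
  proof cases
    case 1
    then show ?thesis using val_eq_Ur unfolding atU_def by metis
  next
    case 2
    have "els w = els (val s e i)"
      unfolding els_val[OF 2(1)] using 2(3,4) less.IH by blast
    then show ?thesis using 2(1,2) by (intro hf_ext) auto
  qed
qed

text \<open>The values at the indices up to \<open>v\<close> form a finite set that satisfies the
  local condition; conversely \<open>local_val_unique\<close> forces every entry of such a set to be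
  the right value.\<close>

lemma eq_val_iff:
  assumes s: "s \<in> lists U"
  shows "z = val s e v \<longleftrightarrow>
    (\<exists>f\<in>HF U. graph_at f v z \<and>
      (\<forall>i. \<forall>w\<in>HF U. graph_at f i w \<longrightarrow> local_val s e (graph_at f) i w))"
    (is "_ \<longleftrightarrow> ?R")
proof
  assume z: "z = val s e v"
  obtain f where f: "f \<in> HF U" "\<forall>i w. graph_at f i w \<longleftrightarrow> i \<in> {..v} \<and> w = val s e i"
    using graph_at_ex[of "{..v}" "val s e" U] val_HF[OF s] by blast
  then have "local_val s e (graph_at f) i w" if "graph_at f i w" for i w
    using that local_val_val[of i "graph_at f" s e] by simp
  then show ?R using f z by (intro bexI[of _ f]) auto
next
  assume ?R
  then obtain f where f: "f \<in> HF U" "graph_at f v z"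
    "\<forall>i. \<forall>w\<in>HF U. graph_at f i w \<longrightarrow> local_val s e (graph_at f) i w"
    by blast
  then show "z = val s e v"
    using local_val_unique[of "graph_at f" s e v z] graph_at_HF[OF f(1)] by blast
qed

fun mk :: "'a hf \<Rightarrow> 'a hf \<Rightarrow> 'a sn" where
  "mk (Ur a) y = Elem a"
| "mk (HSet X) y = (if X = {||} then Num (card (els y)) else Seq (dec y))"

lemma mk_Elem: "mk x y = Elem a \<longleftrightarrow> x = Ur a"
  by (cases x) auto

lemma mk_Num: "mk x y = Num n \<longleftrightarrow> \<not> is_Ur x \<and> els x = {} \<and> n = card (els y)"
  by (cases x) (auto simp: fset_inject[symmetric])

lemma mk_Seq: "mk x y = Seq s \<longleftrightarrow> \<not> is_Ur x \<and> els x \<noteq> {} \<and> s = dec y"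
  by (cases x) (auto simp: fset_inject[symmetric])

text \<open>Together with \<open>seqof\<close>, the default values let any three objects serve as a
  code of a hereditarily finite set.\<close>

primrec numof :: "'a sn \<Rightarrow> nat" where
  "numof (Elem a) = 0" | "numof (Seq s) = 0" | "numof (Num n) = n"

primrec seqof :: "'a sn \<Rightarrow> 'a list" where
  "seqof (Elem a) = []" | "seqof (Seq s) = s" | "seqof (Num n) = []"

lemma univ_HF: "univ (HF_structure A) = HF (univ A)"
  by (simp add: HF_structure_def)

lemma univ_SN: "univ (SN_structure A) = Elem ` univ A \<union> Seq ` lists (univ A) \<union> range Num"
  by (simp add: SN_structure_def)

text \<open>An environment has one block length, so all sorts over the sets share dimension 2. Only
  \<open>h_sn\<close> needs both components; the other sorts read the first.\<close>

definition h_obj :: "'a hf list \<Rightarrow> 'a hf" where "h_obj x = x ! 0"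
definition h_nat :: "'a hf list \<Rightarrow> nat" where "h_nat x = card (els (h_obj x))"
definition h_seq :: "'a hf list \<Rightarrow> 'a list" where "h_seq x = dec (h_obj x)"
definition h_sn :: "'a hf list \<Rightarrow> 'a sn" where "h_sn x = mk (h_obj x) (x ! 1)"

section \<open>Definable sorts over the hereditarily finite sets\<close>

locale hf_sn_pair =
  fixes A :: "('r, 'a) rel_structure"
begin

abbreviation "H \<equiv> HF_structure A"
abbreviation "U \<equiv> univ A"

lemma h_obj_range: "h_obj ` tuples (univ H) 2 = HF U"
proof (intro equalityI subsetI)
  fix z assume "z \<in> HF U"
  then show "z \<in> h_obj ` tuples (univ H) 2"
    by (intro image_eqI[of _ _ "[z, z]"]) (auto simp: h_obj_def tuples_def univ_HF)
qed (auto simp: h_obj_def tuples_def univ_HF)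

sublocale hobj: hf_sort H 2 h_obj U
proof
  show "dfn H 2 2 (\<lambda>e. h_obj (e 0) = h_obj (e 1))"
    unfolding h_obj_def by (rule dfn_eq_nth) simp_all
  have "dfn H 2 2 (\<lambda>e. rel H HF_mem (map (\<lambda>(i, j). e i ! j) [(0, 0), (1, 0)]))"
    by (rule dfn_rel) (auto simp: HF_structure_def)
  then show "dfn H 2 2 (\<lambda>e. h_obj (e 0) \<in> els (h_obj (e 1)))"
  proof (rule dfn_cong)
    fix e show "rel H HF_mem (map (\<lambda>(i, j). e i ! j) [(0, 0), (1, 0)]) =
        (h_obj (e 0) \<in> els (h_obj (e 1)))"
      by (cases "e 1 ! 0") (auto simp: HF_structure_def h_obj_def)
  qed
  have "dfn H 2 1 (\<lambda>e. rel H HF_P (map (\<lambda>(i, j). e i ! j) [(0, 0)]))"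
    by (rule dfn_rel) (auto simp: HF_structure_def)
  then show "dfn H 2 1 (\<lambda>e. is_Ur (h_obj (e 0)))"
  proof (rule dfn_cong)
    fix e assume "env H 2 e"
    then have "h_obj (e 0) \<in> HF U" using h_obj_range unfolding env_def by blast
    then show "rel H HF_P (map (\<lambda>(i, j). e i ! j) [(0, 0)]) = is_Ur (h_obj (e 0))"
      by (cases "e 0 ! 0") (auto simp: HF_structure_def h_obj_def)
  qed
qed (rule h_obj_range)

lemma tm_second [dfn_intros]:
  assumes "i < n" shows "tm H 2 n h_obj (\<lambda>e. e i ! 1)"
  unfolding tm_def
proof (intro conjI allI impI)
  show "e i ! 1 \<in> h_obj ` tuples (univ H) 2" if "env H 2 e" for e
  proof -
    have "e i ! 1 \<in> HF U" using env_tuple[OF that, of i] by (auto simp: tuples_def univ_HF)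
    then show ?thesis unfolding h_obj_range .
  qed
  show "dfn H 2 (Suc n) (\<lambda>e. h_obj (e 0) = e (Suc i) ! 1)"
    unfolding h_obj_def using assms by (intro dfn_eq_nth) auto
qed

lemma second_HF: "env H 2 e \<Longrightarrow> e i ! 1 \<in> HF U"
  using env_tuple[of H 2 e i] by (auto simp: tuples_def univ_HF)

lemma h_nat_eq: "dfn H 2 2 (\<lambda>e. h_nat (e 0) = h_nat (e 1))"
  unfolding h_nat_def
  by (rule dfn_cong[OF _ card_eq_iff[symmetric, OF hobj.env_HF hobj.env_HF]])
    (intro dfn_intros; simp)

lemma dfn_card_eq:
  "tm H 2 n h_obj s \<Longrightarrow> tm H 2 n h_obj t \<Longrightarrow> dfn H 2 n (\<lambda>e. card (els (s e)) = card (els (t e)))"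
  by (rule dfn_subst2[where R = "\<lambda>x y. card (els x) = card (els y)", OF h_nat_eq[unfolded h_nat_def]])

sublocale hnat: nat_sort H 2 h_nat
proof
  have "\<exists>x\<in>h_obj ` tuples (univ H) 2. n = card (els x)" for n
    unfolding h_obj_range using HF_card_ex[of U n] by auto
  then show "h_nat ` tuples (univ H) 2 = UNIV"
    by (auto simp: h_nat_def)
  have "dfn H 2 1 (\<lambda>e. \<forall>w\<in>HF U. \<not> w \<in> els (h_obj (e 0)))"
    by (intro dfn_intros; simp)
  then show "dfn H 2 1 (\<lambda>e. h_nat (e 0) = 0)"
    by (rule dfn_cong)
      (use els_HF[OF hobj.env_HF] in \<open>auto simp: h_nat_def card_eq_0_iff finite_els\<close>)
  have "dfn H 2 1 (\<lambda>e. \<exists>u\<in>HF U. \<forall>w\<in>HF U. w \<in> els (h_obj (e 0)) \<longleftrightarrow> w = u)"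
    by (intro dfn_intros; simp)
  then show "dfn H 2 1 (\<lambda>e. h_nat (e 0) = 1)"
  proof (rule dfn_cong)
    fix e assume "env H 2 e"
    have *: "w \<in> HF U" if "w \<in> els (h_obj (e 0))" for w
      using els_HF[OF hobj.env_HF[OF \<open>env H 2 e\<close>] that] .
    have "(\<exists>u\<in>HF U. \<forall>w\<in>HF U. w \<in> els (h_obj (e 0)) \<longleftrightarrow> w = u) \<longleftrightarrow>
        (\<exists>u. els (h_obj (e 0)) = {u})" using * by blast
    then show "(\<exists>u\<in>HF U. \<forall>w\<in>HF U. w \<in> els (h_obj (e 0)) \<longleftrightarrow> w = u) \<longleftrightarrow> h_nat (e 0) = 1"
      by (simp add: h_nat_def card_1_singleton_iff)
  qed
  show "dfn H 2 3 (\<lambda>e. h_nat (e 0) = h_nat (e 1) + h_nat (e 2))"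
    unfolding h_nat_def
    by (rule dfn_cong[OF _ card_plus_iff[symmetric, OF hobj.env_HF hobj.env_HF hobj.env_HF]])
      (intro dfn_intros dfn_card_eq; simp)
  show "dfn H 2 3 (\<lambda>e. h_nat (e 0) = h_nat (e 1) * h_nat (e 2))"
    unfolding h_nat_def
    by (rule dfn_cong[OF _ card_times_iff[symmetric, OF hobj.env_HF hobj.env_HF]])
      (intro dfn_intros dfn_card_eq; simp)
qed (rule h_nat_eq)


lemma tm_card [dfn_intros]:
  assumes "tm H 2 n h_obj t" shows "tm H 2 n h_nat (\<lambda>e. card (els (t e)))"
proof (rule tm_subst1[OF _ _ hnat.eq assms])
  show "dfn H 2 2 (\<lambda>e. h_nat (e 0) = card (els (h_obj (e 1))))"
    using h_nat_eq unfolding h_nat_def .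
qed (simp add: hnat.range)

lemma h_seq_range: "h_seq ` tuples (univ H) 2 = lists U"
proof -
  have "h_seq ` tuples (univ H) 2 = dec ` h_obj ` tuples (univ H) 2"
    by (simp only: image_image h_seq_def[abs_def])
  also have "\<dots> = dec ` HF U" by (simp only: h_obj_range)
  also have "\<dots> = lists U"
  proof (intro equalityI subsetI)
    fix s assume "s \<in> lists U"
    from dec_ex[OF this] show "s \<in> dec ` HF U" by auto
  next
    fix s assume "s \<in> dec ` HF U"
    then obtain y where "y \<in> HF U" "s = dec y" by auto
    then show "s \<in> lists U" using dec_lists[of y U] by simp
  qed
  finally show ?thesis .
qed

lemma env_lists: "env H 2 e \<Longrightarrow> h_seq (e i) \<in> lists U"
  using h_seq_range unfolding env_def by blast

lemma dfn_graph_at [dfn_intros]: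
  assumes "tm H 2 n h_obj f" "tm H 2 n h_nat i" "tm H 2 n h_obj z"
  shows "dfn H 2 n (\<lambda>e. graph_at (f e) (i e) (z e))"
proof (rule dfn_subst3[where R = graph_at, OF _ assms])
  show "dfn H 2 3 (\<lambda>e. graph_at (h_obj (e 0)) (h_nat (e 1)) (h_obj (e 2)))"
    by (rule dfn_cong[OF _ graph_at_iff[symmetric, OF hobj.env_HF]]) (intro dfn_intros; simp)
qed

lemma dfn_slot [dfn_intros]:
  assumes "tm H 2 n h_obj y" "tm H 2 n h_nat i" "tm H 2 n h_obj z"
  shows "dfn H 2 n (\<lambda>e. slot (y e) (i e) (z e))"
  unfolding slot_def by (intro dfn_intros assms)

lemma dfn_codes_seq:
  assumes "tm H 2 n h_obj y" shows "dfn H 2 n (\<lambda>e. \<exists>s. codes_seq (y e) s)"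
proof (rule dfn_subst1[where R = "\<lambda>y. \<exists>s. codes_seq y s", OF _ assms])
  show "dfn H 2 1 (\<lambda>e. \<exists>s. codes_seq (h_obj (e 0)) s)"
    by (rule dfn_cong[OF _ codes_seq_ex_iff[symmetric, OF hobj.env_HF]]) (intro dfn_intros; simp)
qed

lemma atU_h_seq: "dfn H 2 3 (\<lambda>e. atU (h_seq (e 0)) (h_nat (e 1)) (h_obj (e 2)))"
  unfolding h_seq_def atU_dec by (intro dfn_intros dfn_codes_seq; simp)

lemmas dfn_atU [dfn_intros] = dfn_subst3[where R = atU, OF atU_h_seq]

text \<open>Variables of sort \<open>h_seq\<close> are terms only once this is known, so the
  instances of \<open>atU_h_seq\<close> come from \<open>dfn_rename\<close>. Under the two
  quantifiers \<open>z\<close> and \<open>i\<close> are variables 0 and 1, and the sequences have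
  moved to 2 and 3.\<close>

lemma h_seq_eq: "dfn H 2 2 (\<lambda>e. h_seq (e 0) = h_seq (e 1))"
proof (rule dfn_cong)
  have at: "dfn H 2 4 (\<lambda>e. atU (h_seq (e k)) (h_nat (e 1)) (h_obj (e 0)))" if "k < 4" for k
    using dfn_rename[OF atU_h_seq, of "\<lambda>i. if i = 0 then k else if i = 1 then 1 else 0" 4] that
    by simp
  have "dfn H 2 (Suc (Suc 2)) (\<lambda>e. atU (h_seq (e 2)) (h_nat (e 1)) (h_obj (e 0)) \<longleftrightarrow>
      atU (h_seq (e 3)) (h_nat (e 1)) (h_obj (e 0)))"
    using dfn_iff[OF at[of 2] at[of 3]] by simp
  then show "dfn H 2 2 (\<lambda>e. \<forall>i. \<forall>z\<in>HF U. atU (h_seq (e 0)) i z \<longleftrightarrow> atU (h_seq (e 1)) i z)"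
    by (intro hnat.dfn_all_nat dfn_all_sort[OF h_obj_range]) (simp add: numeral_2_eq_2 numeral_3_eq_3)
  fix e assume e: "env H 2 e"
  show "(\<forall>i. \<forall>z\<in>HF U. atU (h_seq (e 0)) i z \<longleftrightarrow> atU (h_seq (e 1)) i z) \<longleftrightarrow> h_seq (e 0) = h_seq (e 1)"
  proof
    assume *: "\<forall>i. \<forall>z\<in>HF U. atU (h_seq (e 0)) i z \<longleftrightarrow> atU (h_seq (e 1)) i z"
    show "h_seq (e 0) = h_seq (e 1)"
      by (rule atU_inject) (use * atU_HF[OF env_lists[OF e]] in blast)
  qed simp
qed

lemmas [dfn_intros] = tm_var[OF h_seq_eq] dfn_ex_sort[OF h_seq_range] dfn_all_sort[OF h_seq_range]
  dfn_subst2[where R = "\<lambda>x y. x = y", OF h_seq_eq]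

lemma tm_dec [dfn_intros]:
  assumes "tm H 2 n h_obj t" shows "tm H 2 n h_seq (\<lambda>e. dec (t e))"
proof (rule tm_subst1[OF _ _ h_seq_eq assms])
  show "dfn H 2 2 (\<lambda>e. h_seq (e 0) = dec (h_obj (e 1)))"
    using h_seq_eq unfolding h_seq_def .
qed (simp add: h_obj_range h_seq_range dec_lists)

lemma tm_length [dfn_intros]:
  assumes "tm H 2 n h_seq t" shows "tm H 2 n h_nat (\<lambda>e. length (t e))"
proof (rule tm_subst1[OF _ _ hnat.eq assms])
  show "dfn H 2 2 (\<lambda>e. h_nat (e 0) = length (h_seq (e 1)))"
    by (rule dfn_cong[OF _ eq_length_iff[symmetric, OF env_lists]]) (intro dfn_intros; simp)
qed (simp add: hnat.range)

lemma dfn_edge [dfn_intros]: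
  assumes "tm H 2 n h_seq e" "tm H 2 n h_nat u" "tm H 2 n h_nat v"
  shows "dfn H 2 n (\<lambda>x. edge (e x) (u x) (v x))"
proof (rule dfn_subst3[where R = edge, OF _ assms])
  show "dfn H 2 3 (\<lambda>e. edge (h_seq (e 0)) (h_nat (e 1)) (h_nat (e 2)))"
    by (rule dfn_cong[OF _ edge_iff[symmetric, OF env_lists]])
      (unfold code2_def, intro dfn_intros; simp)
qed

lemma h_obj_eq_val:
  "dfn H 2 4 (\<lambda>e. h_obj (e 0) = val (h_seq (e 1)) (h_seq (e 2)) (h_nat (e 3)))"
proof (rule dfn_cong)
  show "dfn H 2 4 (\<lambda>e. \<exists>f\<in>HF U. graph_at f (h_nat (e 3)) (h_obj (e 0)) \<and>
      (\<forall>i. \<forall>w\<in>HF U. graph_at f i w \<longrightarrow>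
        atU (h_seq (e 1)) i w \<or>
        \<not> (1 \<le> i \<and> i \<le> length (h_seq (e 1))) \<and> \<not> is_Ur w \<and>
        (\<forall>w'\<in>HF U. w' \<in> els w \<longrightarrow> (\<exists>u. u < i \<and> edge (h_seq (e 2)) u i \<and> graph_at f u w')) \<and>
        (\<forall>u. u < i \<and> edge (h_seq (e 2)) u i \<longrightarrow> (\<exists>w'\<in>HF U. w' \<in> els w \<and> graph_at f u w'))))"
    by (intro dfn_intros; simp)
  fix e assume e: "env H 2 e"
  \<comment> \<open>Bounded quantifiers over members are exchanged for quantifiers over the sort
    \<open>HF U\<close>.\<close>
  have *: "(\<forall>w'\<in>HF U. w' \<in> els w \<longrightarrow> P w') \<longleftrightarrow> (\<forall>w'\<in>els w. P w')"
    "(\<exists>w'\<in>HF U. w' \<in> els w \<and> P w') \<longleftrightarrow> (\<exists>w'\<in>els w. P w')" if "w \<in> HF U" for w P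
    using els_HF[OF that] by blast+
  show "(\<exists>f\<in>HF U. graph_at f (h_nat (e 3)) (h_obj (e 0)) \<and>
      (\<forall>i. \<forall>w\<in>HF U. graph_at f i w \<longrightarrow>
        atU (h_seq (e 1)) i w \<or>
        \<not> (1 \<le> i \<and> i \<le> length (h_seq (e 1))) \<and> \<not> is_Ur w \<and>
        (\<forall>w'\<in>HF U. w' \<in> els w \<longrightarrow> (\<exists>u. u < i \<and> edge (h_seq (e 2)) u i \<and> graph_at f u w')) \<and>
        (\<forall>u. u < i \<and> edge (h_seq (e 2)) u i \<longrightarrow> (\<exists>w'\<in>HF U. w' \<in> els w \<and> graph_at f u w')))) \<longleftrightarrow>
      h_obj (e 0) = val (h_seq (e 1)) (h_seq (e 2)) (h_nat (e 3))"
    unfolding eq_val_iff[OF env_lists[OF e]] local_val_def by (simp add: * cong: ball_cong)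
qed

text \<open>Elements get no sort of their own; they are handled through the urelements among the
  objects.\<close>

lemma h_sn_Elem: "dfn H 2 2 (\<lambda>e. \<exists>a. h_sn (e 0) = Elem a \<and> h_obj (e 1) = Ur a)"
proof (rule dfn_cong)
  show "dfn H 2 2 (\<lambda>e. is_Ur (h_obj (e 0)) \<and> h_obj (e 1) = h_obj (e 0))"
    by (intro dfn_intros; simp)
qed (auto simp: h_sn_def mk_Elem is_Ur_iff)

lemmas dfn_Elem [dfn_intros] =
  dfn_subst2[where R = "\<lambda>x z. \<exists>a. x = Elem a \<and> z = Ur a", OF h_sn_Elem]

lemma dfn_empty [dfn_intros]:
  assumes "tm H 2 n h_obj t" shows "dfn H 2 n (\<lambda>e. els (t e) = {})"
proof (rule dfn_subst1[where R = "\<lambda>x. els x = {}", OF _ assms])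
  have "dfn H 2 1 (\<lambda>e. \<forall>w\<in>HF U. \<not> w \<in> els (h_obj (e 0)))"
    by (intro dfn_intros; simp)
  then show "dfn H 2 1 (\<lambda>e. els (h_obj (e 0)) = {})"
    by (rule dfn_cong) (use els_HF[OF hobj.env_HF] in blast)
qed

lemma h_sn_Num: "dfn H 2 2 (\<lambda>e. h_sn (e 0) = Num (h_nat (e 1)))"
  unfolding h_sn_def mk_Num h_nat_def by (intro dfn_intros; simp)

lemma h_sn_Seq: "dfn H 2 2 (\<lambda>e. h_sn (e 0) = Seq (h_seq (e 1)))"
  unfolding h_sn_def mk_Seq by (intro dfn_intros; simp)

lemma h_sn_eq: "dfn H 2 2 (\<lambda>e. h_sn (e 0) = h_sn (e 1))"
proof (rule dfn_cong)
  have 1: "dfn H 2 (Suc 2) (\<lambda>e. (\<exists>a. h_sn (e 1) = Elem a \<and> h_obj (e 0) = Ur a) \<and>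
      (\<exists>a. h_sn (e 2) = Elem a \<and> h_obj (e 0) = Ur a))"
    using dfn_conj[OF dfn_rename[OF h_sn_Elem, of "\<lambda>i. if i = 0 then 1 else 0" 3]
        dfn_rename[OF h_sn_Elem, of "\<lambda>i. if i = 0 then 2 else 0" 3]] by simp
  have 2: "dfn H 2 (Suc 2) (\<lambda>e. h_sn (e 1) = Num (h_nat (e 0)) \<and> h_sn (e 2) = Num (h_nat (e 0)))"
    using dfn_conj[OF dfn_rename[OF h_sn_Num, of "\<lambda>i. if i = 0 then 1 else 0" 3]
        dfn_rename[OF h_sn_Num, of "\<lambda>i. if i = 0 then 2 else 0" 3]] by simp
  have 3: "dfn H 2 (Suc 2) (\<lambda>e. h_sn (e 1) = Seq (h_seq (e 0)) \<and> h_sn (e 2) = Seq (h_seq (e 0)))"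
    using dfn_conj[OF dfn_rename[OF h_sn_Seq, of "\<lambda>i. if i = 0 then 1 else 0" 3]
        dfn_rename[OF h_sn_Seq, of "\<lambda>i. if i = 0 then 2 else 0" 3]] by simp
  show "dfn H 2 2 (\<lambda>e.
      (\<exists>z\<in>HF U. (\<exists>a. h_sn (e 0) = Elem a \<and> z = Ur a) \<and> (\<exists>a. h_sn (e 1) = Elem a \<and> z = Ur a)) \<or>
      (\<exists>n. h_sn (e 0) = Num n \<and> h_sn (e 1) = Num n) \<or>
      (\<exists>s\<in>lists U. h_sn (e 0) = Seq s \<and> h_sn (e 1) = Seq s))"
    by (intro dfn_disj dfn_ex_sort[OF h_obj_range] dfn_ex_sort[OF h_seq_range] hnat.dfn_ex_nat)
      (use 1 2 3 in \<open>simp_all add: numeral_2_eq_2\<close>)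
  fix e assume e: "env H 2 e"
  have "h_sn (e 0) = Elem a \<Longrightarrow> Ur a \<in> HF U" "h_sn (e 0) = Seq s \<Longrightarrow> s \<in> lists U" for a s
    using hobj.env_HF[OF e, of 0] dec_lists[OF second_HF[OF e, of 0]]
    by (simp_all add: h_sn_def mk_Elem mk_Seq)
  then show "((\<exists>z\<in>HF U. (\<exists>a. h_sn (e 0) = Elem a \<and> z = Ur a) \<and> (\<exists>a. h_sn (e 1) = Elem a \<and> z = Ur a)) \<or>
      (\<exists>n. h_sn (e 0) = Num n \<and> h_sn (e 1) = Num n) \<or>
      (\<exists>s\<in>lists U. h_sn (e 0) = Seq s \<and> h_sn (e 1) = Seq s)) \<longleftrightarrow> h_sn (e 0) = h_sn (e 1)"
    by (cases "h_sn (e 0)") auto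
qed


lemma h_sn_range: "h_sn ` tuples (univ H) 2 = univ (SN_structure A)"
proof (intro equalityI subsetI)
  fix z assume "z \<in> h_sn ` tuples (univ H) 2"
  then obtain t where t: "length t = 2" "set t \<subseteq> HF U" "z = mk (t ! 0) (t ! 1)"
    by (auto simp: h_sn_def h_obj_def univ_HF tuples_def)
  then have "t ! 0 \<in> HF U" "t ! 1 \<in> HF U" by (auto simp: subset_iff)
  then obtain x y where xy: "x \<in> HF U" "y \<in> HF U" "z = mk x y" using t(3) by blast
  then show "z \<in> univ (SN_structure A)"
    using dec_lists[OF xy(2)] by (cases x) (auto simp: univ_SN)
next
  fix z assume z: "z \<in> univ (SN_structure A)"
  have "\<exists>x\<in>HF U. \<exists>y\<in>HF U. z = mk x y"
  proof (cases z)
    case (Elem a)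
    then show ?thesis using z by (intro bexI[of _ "Ur a"]) (auto simp: univ_SN)
  next
    case (Seq s)
    then have "s \<in> lists U" using z by (auto simp: univ_SN)
    from dec_ex[OF this] obtain y where "y \<in> HF U" "dec y = s" by auto
    \<comment> \<open>Any nonempty set in the first component marks a sequence; this one exists over
      every \<open>U\<close>.\<close>
    then show ?thesis using Seq by (intro bexI[of _ "HSet {|HSet {||}|}"] bexI[of _ y]) auto
  next
    case (Num n)
    obtain y where "y \<in> HF U" "card (els y) = n" using HF_card_ex[of U n] by auto
    then show ?thesis using Num by (intro bexI[of _ "HSet {||}"] bexI[of _ y]) auto
  qed
  then obtain x y where "x \<in> HF U" "y \<in> HF U" "z = mk x y" by blast
  then show "z \<in> h_sn ` tuples (univ H) 2"
    by (intro image_eqI[of _ _ "[x, y]"]) (auto simp: h_sn_def h_obj_def univ_HF tuples_def)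
qed

lemma env_SN: "env H 2 e \<Longrightarrow> h_sn (e i) \<in> univ (SN_structure A)"
  using h_sn_range unfolding env_def by blast

lemmas [dfn_intros] = tm_var[OF h_sn_eq] dfn_subst2[where R = "\<lambda>x y. x = y", OF h_sn_eq]

lemma tm_Num [dfn_intros]:
  assumes "tm H 2 n h_nat t" shows "tm H 2 n h_sn (\<lambda>e. Num (t e))"
  by (rule tm_subst1[OF h_sn_Num _ h_sn_eq assms]) (simp add: h_sn_range univ_SN)

lemma tm_Seq [dfn_intros]:
  assumes "tm H 2 n h_seq t" shows "tm H 2 n h_sn (\<lambda>e. Seq (t e))"
  by (rule tm_subst1[OF h_sn_Seq _ h_sn_eq assms]) (auto simp: h_sn_range univ_SN h_seq_range)

lemma tm_numof [dfn_intros]: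
  assumes "tm H 2 n h_sn t" shows "tm H 2 n h_nat (\<lambda>e. numof (t e))"
proof (rule tm_subst1[OF _ _ hnat.eq assms])
  show "dfn H 2 2 (\<lambda>e. h_nat (e 0) = numof (h_sn (e 1)))"
  proof (rule dfn_cong)
    show "dfn H 2 2 (\<lambda>e. h_sn (e 1) = Num (h_nat (e 0)) \<or>
        \<not> (\<exists>n. h_sn (e 1) = Num n) \<and> h_nat (e 0) = 0)"
      by (intro dfn_intros; simp)
    fix e
    show "(h_sn (e 1) = Num (h_nat (e 0)) \<or> \<not> (\<exists>n. h_sn (e 1) = Num n) \<and> h_nat (e 0) = 0) \<longleftrightarrow>
        h_nat (e 0) = numof (h_sn (e 1))"
      by (cases "h_sn (e 1)") auto
  qed
qed (simp add: hnat.range)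

lemma tm_seqof [dfn_intros]:
  assumes "tm H 2 n h_sn t" shows "tm H 2 n h_seq (\<lambda>e. seqof (t e))"
proof (rule tm_subst1[OF _ _ h_seq_eq assms])
  show "dfn H 2 2 (\<lambda>e. h_seq (e 0) = seqof (h_sn (e 1)))"
  proof (rule dfn_cong)
    \<comment> \<open>Length 0 expresses the default value \<open>[]\<close> by means of the
      available terms.\<close>
    show "dfn H 2 2 (\<lambda>e. h_sn (e 1) = Seq (h_seq (e 0)) \<or>
        \<not> (\<exists>s\<in>lists U. h_sn (e 1) = Seq s) \<and> length (h_seq (e 0)) = 0)"
      by (intro dfn_intros; simp)
    fix e assume e: "env H 2 e"
    show "(h_sn (e 1) = Seq (h_seq (e 0)) \<or>
        \<not> (\<exists>s\<in>lists U. h_sn (e 1) = Seq s) \<and> length (h_seq (e 0)) = 0) \<longleftrightarrow>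
        h_seq (e 0) = seqof (h_sn (e 1))"
      using env_SN[OF e, of 1] by (cases "h_sn (e 1)") (auto simp: univ_SN)
  qed
qed (auto simp: h_sn_range h_seq_range univ_SN)

lemma dfn_append:
  assumes "tm H 2 n h_seq w" "tm H 2 n h_seq s" "tm H 2 n h_seq u"
  shows "dfn H 2 n (\<lambda>e. w e = s e @ u e)"
proof (rule dfn_subst3[where R = "\<lambda>w s u. w = s @ u", OF _ assms])
  show "dfn H 2 3 (\<lambda>e. h_seq (e 0) = h_seq (e 1) @ h_seq (e 2))"
  proof (rule dfn_cong)
    show "dfn H 2 3 (\<lambda>e. \<forall>i. \<forall>z\<in>HF U. atU (h_seq (e 0)) i z \<longleftrightarrow> atU (h_seq (e 1)) i z \<or>
        (\<exists>j. i = length (h_seq (e 1)) + j \<and> atU (h_seq (e 2)) j z))"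
      by (intro dfn_intros; simp)
    fix e assume e: "env H 2 e"
    show "(\<forall>i. \<forall>z\<in>HF U. atU (h_seq (e 0)) i z \<longleftrightarrow> atU (h_seq (e 1)) i z \<or>
        (\<exists>j. i = length (h_seq (e 1)) + j \<and> atU (h_seq (e 2)) j z)) \<longleftrightarrow>
        h_seq (e 0) = h_seq (e 1) @ h_seq (e 2)"
      unfolding append_iff using atU_HF[OF env_lists[OF e]] by blast
  qed
qed

section \<open>Symbols of the three-sorted structure and the composite map over the sets\<close>

abbreviation "SN \<equiv> SN_structure A"

lemma upt_numeral: "[0..<2] = [0, 1]" "[0..<3] = [0, 1, 2]"
  by (simp_all add: upt_rec)

lemma SN_rel_definable:
  assumes "r \<in> syms SN"
  shows "dfn H 2 (arity SN r) (\<lambda>e. rel SN r (map (\<lambda>i. h_sn (e i)) [0..<arity SN r]))"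
proof -
  have rel: "rel SN = sn_rel A" and arity: "arity SN = sn_arity (arity A)"
    by (simp_all add: SN_structure_def)
  have Elem_HF: "Ur a \<in> HF U" if "env H 2 e" "h_sn (e i) = Elem a" for e i a
    using env_SN[OF that(1), of i] that(2) by (auto simp: univ_SN)
  have Seq_lists: "s \<in> lists U" if "env H 2 e" "h_sn (e i) = Seq s" for e i s
    using env_SN[OF that(1), of i] that(2) by (auto simp: univ_SN)
  show ?thesis
  proof (cases r)
    case (SN_base q)
    have q: "q \<in> syms A" using assms SN_base by (auto simp: SN_structure_def)
    \<comment> \<open>A code of an element has its urelement in component 0, so the base relation
      can be evaluated there directly.\<close>
    let ?ijs = "map (\<lambda>i. (i, 0)) [0..<arity A q]"
    have "dfn H 2 (arity A q) (\<lambda>e. rel H (HF_base q) (map (\<lambda>(i, j). e i ! j) ?ijs))"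
      by (rule dfn_rel) (use q in \<open>auto simp: HF_structure_def\<close>)
    then have "dfn H 2 (arity A q) (\<lambda>e. sn_rel A (SN_base q) (map (\<lambda>i. h_sn (e i)) [0..<arity A q]))"
    proof (rule dfn_cong)
      fix e :: "nat \<Rightarrow> 'a hf list"
      have "map (\<lambda>i. e i ! 0) [0..<arity A q] = map Ur as \<longleftrightarrow>
          map (\<lambda>i. h_sn (e i)) [0..<arity A q] = map Elem as" if "length as = arity A q" for as
        using that by (auto simp: list_eq_iff_nth_eq h_sn_def mk_Elem h_obj_def)
      then show "rel H (HF_base q) (map (\<lambda>(i, j). e i ! j) ?ijs) =
          sn_rel A (SN_base q) (map (\<lambda>i. h_sn (e i)) [0..<arity A q])"
        by (auto simp: HF_structure_def tuples_def comp_def)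
    qed
    then show ?thesis by (simp add: rel arity SN_base)
  next
    case SN_sortA
    have "dfn H 2 1 (\<lambda>e. \<exists>z\<in>HF U. \<exists>a. h_sn (e 0) = Elem a \<and> z = Ur a)"
      by (intro dfn_intros; simp)
    then show ?thesis unfolding SN_sortA rel arity
      by simp (erule dfn_cong, use Elem_HF in blast)
  next
    case SN_sortS
    have "dfn H 2 1 (\<lambda>e. \<exists>s\<in>lists U. h_sn (e 0) = Seq s)"
      by (intro dfn_intros; simp)
    then show ?thesis unfolding SN_sortS rel arity
      by simp (erule dfn_cong, use Seq_lists in blast)
  next
    case SN_sortN
    have "dfn H 2 1 (\<lambda>e. \<exists>n. h_sn (e 0) = Num n)"
      by (intro dfn_intros; simp)
    then show ?thesis unfolding SN_sortN rel arity by simp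
  next
    case SN_t
    have "dfn H 2 3 (\<lambda>e. \<exists>s\<in>lists U. \<exists>i. \<exists>z\<in>HF U. h_sn (e 0) = Seq s \<and> h_sn (e 1) = Num i \<and>
        (\<exists>a. h_sn (e 2) = Elem a \<and> z = Ur a) \<and> atU s i z)"
      by (intro dfn_intros; simp)
    then show ?thesis unfolding SN_t rel arity sn_arity.simps upt_numeral list.map
    proof (rule dfn_cong)
      fix e assume e: "env H 2 e"
      show "(\<exists>s\<in>lists U. \<exists>i. \<exists>z\<in>HF U. h_sn (e 0) = Seq s \<and> h_sn (e 1) = Num i \<and>
          (\<exists>a. h_sn (e 2) = Elem a \<and> z = Ur a) \<and> atU s i z) \<longleftrightarrow>
        sn_rel A SN_t [h_sn (e 0), h_sn (e 1), h_sn (e 2)]"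
        using Elem_HF[OF e] Seq_lists[OF e] by (auto simp: atU_def at_def)
    qed
  next
    case SN_length
    have "dfn H 2 2 (\<lambda>e. \<exists>s\<in>lists U. h_sn (e 0) = Seq s \<and> h_sn (e 1) = Num (length s))"
      by (intro dfn_intros; simp)
    then show ?thesis unfolding SN_length rel arity sn_arity.simps upt_numeral list.map
      by (rule dfn_cong) (use Seq_lists in auto)
  next
    case SN_append
    have "dfn H 2 3 (\<lambda>e. \<exists>s\<in>lists U. \<exists>u\<in>lists U. \<exists>w\<in>lists U.
        h_sn (e 0) = Seq s \<and> h_sn (e 1) = Seq u \<and> h_sn (e 2) = Seq w \<and> w = s @ u)"
      by (intro dfn_append dfn_intros; simp)
    then show ?thesis unfolding SN_append rel arity sn_arity.simps upt_numeral list.map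
    proof (rule dfn_cong)
      fix e assume e: "env H 2 e"
      show "(\<exists>s\<in>lists U. \<exists>u\<in>lists U. \<exists>w\<in>lists U.
          h_sn (e 0) = Seq s \<and> h_sn (e 1) = Seq u \<and> h_sn (e 2) = Seq w \<and> w = s @ u) \<longleftrightarrow>
        sn_rel A SN_append [h_sn (e 0), h_sn (e 1), h_sn (e 2)]"
        using Seq_lists[OF e] by auto
    qed
  next
    case SN_mem
    have "dfn H 2 2 (\<lambda>e. \<exists>s\<in>lists U. \<exists>i. \<exists>z\<in>HF U.
        (\<exists>a. h_sn (e 0) = Elem a \<and> z = Ur a) \<and> h_sn (e 1) = Seq s \<and> atU s i z)"
      by (intro dfn_intros; simp)
    then show ?thesis unfolding SN_mem rel arity sn_arity.simps upt_numeral list.map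
    proof (rule dfn_cong)
      fix e assume e: "env H 2 e"
      have "a \<in> set s \<longleftrightarrow> (\<exists>i. at s i a)" for a :: 'a and s
      proof
        assume "a \<in> set s"
        then obtain i where "i < length s" "s ! i = a" by (auto simp: in_set_conv_nth)
        then have "at s (Suc i) a" by (simp add: at_def)
        then show "\<exists>i. at s i a" ..
      qed (auto simp: at_def)
      then show "(\<exists>s\<in>lists U. \<exists>i. \<exists>z\<in>HF U.
          (\<exists>a. h_sn (e 0) = Elem a \<and> z = Ur a) \<and> h_sn (e 1) = Seq s \<and> atU s i z) \<longleftrightarrow>
        sn_rel A SN_mem [h_sn (e 0), h_sn (e 1)]"
        using Elem_HF[OF e] Seq_lists[OF e] by (auto simp: atU_def)
    qed
  next
    case SN_plus
    have "dfn H 2 3 (\<lambda>e. \<exists>m. \<exists>n. h_sn (e 0) = Num m \<and> h_sn (e 1) = Num n \<and> h_sn (e 2) = Num (m + n))"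
      by (intro dfn_intros; simp)
    then show ?thesis unfolding SN_plus rel arity sn_arity.simps upt_numeral list.map
      by (rule dfn_cong) auto
  next
    case SN_times
    have "dfn H 2 3 (\<lambda>e. \<exists>m. \<exists>n. h_sn (e 0) = Num m \<and> h_sn (e 1) = Num n \<and> h_sn (e 2) = Num (m * n))"
      by (intro dfn_intros; simp)
    then show ?thesis unfolding SN_times rel arity sn_arity.simps upt_numeral list.map
      by (rule dfn_cong) auto
  next
    case SN_zero
    have "dfn H 2 1 (\<lambda>e. h_sn (e 0) = Num 0)"
      by (intro dfn_intros; simp)
    then show ?thesis unfolding SN_zero rel arity by simp
  next
    case SN_one
    have "dfn H 2 1 (\<lambda>e. h_sn (e 0) = Num 1)"
      by (intro dfn_intros; simp)
    then show ?thesis unfolding SN_one rel arity by simp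
  qed
qed


definition s_hf :: "'a sn list \<Rightarrow> 'a hf" where
  "s_hf x = val (seqof (x ! 0)) (seqof (x ! 1)) (numof (x ! 2))"

text \<open>Three pairs of sets decode to two sequences and a number, so the composite is
  \<open>val\<close> applied to terms and \<open>h_obj_eq_val\<close> suffices.\<close>

lemma composite_HF_definable:
  "dfn H 2 (Suc 3) (\<lambda>e. e 3 ! 0 = s_hf (map h_sn (map e [0..<3])))"
proof -
  have "dfn H 2 4 (\<lambda>e. h_obj (e 3) =
      val (seqof (h_sn (e 0))) (seqof (h_sn (e 1))) (numof (h_sn (e 2))))"
    by (rule dfn_subst4[where R = "\<lambda>z s t v. z = val s t v", OF h_obj_eq_val];
        intro dfn_intros; simp)
  then show ?thesis by (simp add: s_hf_def upt_numeral h_obj_def)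
qed

end

section \<open>Hereditarily finite sets in sequences and numbers\<close>

definition atE :: "'a list \<Rightarrow> nat \<Rightarrow> 'a sn \<Rightarrow> bool" where
  "atE s i z \<longleftrightarrow> (\<exists>a. z = Elem a \<and> at s i a)"

definition slotE :: "'a hf \<Rightarrow> nat \<Rightarrow> 'a sn \<Rightarrow> bool" where
  "slotE y i w \<longleftrightarrow> (\<exists>a. w = Elem a \<and> slot y i (Ur a))"

text \<open>The bisimulation condition at one pair of indices. It looks only at smaller neighbours,
  the ones that \<open>val\<close> follows.\<close>

definition local_bisim :: "'a list \<Rightarrow> 'a list \<Rightarrow> 'a list \<Rightarrow> 'a list \<Rightarrow> (nat \<Rightarrow> nat \<Rightarrow> bool) \<Rightarrow>
    nat \<Rightarrow> nat \<Rightarrow> bool" where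
  "local_bisim s e s' e' R u u' \<longleftrightarrow>
     (\<exists>a. at s u a \<and> at s' u' a) \<or>
     \<not> (1 \<le> u \<and> u \<le> length s) \<and> \<not> (1 \<le> u' \<and> u' \<le> length s') \<and>
       (\<forall>w. w < u \<and> edge e w u \<longrightarrow> (\<exists>w'. w' < u' \<and> edge e' w' u' \<and> R w w')) \<and>
       (\<forall>w'. w' < u' \<and> edge e' w' u' \<longrightarrow> (\<exists>w. w < u \<and> edge e w u \<and> R w w'))"

text \<open>Codes are well-founded by the order of numbers, so induction on \<open>u\<close> shows
  that bisimilar indices have equal values.\<close>

lemma local_bisim_sound:
  assumes R: "\<And>u u'. R u u' \<Longrightarrow> local_bisim s e s' e' R u u'" and "R u u'"
  shows "val s e u = val s' e' u'"
  using assms(2)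
proof (induction u arbitrary: u' rule: less_induct)
  case (less u)
  from R[OF less.prems] consider a where "at s u a" "at s' u' a"
    | "\<not> (1 \<le> u \<and> u \<le> length s)" "\<not> (1 \<le> u' \<and> u' \<le> length s')"
      "\<forall>w. w < u \<and> edge e w u \<longrightarrow> (\<exists>w'. w' < u' \<and> edge e' w' u' \<and> R w w')"
      "\<forall>w'. w' < u' \<and> edge e' w' u' \<longrightarrow> (\<exists>w. w < u \<and> edge e w u \<and> R w w')"
    unfolding local_bisim_def by blast
  then show ?case
  proof cases
    case 1
    then show ?thesis by (metis val_eq_Ur)
  next
    case 2
    have "els (val s e u) = els (val s' e' u')"
      unfolding els_val[OF 2(1)] els_val[OF 2(2)]
    proof (intro equalityI subsetI)
      fix x assume "x \<in> val s e ` {w. w < u \<and> edge e w u}"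
      then obtain w where w: "w < u" "edge e w u" "x = val s e w" by blast
      then obtain w' where "w' < u'" "edge e' w' u'" "R w w'" using 2(3) by blast
      then show "x \<in> val s' e' ` {w. w < u' \<and> edge e' w u'}" using less.IH[OF w(1)] w(3) by blast
    next
      fix x assume "x \<in> val s' e' ` {w. w < u' \<and> edge e' w u'}"
      then obtain w' where w': "w' < u'" "edge e' w' u'" "x = val s' e' w'" by blast
      then obtain w where "w < u" "edge e w u" "R w w'" using 2(4) by blast
      then show "x \<in> val s e ` {w. w < u \<and> edge e w u}" using less.IH[of w w'] w'(3) by force
    qed
    then show ?thesis using 2(1,2) by (intro hf_ext) auto
  qed
qed

text \<open>\<open>R\<close> need only contain pairs below \<open>u\<close> and \<open>u'\<close>,
  which permits cutting equality of values down to a finite relation.\<close>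

lemma local_bisim_val_eq:
  assumes "val s e u = val s' e' u'"
    and R: "\<And>w w'. w < u \<Longrightarrow> w' < u' \<Longrightarrow> val s e w = val s' e' w' \<Longrightarrow> R w w'"
  shows "local_bisim s e s' e' R u u'"
proof (cases "1 \<le> u \<and> u \<le> length s")
  case True
  then obtain a where "val s e u = Ur a" using is_Ur_val[of s e u] unfolding is_Ur_iff by blast
  then have "at s u a" "at s' u' a" using assms(1) val_eq_Ur by metis+
  then show ?thesis unfolding local_bisim_def by blast
next
  case False
  then have False': "\<not> (1 \<le> u' \<and> u' \<le> length s')"
    using is_Ur_val[of s e u] is_Ur_val[of s' e' u'] assms(1) by simp
  have eq: "val s e ` {w. w < u \<and> edge e w u} = val s' e' ` {w. w < u' \<and> edge e' w u'}"
    using assms(1) els_val[OF False] els_val[OF False'] by metis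
  have "\<exists>w'. w' < u' \<and> edge e' w' u' \<and> R w w'" if w: "w < u" "edge e w u" for w
  proof -
    have "val s e w \<in> val s' e' ` {w. w < u' \<and> edge e' w u'}" using w unfolding eq[symmetric] by blast
    then show ?thesis using R w by blast
  qed
  moreover have "\<exists>w. w < u \<and> edge e w u \<and> R w w'" if w: "w' < u'" "edge e' w' u'" for w'
  proof -
    have "val s' e' w' \<in> val s e ` {w. w < u \<and> edge e w u}" using w unfolding eq by blast
    then show ?thesis using R w by force
  qed
  ultimately show ?thesis unfolding local_bisim_def using False False' by blast
qed

lemma val_eq_iff:
  assumes "a \<in> U" "b \<in> U" "a \<noteq> b"
  shows "val s e v = val s' e' v' \<longleftrightarrow>
    (\<exists>B\<in>lists U. edge B v v' \<and> (\<forall>u u'. edge B u u' \<longrightarrow> local_bisim s e s' e' (edge B) u u'))"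
    (is "_ \<longleftrightarrow> ?R")
proof
  assume eq: "val s e v = val s' e' v'"
  \<comment> \<open>Equality of values, restricted to indices up to \<open>v\<close> and
    \<open>v'\<close>, is finite and can be coded by one sequence.\<close>
  let ?B = "{(u, u'). u \<le> v \<and> u' \<le> v' \<and> val s e u = val s' e' u'}"
  have "?B \<subseteq> {..v} \<times> {..v'}" by auto
  then have "finite ?B" by (rule finite_subset) simp
  from edge_ex[OF assms this] obtain B where B: "B \<in> lists U" "\<forall>u u'. edge B u u' \<longleftrightarrow> (u, u') \<in> ?B"
    by blast
  have "local_bisim s e s' e' (edge B) u u'" if "edge B u u'" for u u'
    by (rule local_bisim_val_eq) (use that B(2) in auto)
  then show ?R using B eq by (intro bexI[of _ B]) auto
next
  assume ?R
  then obtain B where "B \<in> lists U" "edge B v v'"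
    "\<forall>u u'. edge B u u' \<longrightarrow> local_bisim s e s' e' (edge B) u u'"
    by blast
  then show "val s e v = val s' e' v'" using local_bisim_sound[of "edge B"] by blast
qed

text \<open>A bijection from the numbers below \<open>n\<close> onto the members of \<open>x\<close>
  cannot be coded as such, since members are not numbers. They are named by indices \<open>u\<close>
  into a common code \<open>s\<close>, \<open>e\<close>, and then \<open>B\<close> is a relation
  between numbers.\<close>

lemma card_els_eq_iff:
  assumes ab: "a \<in> U" "b \<in> U" "a \<noteq> b" and x: "x \<in> HF U"
  shows "card (els x) = n \<longleftrightarrow>
    (\<exists>s\<in>lists U. \<exists>e\<in>lists U. \<exists>B\<in>lists U.
      (\<forall>i. i < n \<longrightarrow> (\<exists>y\<in>HF U. y \<in> els x \<and> (\<exists>u. edge B i u \<and> y = val s e u))) \<and>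
      (\<forall>y\<in>HF U. y \<in> els x \<longrightarrow> (\<exists>i. i < n \<and> (\<exists>u. edge B i u \<and> y = val s e u))) \<and>
      (\<forall>i. \<forall>i'. \<forall>y\<in>HF U. \<forall>y'\<in>HF U.
        i < n \<and> i' < n \<and> (\<exists>u. edge B i u \<and> y = val s e u) \<and> (\<exists>u. edge B i' u \<and> y' = val s e u) \<longrightarrow>
        (y = y' \<longleftrightarrow> i = i')))"
    (is "_ \<longleftrightarrow> ?R")
proof
  assume "card (els x) = n"
  then obtain g where g: "bij_betw g {..<n} (els x)"
    using ex_bij_betw_nat_finite[OF finite_els[of x]] by (auto simp: lessThan_atLeast0)
  then have g_in: "g i \<in> els x" if "i < n" for i using that by (auto simp: bij_betw_def)
  have g_onto: "\<exists>i<n. y = g i" if "y \<in> els x" for y using g that by (auto simp: bij_betw_def)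
  have g_inj: "g i = g i' \<longleftrightarrow> i = i'" if "i < n" "i' < n" for i i'
    using g that by (auto simp: bij_betw_def inj_on_def)
  from val_ex[OF ab x] obtain s e v where sev: "s \<in> lists U" "e \<in> lists U" "val s e v = x"
    by blast
  \<comment> \<open>The code of \<open>x\<close> itself names all its members, by indices below
    \<open>v\<close>.\<close>
  let ?B = "{(i, u). i < n \<and> u < v \<and> val s e u = g i}"
  have "?B \<subseteq> {..<n} \<times> {..<v}" by auto
  then have "finite ?B" by (rule finite_subset) simp
  from edge_ex[OF ab this] obtain B where B: "B \<in> lists U" "\<forall>u u'. edge B u u' \<longleftrightarrow> (u, u') \<in> ?B"
    by blast
  have P: "(\<exists>u. edge B i u \<and> y = val s e u) \<longleftrightarrow> y = g i" if "i < n" for i y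
  proof -
    have "g i \<in> els (val s e v)" using g_in[OF that] sev(3) by simp
    moreover from this have "\<not> (1 \<le> v \<and> v \<le> length s)"
      using is_Ur_val[of s e v] by (auto simp: is_Ur_iff)
    ultimately have "\<exists>u<v. val s e u = g i" using els_val[of v s e] by auto
    then show ?thesis using B(2) that by auto
  qed
  show ?R
  proof (rule bexI[OF _ sev(1)], rule bexI[OF _ sev(2)], rule bexI[OF _ B(1)],
      intro conjI allI ballI impI)
    fix i assume "i < n"
    then show "\<exists>y\<in>HF U. y \<in> els x \<and> (\<exists>u. edge B i u \<and> y = val s e u)"
      using P g_in els_HF[OF x] by (intro bexI[of _ "g i"]) auto
  next
    fix y assume "y \<in> els x"
    then show "\<exists>i. i < n \<and> (\<exists>u. edge B i u \<and> y = val s e u)" using g_onto P by metis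
  next
    fix i i' y y'
    assume "i < n \<and> i' < n \<and> (\<exists>u. edge B i u \<and> y = val s e u) \<and> (\<exists>u. edge B i' u \<and> y' = val s e u)"
    then have "i < n" "i' < n" "y = g i" "y' = g i'" using P by metis+
    then show "y = y' \<longleftrightarrow> i = i'" using g_inj by simp
  qed
next
  assume ?R
  then obtain s e B where "s \<in> lists U" "e \<in> lists U" "B \<in> lists U" and
    1: "\<forall>i. i < n \<longrightarrow> (\<exists>y\<in>HF U. y \<in> els x \<and> (\<exists>u. edge B i u \<and> y = val s e u))" and
    2: "\<forall>y\<in>HF U. y \<in> els x \<longrightarrow> (\<exists>i. i < n \<and> (\<exists>u. edge B i u \<and> y = val s e u))" and
    3: "\<forall>i. \<forall>i'. \<forall>y\<in>HF U. \<forall>y'\<in>HF U.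
        i < n \<and> i' < n \<and> (\<exists>u. edge B i u \<and> y = val s e u) \<and> (\<exists>u. edge B i' u \<and> y' = val s e u) \<longrightarrow>
        (y = y' \<longleftrightarrow> i = i')"
    by (elim bexE conjE)
  define P where "P i y \<longleftrightarrow> (\<exists>u. edge B i u \<and> y = val s e u)" for i y
  obtain g where g: "\<And>i. i < n \<Longrightarrow> g i \<in> els x \<and> P i (g i)"
    using 1 unfolding P_def[symmetric] by metis
  have inj: "y = y' \<longleftrightarrow> i = i'" if "i < n" "i' < n" "y \<in> els x" "y' \<in> els x" "P i y" "P i' y'" for i i' y y'
    using 3 that els_HF[OF x] unfolding P_def[symmetric] by blast
  have "bij_betw g {..<n} (els x)"
  proof (rule bij_betwI')
    show "g i = g i' \<longleftrightarrow> i = i'" if "i \<in> {..<n}" "i' \<in> {..<n}" for i i'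
      using inj[of i i' "g i" "g i'"] g that by blast
    show "\<exists>i\<in>{..<n}. y = g i" if y: "y \<in> els x" for y
    proof -
      obtain i where i: "i < n" "P i y" using 2 y els_HF[OF x y] unfolding P_def[symmetric] by blast
      then have "y = g i" using inj[of i i y "g i"] g[OF i(1)] y by blast
      then show ?thesis using i(1) by blast
    qed
  qed (use g in blast)
  then show "card (els x) = n" using bij_betw_same_card by fastforce
qed

lemma at_in: "at s i a \<Longrightarrow> s \<in> lists U \<Longrightarrow> a \<in> U"
  by (auto simp: at_def in_lists_conv_set)

lemma codes_seq_iff:
  assumes "y \<in> HF (univ A)" "s \<in> lists (univ A)"
  shows "codes_seq y s \<longleftrightarrow> (\<forall>i. \<forall>w\<in>univ (SN_structure A). slotE y i w \<longleftrightarrow> atE s i w)"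
proof -
  have "codes_seq y s \<longleftrightarrow> (\<forall>i a. slot y i (Ur a) \<longleftrightarrow> at s i a)"
    by (auto simp: codes_seq_def atU_def slot_def is_Ur_iff)
  also have "\<dots> \<longleftrightarrow> (\<forall>i. \<forall>a\<in>univ A. slot y i (Ur a) \<longleftrightarrow> at s i a)"
  proof -
    have "a \<in> univ A" if "slot y i (Ur a)" for i a
      using slot_HF[OF assms(1) that] by simp
    then show ?thesis using at_in[OF _ assms(2)] by blast
  qed
  also have "\<dots> \<longleftrightarrow> (\<forall>i. \<forall>w\<in>univ (SN_structure A). slotE y i w \<longleftrightarrow> atE s i w)"
    by (auto simp: slotE_def atE_def univ_SN)
  finally show ?thesis .
qed

lemma dec_eq_iff:
  "s = dec y \<longleftrightarrow> codes_seq y s \<or> \<not> (\<exists>s'. codes_seq y s') \<and> length s = 0"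
proof (cases "\<exists>s'. codes_seq y s'")
  case True
  then show ?thesis using dec_eq by metis
next
  case False
  then show ?thesis by (simp add: dec_def)
qed

lemma codes_seq_lists: "y \<in> HF U \<Longrightarrow> codes_seq y s \<Longrightarrow> s \<in> lists U"
  using dec_lists dec_eq by metis

section \<open>Definable sorts over sequences and numbers\<close>

definition s_obj :: "'a sn list \<Rightarrow> 'a sn" where "s_obj x = x ! 0"
definition s_nat :: "'a sn list \<Rightarrow> nat" where "s_nat x = numof (s_obj x)"
definition s_seq :: "'a sn list \<Rightarrow> 'a list" where "s_seq x = seqof (s_obj x)"

text \<open>As definable operations on objects, \<open>to_Num\<close> and \<open>to_Seq\<close>
  reduce equality of decoded values to equality of objects and let the relation symbols be applied
  to arbitrary objects.\<close>

definition to_Num :: "'a sn \<Rightarrow> 'a sn" where "to_Num z = Num (numof z)"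
definition to_Seq :: "'a sn \<Rightarrow> 'a sn" where "to_Seq z = Seq (seqof z)"

text \<open>\<open>a\<close> and \<open>b\<close> only guarantee that coding sequences exist. No
  formula mentions them, so the interpretation remains parameter-free.\<close>

locale two_elements = hf_sn_pair A for A :: "('r, 'a) rel_structure" +
  fixes a b :: 'a
  assumes ab: "a \<in> univ A" "b \<in> univ A" "a \<noteq> b"
begin

lemma tm_coord [dfn_intros]:
  assumes "i < n" "j < 3"
  shows "tm SN 3 n s_obj (\<lambda>e. e i ! j)"
  unfolding tm_def
proof (intro conjI allI impI)
  show "e i ! j \<in> s_obj ` tuples (univ SN) 3" if "env SN 3 e" for e
  proof -
    have "e i ! j \<in> univ SN" using env_tuple[OF that, of i] assms(2) by (auto simp: tuples_def)
    then show ?thesis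
      by (intro image_eqI[of _ _ "[e i ! j, e i ! j, e i ! j]"]) (auto simp: s_obj_def tuples_def)
  qed
  show "dfn SN 3 (Suc n) (\<lambda>e. s_obj (e 0) = e (Suc i) ! j)"
    unfolding s_obj_def using assms by (intro dfn_eq_nth) auto
qed

lemma s_obj_range: "s_obj ` tuples (univ SN) 3 = univ SN"
proof (intro equalityI subsetI)
  fix z assume "z \<in> univ SN"
  then show "z \<in> s_obj ` tuples (univ SN) 3"
    by (intro image_eqI[of _ _ "[z, z, z]"]) (auto simp: s_obj_def tuples_def)
qed (auto simp: s_obj_def tuples_def)

lemma s_obj_eq: "dfn SN 3 2 (\<lambda>e. s_obj (e 0) = s_obj (e 1))"
  unfolding s_obj_def by (rule dfn_eq_nth) simp_all

lemmas [dfn_intros] = tm_var[OF s_obj_eq] dfn_ex_sort[OF s_obj_range] dfn_all_sort[OF s_obj_range]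
  dfn_subst2[where R = "\<lambda>x y. x = y", OF s_obj_eq]

lemma SN_rel: "rel SN = sn_rel A" and SN_arity: "arity SN = sn_arity (arity A)"
  by (simp_all add: SN_structure_def)

lemma dfn_rel1:
  assumes "r \<in> syms SN" "sn_arity (arity A) r = 1" "tm SN 3 n s_obj t"
  shows "dfn SN 3 n (\<lambda>e. sn_rel A r [t e])"
proof (rule dfn_subst1[OF _ assms(3)])
  have "dfn SN 3 1 (\<lambda>e. rel SN r (map (\<lambda>(i, j). e i ! j) [(0, 0)]))"
    by (rule dfn_rel) (use assms in \<open>auto simp: SN_arity\<close>)
  then show "dfn SN 3 1 (\<lambda>e. sn_rel A r [s_obj (e 0)])" by (simp add: SN_rel s_obj_def)
qed

lemma dfn_rel2:
  assumes "r \<in> syms SN" "sn_arity (arity A) r = 2" "tm SN 3 n s_obj t" "tm SN 3 n s_obj u"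
  shows "dfn SN 3 n (\<lambda>e. sn_rel A r [t e, u e])"
proof (rule dfn_subst2[where R = "\<lambda>x y. sn_rel A r [x, y]", OF _ assms(3,4)])
  have "dfn SN 3 2 (\<lambda>e. rel SN r (map (\<lambda>(i, j). e i ! j) [(0, 0), (1, 0)]))"
    by (rule dfn_rel) (use assms in \<open>auto simp: SN_arity\<close>)
  then show "dfn SN 3 2 (\<lambda>e. sn_rel A r [s_obj (e 0), s_obj (e 1)])" by (simp add: SN_rel s_obj_def)
qed

lemma dfn_rel3:
  assumes "r \<in> syms SN" "sn_arity (arity A) r = 3"
    "tm SN 3 n s_obj t" "tm SN 3 n s_obj u" "tm SN 3 n s_obj v"
  shows "dfn SN 3 n (\<lambda>e. sn_rel A r [t e, u e, v e])"
proof (rule dfn_subst3[where R = "\<lambda>x y z. sn_rel A r [x, y, z]", OF _ assms(3-5)])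
  have "dfn SN 3 3 (\<lambda>e. rel SN r (map (\<lambda>(i, j). e i ! j) [(0, 0), (1, 0), (2, 0)]))"
    by (rule dfn_rel) (use assms in \<open>auto simp: SN_arity\<close>)
  then show "dfn SN 3 3 (\<lambda>e. sn_rel A r [s_obj (e 0), s_obj (e 1), s_obj (e 2)])"
    by (simp add: SN_rel s_obj_def)
qed

lemma SN_syms: "{SN_sortA, SN_sortS, SN_sortN, SN_t, SN_length, SN_append, SN_mem,
          SN_plus, SN_times, SN_zero, SN_one} \<subseteq> syms SN"
  by (auto simp: SN_structure_def)

lemma tm_to_Num:
  assumes "tm SN 3 n s_obj t" shows "tm SN 3 n s_obj (\<lambda>e. to_Num (t e))"
proof (rule tm_subst1[OF _ _ s_obj_eq assms])
  have "dfn SN 3 2 (\<lambda>e. (sn_rel A SN_sortN [s_obj (e 1)] \<and> s_obj (e 0) = s_obj (e 1)) \<or>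
      (\<not> sn_rel A SN_sortN [s_obj (e 1)] \<and> sn_rel A SN_zero [s_obj (e 0)]))"
    by (intro dfn_intros dfn_rel1) (use SN_syms in simp_all)
  then show "dfn SN 3 2 (\<lambda>e. s_obj (e 0) = to_Num (s_obj (e 1)))"
  proof (rule dfn_cong)
    fix e
    show "(sn_rel A SN_sortN [s_obj (e 1)] \<and> s_obj (e 0) = s_obj (e 1)) \<or>
      (\<not> sn_rel A SN_sortN [s_obj (e 1)] \<and> sn_rel A SN_zero [s_obj (e 0)]) \<longleftrightarrow>
      s_obj (e 0) = to_Num (s_obj (e 1))"
      by (cases "s_obj (e 1)") (auto simp: to_Num_def)
  qed
qed (unfold s_obj_range, auto simp: to_Num_def univ_SN)

lemma tm_to_Seq:
  assumes "tm SN 3 n s_obj t" shows "tm SN 3 n s_obj (\<lambda>e. to_Seq (t e))"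
proof (rule tm_subst1[OF _ _ s_obj_eq assms])
  \<comment> \<open>The empty sequence is the only \<open>s\<close> with
    \<open>s = s @ s\<close>.\<close>
  have "dfn SN 3 2 (\<lambda>e. (sn_rel A SN_sortS [s_obj (e 1)] \<and> s_obj (e 0) = s_obj (e 1)) \<or>
      (\<not> sn_rel A SN_sortS [s_obj (e 1)] \<and> sn_rel A SN_append [s_obj (e 0), s_obj (e 0), s_obj (e 0)]))"
    by (intro dfn_intros dfn_rel1 dfn_rel3) (use SN_syms in simp_all)
  then show "dfn SN 3 2 (\<lambda>e. s_obj (e 0) = to_Seq (s_obj (e 1)))"
  proof (rule dfn_cong)
    fix e
    show "(sn_rel A SN_sortS [s_obj (e 1)] \<and> s_obj (e 0) = s_obj (e 1)) \<or>
      (\<not> sn_rel A SN_sortS [s_obj (e 1)] \<and> sn_rel A SN_append [s_obj (e 0), s_obj (e 0), s_obj (e 0)]) \<longleftrightarrow>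
      s_obj (e 0) = to_Seq (s_obj (e 1))"
      by (cases "s_obj (e 1)") (auto simp: to_Seq_def)
  qed
qed (unfold s_obj_range, auto simp: to_Seq_def univ_SN)

lemma s_nat_eq: "dfn SN 3 2 (\<lambda>e. s_nat (e 0) = s_nat (e 1))"
proof -
  have "dfn SN 3 2 (\<lambda>e. to_Num (s_obj (e 0)) = to_Num (s_obj (e 1)))"
    by (intro dfn_intros tm_to_Num) simp_all
  then show ?thesis by (simp add: to_Num_def s_nat_def)
qed

lemma s_seq_eq: "dfn SN 3 2 (\<lambda>e. s_seq (e 0) = s_seq (e 1))"
proof -
  have "dfn SN 3 2 (\<lambda>e. to_Seq (s_obj (e 0)) = to_Seq (s_obj (e 1)))"
    by (intro dfn_intros tm_to_Seq) simp_all
  then show ?thesis by (simp add: to_Seq_def s_seq_def)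
qed

sublocale snat: nat_sort SN 3 s_nat
proof
  have "n \<in> s_nat ` tuples (univ SN) 3" for n
    by (intro image_eqI[of _ _ "[Num n, Num n, Num n]"])
      (auto simp: s_nat_def s_obj_def tuples_def univ_SN)
  then show "s_nat ` tuples (univ SN) 3 = UNIV" by blast
  have "dfn SN 3 1 (\<lambda>e. sn_rel A SN_zero [to_Num (s_obj (e 0))])"
    by (intro dfn_rel1 dfn_intros tm_to_Num) (use SN_syms in simp_all)
  then show "dfn SN 3 1 (\<lambda>e. s_nat (e 0) = 0)" by (simp add: to_Num_def s_nat_def)
  have "dfn SN 3 1 (\<lambda>e. sn_rel A SN_one [to_Num (s_obj (e 0))])"
    by (intro dfn_rel1 dfn_intros tm_to_Num) (use SN_syms in simp_all)
  then show "dfn SN 3 1 (\<lambda>e. s_nat (e 0) = 1)" by (simp add: to_Num_def s_nat_def)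
  have "dfn SN 3 3 (\<lambda>e. sn_rel A SN_plus [to_Num (s_obj (e 1)), to_Num (s_obj (e 2)), to_Num (s_obj (e 0))])"
    by (intro dfn_rel3 dfn_intros tm_to_Num) (use SN_syms in simp_all)
  then show "dfn SN 3 3 (\<lambda>e. s_nat (e 0) = s_nat (e 1) + s_nat (e 2))"
    by (simp add: to_Num_def s_nat_def)
  have "dfn SN 3 3 (\<lambda>e. sn_rel A SN_times [to_Num (s_obj (e 1)), to_Num (s_obj (e 2)), to_Num (s_obj (e 0))])"
    by (intro dfn_rel3 dfn_intros tm_to_Num) (use SN_syms in simp_all)
  then show "dfn SN 3 3 (\<lambda>e. s_nat (e 0) = s_nat (e 1) * s_nat (e 2))"
    by (simp add: to_Num_def s_nat_def)
qed (rule s_nat_eq)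

lemma s_seq_range: "s_seq ` tuples (univ SN) 3 = lists U"
proof (intro equalityI subsetI)
  fix s assume "s \<in> lists U"
  then show "s \<in> s_seq ` tuples (univ SN) 3"
    by (intro image_eqI[of _ _ "[Seq s, Seq s, Seq s]"])
      (auto simp: s_seq_def s_obj_def tuples_def univ_SN)
next
  fix s assume "s \<in> s_seq ` tuples (univ SN) 3"
  then obtain z where "z \<in> s_obj ` tuples (univ SN) 3" "s = seqof z"
    by (auto simp: s_seq_def)
  then show "s \<in> lists U" unfolding s_obj_range by (auto simp: univ_SN)
qed

lemma env_seq: "env SN 3 e \<Longrightarrow> s_seq (e i) \<in> lists U"
  using s_seq_range unfolding env_def by blast

lemmas [dfn_intros] = tm_var[OF s_seq_eq] dfn_ex_sort[OF s_seq_range] dfn_all_sort[OF s_seq_range]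

lemma tm_SN_Num [dfn_intros]:
  assumes "tm SN 3 n s_nat t" shows "tm SN 3 n s_obj (\<lambda>e. Num (t e))"
proof (rule tm_subst1[OF _ _ s_obj_eq assms])
  have "dfn SN 3 2 (\<lambda>e. s_obj (e 0) = to_Num (s_obj (e 1)))"
    by (intro dfn_intros tm_to_Num) simp_all
  then show "dfn SN 3 2 (\<lambda>e. s_obj (e 0) = Num (s_nat (e 1)))"
    by (simp add: to_Num_def s_nat_def)
qed (unfold s_obj_range, simp add: univ_SN)

lemma tm_SN_Seq [dfn_intros]:
  assumes "tm SN 3 n s_seq t" shows "tm SN 3 n s_obj (\<lambda>e. Seq (t e))"
proof (rule tm_subst1[OF _ _ s_obj_eq assms])
  have "dfn SN 3 2 (\<lambda>e. s_obj (e 0) = to_Seq (s_obj (e 1)))"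
    by (intro dfn_intros tm_to_Seq) simp_all
  then show "dfn SN 3 2 (\<lambda>e. s_obj (e 0) = Seq (s_seq (e 1)))"
    by (simp add: to_Seq_def s_seq_def)
qed (unfold s_seq_range s_obj_range, auto simp: univ_SN)

lemma tm_SN_numof [dfn_intros]:
  assumes "tm SN 3 n s_obj t" shows "tm SN 3 n s_nat (\<lambda>e. numof (t e))"
proof (rule tm_subst1[OF _ _ s_nat_eq assms])
  show "dfn SN 3 2 (\<lambda>e. s_nat (e 0) = numof (s_obj (e 1)))"
    using s_nat_eq unfolding s_nat_def .
qed (simp add: snat.range)

lemma tm_SN_seqof [dfn_intros]:
  assumes "tm SN 3 n s_obj t" shows "tm SN 3 n s_seq (\<lambda>e. seqof (t e))"
proof (rule tm_subst1[OF _ _ s_seq_eq assms])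
  show "dfn SN 3 2 (\<lambda>e. s_seq (e 0) = seqof (s_obj (e 1)))"
    using s_seq_eq unfolding s_seq_def .
qed (unfold s_seq_range s_obj_range, auto simp: univ_SN)

lemma tm_SN_length [dfn_intros]:
  assumes "tm SN 3 n s_seq t" shows "tm SN 3 n s_nat (\<lambda>e. length (t e))"
proof (rule tm_subst1[OF _ _ s_nat_eq assms])
  have "dfn SN 3 2 (\<lambda>e. sn_rel A SN_length [Seq (s_seq (e 1)), Num (s_nat (e 0))])"
    by (intro dfn_rel2 dfn_intros) (use SN_syms in simp_all)
  then show "dfn SN 3 2 (\<lambda>e. s_nat (e 0) = length (s_seq (e 1)))" by simp
qed (simp add: snat.range)

lemma dfn_atE [dfn_intros]:
  assumes "tm SN 3 n s_seq s" "tm SN 3 n s_nat i" "tm SN 3 n s_obj z"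
  shows "dfn SN 3 n (\<lambda>e. atE (s e) (i e) (z e))"
proof -
  have "dfn SN 3 n (\<lambda>e. sn_rel A SN_t [Seq (s e), Num (i e), z e])"
    by (intro dfn_rel3 tm_SN_Num tm_SN_Seq assms) (use SN_syms in simp_all)
  then show ?thesis by (rule dfn_cong) (auto simp: atE_def at_def)
qed

lemma SN_edge_iff:
  assumes "e \<in> lists U"
  shows "edge e u v \<longleftrightarrow> (\<exists>z\<in>univ SN. atE e 1 z \<and> atE e (code2 u v) z)"
  using at_in[OF _ assms] unfolding edge_def atE_def univ_SN by blast

lemma dfn_SN_edge [dfn_intros]:
  assumes "tm SN 3 n s_seq e" "tm SN 3 n s_nat u" "tm SN 3 n s_nat v"
  shows "dfn SN 3 n (\<lambda>x. edge (e x) (u x) (v x))"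
proof (rule dfn_subst3[where R = edge, OF _ assms])
  show "dfn SN 3 3 (\<lambda>e. edge (s_seq (e 0)) (s_nat (e 1)) (s_nat (e 2)))"
    by (rule dfn_cong[OF _ SN_edge_iff[symmetric, OF env_seq]])
      (unfold code2_def, intro dfn_intros; simp)
qed

section \<open>Coded hereditarily finite sets as a definable sort\<close>

lemma local_bisim_iff:
  assumes "s \<in> lists U"
  shows "local_bisim s e s' e' R u u' \<longleftrightarrow>
     (\<exists>z\<in>univ SN. atE s u z \<and> atE s' u' z) \<or>
     \<not> (1 \<le> u \<and> u \<le> length s) \<and> \<not> (1 \<le> u' \<and> u' \<le> length s') \<and>
       (\<forall>w. w < u \<and> edge e w u \<longrightarrow> (\<exists>w'. w' < u' \<and> edge e' w' u' \<and> R w w')) \<and>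
       (\<forall>w'. w' < u' \<and> edge e' w' u' \<longrightarrow> (\<exists>w. w < u \<and> edge e w u \<and> R w w'))"
proof -
  have "(\<exists>z\<in>univ SN. atE s u z \<and> atE s' u' z) \<longleftrightarrow> (\<exists>a. at s u a \<and> at s' u' a)"
    using at_in[OF _ assms] unfolding atE_def univ_SN by blast
  then show ?thesis unfolding local_bisim_def by simp
qed

lemma seqof_coord: "env SN 3 e \<Longrightarrow> j < 3 \<Longrightarrow> seqof (e i ! j) \<in> lists U"
proof -
  assume "env SN 3 e" "j < 3"
  then have "e i ! j \<in> univ SN" using env_tuple[of SN 3 e i] by (auto simp: tuples_def)
  then show ?thesis by (auto simp: univ_SN)
qed

lemma val_eq_formula:
  assumes "s \<in> lists U"
  shows "val s e v = val s' e' v' \<longleftrightarrow>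
    (\<exists>B\<in>lists U. edge B v v' \<and> (\<forall>u. \<forall>u'. edge B u u' \<longrightarrow>
     (\<exists>z\<in>univ SN. atE s u z \<and> atE s' u' z) \<or>
     \<not> (1 \<le> u \<and> u \<le> length s) \<and> \<not> (1 \<le> u' \<and> u' \<le> length s') \<and>
       (\<forall>w. w < u \<and> edge e w u \<longrightarrow> (\<exists>w'. w' < u' \<and> edge e' w' u' \<and> edge B w w')) \<and>
       (\<forall>w'. w' < u' \<and> edge e' w' u' \<longrightarrow> (\<exists>w. w < u \<and> edge e w u \<and> edge B w w'))))"
  unfolding val_eq_iff[OF ab] local_bisim_iff[OF assms] ..

lemma s_hf_eq_val: "dfn SN 3 4 (\<lambda>e. s_hf (e 0) = val (s_seq (e 1)) (s_seq (e 2)) (s_nat (e 3)))"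
  unfolding s_hf_def
  by (rule dfn_cong[OF _ val_eq_formula[symmetric, OF seqof_coord]], (intro dfn_intros; simp), simp_all)

lemma s_hf_eq: "dfn SN 3 2 (\<lambda>e. s_hf (e 0) = s_hf (e 1))"
  unfolding s_hf_def
  by (rule dfn_cong[OF _ val_eq_formula[symmetric, OF seqof_coord]], (intro dfn_intros; simp), simp_all)

lemma dfn_eq_val:
  assumes "tm SN 3 n s_hf z" "tm SN 3 n s_seq s" "tm SN 3 n s_seq t" "tm SN 3 n s_nat v"
  shows "dfn SN 3 n (\<lambda>e. z e = val (s e) (t e) (v e))"
  by (rule dfn_subst4[where R = "\<lambda>z s t v. z = val s t v", OF s_hf_eq_val assms])

lemma s_hf_range: "s_hf ` tuples (univ SN) 3 = HF U"
proof (intro equalityI subsetI)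
  fix z assume "z \<in> HF U"
  from val_ex[OF ab this] obtain s e v where "s \<in> lists U" "e \<in> lists U" "val s e v = z"
    by blast
  then show "z \<in> s_hf ` tuples (univ SN) 3"
    by (intro image_eqI[of _ _ "[Seq s, Seq e, Num v]"]) (auto simp: s_hf_def tuples_def univ_SN)
next
  fix z assume "z \<in> s_hf ` tuples (univ SN) 3"
  then obtain t where t: "t \<in> tuples (univ SN) 3" "z = s_hf t" by blast
  then have "t ! 0 \<in> univ SN" by (auto simp: tuples_def)
  then have "seqof (t ! 0) \<in> lists U" by (auto simp: univ_SN)
  then show "z \<in> HF U" unfolding t(2) s_hf_def by (rule val_HF)
qed

sublocale shf: hf_sort SN 3 s_hf U
proof
  show "dfn SN 3 2 (\<lambda>e. s_hf (e 0) \<in> els (s_hf (e 1)))"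
  proof (rule dfn_cong)
    \<comment> \<open>Members are the values of smaller neighbours under the same two sequences, so
      membership reduces to equality of values.\<close>
    show "dfn SN 3 2 (\<lambda>e. \<not> (1 \<le> numof (e 1 ! 2) \<and> numof (e 1 ! 2) \<le> length (seqof (e 1 ! 0))) \<and>
        (\<exists>u. u < numof (e 1 ! 2) \<and> edge (seqof (e 1 ! 1)) u (numof (e 1 ! 2)) \<and>
          s_hf (e 0) = val (seqof (e 1 ! 0)) (seqof (e 1 ! 1)) u))"
      by (intro dfn_intros dfn_eq_val tm_var[OF s_hf_eq]; simp)
    fix e
    show "(\<not> (1 \<le> numof (e 1 ! 2) \<and> numof (e 1 ! 2) \<le> length (seqof (e 1 ! 0))) \<and>
        (\<exists>u. u < numof (e 1 ! 2) \<and> edge (seqof (e 1 ! 1)) u (numof (e 1 ! 2)) \<and>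
          s_hf (e 0) = val (seqof (e 1 ! 0)) (seqof (e 1 ! 1)) u)) \<longleftrightarrow> s_hf (e 0) \<in> els (s_hf (e 1))"
    proof (cases "1 \<le> numof (e 1 ! 2) \<and> numof (e 1 ! 2) \<le> length (seqof (e 1 ! 0))")
      case True
      then have "is_Ur (s_hf (e 1))" by (simp add: s_hf_def)
      then show ?thesis using True by (auto simp: is_Ur_iff)
    next
      case False
      show ?thesis unfolding s_hf_def[of "e 1"] els_val[OF False] using False by auto
    qed
  qed
  show "dfn SN 3 1 (\<lambda>e. is_Ur (s_hf (e 0)))"
    unfolding s_hf_def is_Ur_val by (intro dfn_intros; simp)
qed (fact s_hf_range s_hf_eq)+

section \<open>Decoding elements, numbers and sequences from coded sets\<close>

lemma dfn_Ur_Elem [dfn_intros]: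
  assumes "tm SN 3 n s_hf t" "tm SN 3 n s_obj z"
  shows "dfn SN 3 n (\<lambda>e. \<exists>a. t e = Ur a \<and> z e = Elem a)"
proof (rule dfn_subst2[where R = "\<lambda>x z. \<exists>a. x = Ur a \<and> z = Elem a", OF _ assms])
  show "dfn SN 3 2 (\<lambda>e. \<exists>a. s_hf (e 0) = Ur a \<and> s_obj (e 1) = Elem a)"
  proof (rule dfn_cong)
    show "dfn SN 3 2 (\<lambda>e. atE (seqof (e 0 ! 0)) (numof (e 0 ! 2)) (s_obj (e 1)))"
      by (intro dfn_intros; simp)
  qed (auto simp: s_hf_def val_eq_Ur atE_def)
qed

lemma dfn_card [dfn_intros]:
  assumes "tm SN 3 n s_hf t" "tm SN 3 n s_nat k"
  shows "dfn SN 3 n (\<lambda>e. card (els (t e)) = k e)"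
proof (rule dfn_subst2[where R = "\<lambda>x n. card (els x) = n", OF _ assms])
  show "dfn SN 3 2 (\<lambda>e. card (els (s_hf (e 0))) = s_nat (e 1))"
    by (rule dfn_cong[OF _ card_els_eq_iff[symmetric, OF ab shf.env_HF]])
      (intro dfn_eq_val dfn_intros; simp)
qed

lemma dfn_slotE [dfn_intros]:
  assumes "tm SN 3 n s_hf y" "tm SN 3 n s_nat i" "tm SN 3 n s_obj w"
  shows "dfn SN 3 n (\<lambda>e. slotE (y e) (i e) (w e))"
proof (rule dfn_subst3[where R = slotE, OF _ assms])
  show "dfn SN 3 3 (\<lambda>e. slotE (s_hf (e 0)) (s_nat (e 1)) (s_obj (e 2)))"
  proof (rule dfn_cong)
    show "dfn SN 3 3 (\<lambda>e. \<exists>q\<in>HF U. (\<exists>a. q = Ur a \<and> s_obj (e 2) = Elem a) \<and>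
        (\<exists>X\<in>HF U. pair X q \<in> els (s_hf (e 0)) \<and> card (els X) = s_nat (e 1)))"
      by (intro dfn_intros; simp)
    fix e assume e: "env SN 3 e"
    have "(\<exists>X\<in>HF U. pair X q \<in> els (s_hf (e 0)) \<and> card (els X) = s_nat (e 1)) \<longleftrightarrow>
        graph_at (s_hf (e 0)) (s_nat (e 1)) q" for q
      using graph_at_iff[OF shf.env_HF[OF e]] by simp
    then show "(\<exists>q\<in>HF U. (\<exists>a. q = Ur a \<and> s_obj (e 2) = Elem a) \<and>
        (\<exists>X\<in>HF U. pair X q \<in> els (s_hf (e 0)) \<and> card (els X) = s_nat (e 1))) \<longleftrightarrow>
        slotE (s_hf (e 0)) (s_nat (e 1)) (s_obj (e 2))"
      using graph_at_HF[OF shf.env_HF[OF e], of 0 "s_nat (e 1)"] by (force simp: slotE_def slot_def)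
  qed
qed

lemma dfn_SN_codes_seq [dfn_intros]:
  assumes "tm SN 3 n s_hf y" "tm SN 3 n s_seq s"
  shows "dfn SN 3 n (\<lambda>e. codes_seq (y e) (s e))"
proof (rule dfn_subst2[where R = codes_seq, OF _ assms])
  show "dfn SN 3 2 (\<lambda>e. codes_seq (s_hf (e 0)) (s_seq (e 1)))"
    by (rule dfn_cong[OF _ codes_seq_iff[symmetric, OF shf.env_HF env_seq]])
      (intro dfn_intros; simp)
qed

lemma dfn_SN_empty [dfn_intros]:
  assumes "tm SN 3 n s_hf t" shows "dfn SN 3 n (\<lambda>e. els (t e) = {})"
proof (rule dfn_subst1[where R = "\<lambda>x. els x = {}", OF _ assms])
  have "dfn SN 3 1 (\<lambda>e. \<forall>w\<in>HF U. \<not> w \<in> els (s_hf (e 0)))"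
    by (intro dfn_intros; simp)
  then show "dfn SN 3 1 (\<lambda>e. els (s_hf (e 0)) = {})"
    by (rule dfn_cong) (use els_HF[OF shf.env_HF] in blast)
qed

lemma composite_SN_definable:
  "dfn SN 3 (Suc 2) (\<lambda>e. e 2 ! 0 = h_sn (map s_hf (map e [0..<2])))"
proof -
  have "dfn SN 3 3 (\<lambda>e. s_obj (e 2) = mk (s_hf (e 0)) (s_hf (e 1)))"
  proof (rule dfn_cong)
    \<comment> \<open>The disjuncts follow the cases of \<open>mk\<close>; the innermost disjunction
      is \<open>s = dec y\<close> as unfolded by \<open>dec_eq_iff\<close>.\<close>
    show "dfn SN 3 3 (\<lambda>e. (\<exists>a. s_hf (e 0) = Ur a \<and> s_obj (e 2) = Elem a) \<or>
        \<not> is_Ur (s_hf (e 0)) \<and> els (s_hf (e 0)) = {} \<and>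
          (\<exists>n. s_obj (e 2) = Num n \<and> card (els (s_hf (e 1))) = n) \<or>
        \<not> is_Ur (s_hf (e 0)) \<and> \<not> els (s_hf (e 0)) = {} \<and>
          (\<exists>s\<in>lists U. s_obj (e 2) = Seq s \<and>
             (codes_seq (s_hf (e 1)) s \<or>
              \<not> (\<exists>s'\<in>lists U. codes_seq (s_hf (e 1)) s') \<and> length s = 0)))"
      by (intro dfn_intros; simp)
    fix e assume e: "env SN 3 e"
    have *: "(\<exists>s'\<in>lists U. codes_seq (s_hf (e 1)) s') \<longleftrightarrow> (\<exists>s'. codes_seq (s_hf (e 1)) s')"
      using codes_seq_lists[OF shf.env_HF[OF e]] by blast
    show "((\<exists>a. s_hf (e 0) = Ur a \<and> s_obj (e 2) = Elem a) \<or>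
        \<not> is_Ur (s_hf (e 0)) \<and> els (s_hf (e 0)) = {} \<and>
          (\<exists>n. s_obj (e 2) = Num n \<and> card (els (s_hf (e 1))) = n) \<or>
        \<not> is_Ur (s_hf (e 0)) \<and> \<not> els (s_hf (e 0)) = {} \<and>
          (\<exists>s\<in>lists U. s_obj (e 2) = Seq s \<and>
             (codes_seq (s_hf (e 1)) s \<or>
              \<not> (\<exists>s'\<in>lists U. codes_seq (s_hf (e 1)) s') \<and> length s = 0))) \<longleftrightarrow>
        s_obj (e 2) = mk (s_hf (e 0)) (s_hf (e 1))"
      unfolding * dec_eq_iff[symmetric]
    proof (cases "s_hf (e 0)")
      case (HSet X)
      have "fset X = {} \<longleftrightarrow> X = {||}" by (simp add: fset_inject[symmetric])
      then show "((\<exists>a. s_hf (e 0) = Ur a \<and> s_obj (e 2) = Elem a) \<or>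
        \<not> is_Ur (s_hf (e 0)) \<and> els (s_hf (e 0)) = {} \<and>
          (\<exists>n. s_obj (e 2) = Num n \<and> card (els (s_hf (e 1))) = n) \<or>
        \<not> is_Ur (s_hf (e 0)) \<and> \<not> els (s_hf (e 0)) = {} \<and>
          (\<exists>s\<in>lists U. s_obj (e 2) = Seq s \<and> s = dec (s_hf (e 1)))) \<longleftrightarrow>
        s_obj (e 2) = mk (s_hf (e 0)) (s_hf (e 1))"
        using dec_lists[OF shf.env_HF[OF e, of 1]] HSet by simp
    qed simp
  qed
  then show ?thesis by (simp add: h_sn_def h_obj_def s_obj_def upt_numeral)
qed

lemma HF_rel_definable:
  assumes "r \<in> syms H"
  shows "dfn SN 3 (arity H r) (\<lambda>e. rel H r (map (\<lambda>i. s_hf (e i)) [0..<arity H r]))"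
proof -
  have rel: "rel H = hf_rel A" and arity: "arity H = hf_arity (arity A)"
    by (simp_all add: HF_structure_def)
  show ?thesis
  proof (cases r)
    case (HF_base q)
    have q: "q \<in> syms A" using assms HF_base by (auto simp: HF_structure_def)
    let ?k = "arity A q"
    let ?ijs = "map (\<lambda>i. (i, 0)) [0..<?k]"
    \<comment> \<open>The element behind an urelement code is an entry of a sequence, not a
      component of the code, so it must be fetched by \<open>dfn_comp\<close>. Other codes get the
      dummy \<open>Num 0\<close>, which is not an element and thus satisfies no base relation, just
      like a set.\<close>
    let ?C = "\<lambda>i x e. (\<exists>a. s_hf (e i) = Ur a \<and> s_obj x = Elem a) \<or>
        \<not> is_Ur (s_hf (e i)) \<and> s_obj x = Num 0"
    have "dfn SN 3 ?k (\<lambda>e. rel SN (SN_base q) (map (\<lambda>(i, j). e i ! j) ?ijs))"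
      by (rule dfn_rel) (use q in \<open>auto simp: SN_structure_def\<close>)
    then have "dfn SN 3 ?k (\<lambda>e. hf_rel A (HF_base q) (map (\<lambda>i. s_hf (e i)) [0..<?k]))"
    proof (rule dfn_comp[where C = ?C])
      show "dfn SN 3 (Suc ?k) (\<lambda>e. (\<exists>a. s_hf (e (Suc i)) = Ur a \<and> s_obj (e 0) = Elem a) \<or>
          \<not> is_Ur (s_hf (e (Suc i))) \<and> s_obj (e 0) = Num 0)" if "i < ?k" for i
        using that by (intro dfn_intros; simp)
      show "\<exists>x\<in>tuples (univ SN) 3. ?C i x e" if "env SN 3 e" for i e
      proof -
        have "\<exists>z\<in>univ SN. (\<exists>a. s_hf (e i) = Ur a \<and> z = Elem a) \<or> \<not> is_Ur (s_hf (e i)) \<and> z = Num 0"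
          using shf.env_HF[OF that, of i] by (cases "s_hf (e i)") (auto simp: univ_SN)
        then obtain z where "z \<in> univ SN"
          "(\<exists>a. s_hf (e i) = Ur a \<and> z = Elem a) \<or> \<not> is_Ur (s_hf (e i)) \<and> z = Num 0" by blast
        moreover obtain x where "x \<in> tuples (univ SN) 3" "z = s_obj x"
          using s_obj_range \<open>z \<in> univ SN\<close> by blast
        ultimately show ?thesis by auto
      qed
      fix e h
      assume *: "\<And>i. i < ?k \<Longrightarrow> ?C i (h i) e"
      have "map (\<lambda>i. h i ! 0) [0..<?k] = map Elem as \<longleftrightarrow>
          map (\<lambda>i. s_hf (e i)) [0..<?k] = map Ur as" if "length as = ?k" for as
      proof -
        have "h i ! 0 = Elem a \<longleftrightarrow> s_hf (e i) = Ur a" if "i < ?k" for i a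
          using *[OF that] by (auto simp: s_obj_def is_Ur_iff)
        then show ?thesis using that by (auto simp: list_eq_iff_nth_eq)
      qed
      then show "rel SN (SN_base q) (map (\<lambda>(i, j). h i ! j) ?ijs) =
          hf_rel A (HF_base q) (map (\<lambda>i. s_hf (e i)) [0..<?k])"
        by (auto simp: SN_structure_def tuples_def comp_def)
    qed
    then show ?thesis by (simp add: rel arity HF_base)
  next
    case HF_P
    have "dfn SN 3 1 (\<lambda>e. is_Ur (s_hf (e 0)))" by (intro dfn_intros; simp)
    then have "dfn SN 3 1 (\<lambda>e. hf_rel A HF_P [s_hf (e 0)])"
    proof (rule dfn_cong)
      fix e assume "env SN 3 e"
      from shf.env_HF[OF this, of 0] show "is_Ur (s_hf (e 0)) = hf_rel A HF_P [s_hf (e 0)]"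
        by (cases "s_hf (e 0)") auto
    qed
    then show ?thesis by (simp add: rel arity HF_P)
  next
    case HF_mem
    have "dfn SN 3 2 (\<lambda>e. s_hf (e 0) \<in> els (s_hf (e 1)))" by (intro dfn_intros; simp)
    then have "dfn SN 3 2 (\<lambda>e. hf_rel A HF_mem [s_hf (e 0), s_hf (e 1)])"
    proof (rule dfn_cong)
      fix e show "s_hf (e 0) \<in> els (s_hf (e 1)) \<longleftrightarrow> hf_rel A HF_mem [s_hf (e 0), s_hf (e 1)]"
        by (cases "s_hf (e 1)") auto
    qed
    then show ?thesis by (simp add: rel arity HF_mem upt_numeral)
  qed
qed

section \<open>Assembly of the two interpretations\<close>

lemma map_in_tuples:
  assumes "f ` T = V" "xss \<in> tuples T k" shows "map f xss \<in> tuples V k"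
  using assms by (auto simp: tuples_def)

lemma bi_interpretable: "absolutely_bi_interpretable H SN"
proof -
  have ne: "univ H \<noteq> {}" "univ SN \<noteq> {}"
    using infinite_HF[of U] by (auto simp: univ_HF univ_SN)
  obtain \<Gamma> where \<Gamma>: "interpretation_via H SN \<Gamma> s_hf" "code_dim \<Gamma> = 3"
    "dom_set \<Gamma> SN = tuples (univ SN) 3"
    by (rule interpretation_total[OF _ ne(2) _ shf.eq HF_rel_definable])
      (auto simp: s_hf_range univ_HF)
  obtain \<Delta> where \<Delta>: "interpretation_via SN H \<Delta> h_sn" "code_dim \<Delta> = 2"
    "dom_set \<Delta> H = tuples (univ H) 2"
    by (rule interpretation_total[OF _ ne(1) h_sn_range h_sn_eq SN_rel_definable]) auto
  \<comment> \<open>Since every tuple is a code, the side condition in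
    \<open>composite_graph\<close> holds automatically and the graph has the form treated by
    \<open>definable_graph\<close>.\<close>
  have 1: "composite_graph H SN \<Gamma> s_hf \<Delta> h_sn =
      {concat xss @ [s_hf (map h_sn xss)] | xss. xss \<in> tuples (tuples (univ H) 2) 3}"
    unfolding composite_graph_def \<Gamma>(2,3) \<Delta>(3)
    using map_in_tuples[OF h_sn_range] by blast
  have 2: "composite_graph SN H \<Delta> h_sn \<Gamma> s_hf =
      {concat xss @ [h_sn (map s_hf xss)] | xss. xss \<in> tuples (tuples (univ SN) 3) 2}"
    unfolding composite_graph_def \<Delta>(2,3) \<Gamma>(3)
    using map_in_tuples[OF s_hf_range[folded univ_HF]] by blast
  have "definable H (3 * 2 + 1) (composite_graph H SN \<Gamma> s_hf \<Delta> h_sn)"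
    unfolding 1
  proof (rule definable_graph[OF _ ne(1) _ composite_HF_definable])
    show "s_hf (map h_sn xss) \<in> univ H" if "xss \<in> tuples (tuples (univ H) 2) 3" for xss
      using map_in_tuples[OF h_sn_range that] s_hf_range unfolding univ_HF by blast
  qed simp
  moreover have "definable SN (2 * 3 + 1) (composite_graph SN H \<Delta> h_sn \<Gamma> s_hf)"
    unfolding 2
  proof (rule definable_graph[OF _ ne(2) _ composite_SN_definable])
    show "h_sn (map s_hf xss) \<in> univ SN" if "xss \<in> tuples (tuples (univ SN) 3) 2" for xss
      using map_in_tuples[OF s_hf_range[folded univ_HF] that] h_sn_range by blast
  qed simp
  ultimately show ?thesis
    unfolding absolutely_bi_interpretable_def using \<Gamma>(1,2) \<Delta>(1,2) by metis
qed

end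

theorem theorem3p2:
  fixes A :: "('f, 'r, 'a) fo_structure"
  assumes "is_structure A"
    and "\<exists>a\<in>fo_univ A. \<exists>b\<in>fo_univ A. a \<noteq> b"
  shows "absolutely_bi_interpretable
           (HF_structure (graph_structure A)) (SN_structure (graph_structure A))"
proof -
  obtain a b where ab: "a \<in> fo_univ A" "b \<in> fo_univ A" "a \<noteq> b" using assms(2) by blast
  interpret two_elements "graph_structure A" a b
    by unfold_locales (use ab in \<open>auto simp: graph_structure_def\<close>)
  show ?thesis by (rule bi_interpretable)
qed

end
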